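(* Let $n\ge 3$ and $\Lambda<0$. Let $\mathcal H$ be the completion of $C^\infty_c((0,\infty),\mathbb C)$ with respect to the norm induced by the bilinear form \[ B(w,\tilde w)=\int_0^\infty\Big\{\frac 1{32}\frac{n^2}{n-1}\bar w'\tilde w'+n|\Lambda| t^2\bar w\tilde w\Big\}\,dt, \] and let $K(w,\tilde w)=\int_0^\infty t^{2-\frac4n}\bar w\tilde w\,dt$. Then the generalized eigenvalue problem \[ B(w,\varphi)=\lambda K(w,\varphi)\quad\forall\,\varphi\in\mathcal H \] (equivalently, $-\frac1{32} \frac{n^2}{n-1}\ddot w+n|\Lambda| t^2w=\lambda t^{2-\frac4n}w$ in $H^{1,2}_0((0,\infty))$) has countably many solutions $(w_i,\lambda_i)$ such that $0<\lambda_0<\lambda_1<\lambda_2<\cdots$, $\lim_i\lambda_i=\infty$, and $K(w_i,w_j)=\delta_{ij}$. The $w_i$ are complete in $\mathcal H$ as well as in $L^2((0,\infty))$. *)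

theory Defs
  imports "HOL-Analysis.Analysis"
begin

definition vd :: "(real \<Rightarrow> complex) \<Rightarrow> real \<Rightarrow> complex" where
  "vd f = (\<lambda>t. vector_derivative f (at t))"

definition test_fun :: "(real \<Rightarrow> complex) \<Rightarrow> bool" where
  "test_fun \<phi> \<longleftrightarrow>
     (\<forall>k t. ((vd ^^ k) \<phi>) differentiable (at t)) \<and>
     (\<exists>a b. 0 < a \<and> a < b \<and> (\<forall>t. t \<notin> {a..b} \<longrightarrow> \<phi> t = 0))"

definition cB :: "nat \<Rightarrow> real" where
  "cB n = (1/32) * (real n)^2 / (real n - 1)"

definition Bnorm2 :: "nat \<Rightarrow> real \<Rightarrow> (real \<Rightarrow> complex) \<Rightarrow> (real \<Rightarrow> complex) \<Rightarrow> ennreal" where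
  "Bnorm2 n \<Lambda> w w' =
     (\<integral>\<^sup>+ t\<in>{0<..}. ennreal (cB n * (norm (w' t))^2 + real n * \<bar>\<Lambda>\<bar> * t^2 * (norm (w t))^2) \<partial>lborel)"

text \<open>The completion \<H> of the test functions w.r.t. the B-norm, realised concretely:
  an element is a (measurable) function w together with its (weak) derivative w',
  which are the limits of a B-Cauchy sequence of test functions.\<close>
definition in_H :: "nat \<Rightarrow> real \<Rightarrow> (real \<Rightarrow> complex) \<Rightarrow> (real \<Rightarrow> complex) \<Rightarrow> bool" where
  "in_H n \<Lambda> w w' \<longleftrightarrow>
     w \<in> borel_measurable lborel \<and> w' \<in> borel_measurable lborel \<and>
     (\<exists>\<phi> :: nat \<Rightarrow> real \<Rightarrow> complex. (\<forall>k. test_fun (\<phi> k)) \<and>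
        ((\<lambda>k. Bnorm2 n \<Lambda> (\<lambda>t. \<phi> k t - w t) (\<lambda>t. vd (\<phi> k) t - w' t)) \<longlonglongrightarrow> 0))"

definition formB :: "nat \<Rightarrow> real \<Rightarrow> (real \<Rightarrow> complex) \<Rightarrow> (real \<Rightarrow> complex)
    \<Rightarrow> (real \<Rightarrow> complex) \<Rightarrow> (real \<Rightarrow> complex) \<Rightarrow> complex" where
  "formB n \<Lambda> w w' v v' =
     (LINT t:{0<..}|lborel. of_real (cB n) * cnj (w' t) * v' t
                            + of_real (real n * \<bar>\<Lambda>\<bar> * t^2) * cnj (w t) * v t)"

definition formK :: "nat \<Rightarrow> (real \<Rightarrow> complex) \<Rightarrow> (real \<Rightarrow> complex) \<Rightarrow> complex" where
  "formK n w v = (LINT t:{0<..}|lborel. of_real (t powr (2 - 4 / real n)) * cnj (w t) * v t)"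

end

theory Submission
  imports Defs "HOL-Library.Function_Algebras" "HOL-Complex_Analysis.Great_Picard"
begin

text \<open>
  The eigenfunctions are found variationally, among real-valued functions. Maximizing \<open>K\<close> on the
  \<open>B\<close>-unit ball of the \<open>B\<close>-orthogonal complement of the eigenfunctions found so far produces the next
  one: by compactness a maximizing sequence has a \<open>K\<close>-Cauchy subsequence, and the parallelogram laws
  make this subsequence \<open>B\<close>-Cauchy, so no weak topology is needed. Compactness also forces the
  eigenvalues to infinity, and then the part of a vector orthogonal to all eigenfunctions has
  \<open>K\<close>-norm zero.

  Compactness holds because \<open>w(t) = \<integral>\<^sub>0\<^sup>t w'\<close> is Hoelder continuous with exponent one half, bounded in
  terms of \<open>B\<close>; a diagonal argument gives pointwise convergence, and the weight
  \<open>t\<^bsup>2 - 4/n\<^esup>\<close> is negligible against \<open>t\<^sup>2\<close> at infinity. Testing the weak equation with primitives of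
  \<open>\<psi> - \<psi>(\<cdot> - s)\<close> shows that \<open>w + \<integral>\<integral> q w\<close> is additive, hence that \<open>w\<close> solves a second order equation
  with \<open>w(0) = 0\<close>; so eigenvalues are simple.
\<close>

section \<open>Compact pairs of quadratic forms\<close>

text \<open>Elements of the form domain are pairs of functions, not classes modulo null sets, so the
  forms are only positive semidefinite; the eigenvalue argument gets by with
  \<open>K x x = 0\<close> implying \<open>B x x = 0\<close>. Real scalars suffice because both
  forms have real coefficients, and complex elements are treated through real and imaginary parts.
  The obstacle is strictness of the eigenvalues: the variational construction gives only a weakly
  increasing sequence, and simplicity needs uniqueness for an initial value problem at
  \<open>t = 0\<close>, where a weak solution is known to be continuous and no more. Hence the
  equation is used in integrated form. The translate of \<psi> is subtracted because a test function
  is the derivative of a test function only if its integral vanishes. The exponent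
  \<open>p = 2 - 4/n\<close> satisfies \<open>0 < p < 2\<close>: the upper bound makes tails of
  \<open>K\<close> small against \<open>B\<close>, the lower bound makes the potential continuous at
  0. Completeness in \<open>L2\<close> follows from completeness in \<open>B\<close>, since test
  functions are dense in \<open>L2\<close> and the \<open>B\<close>-norm dominates the
  \<open>L2\<close>-norm.\<close>

locale semi_inner =
  fixes V :: "'a::real_vector set" and B :: "'a \<Rightarrow> 'a \<Rightarrow> real"
  assumes V: "subspace V"
    and add_left: "\<lbrakk>x \<in> V; y \<in> V; z \<in> V\<rbrakk> \<Longrightarrow> B (x + y) z = B x z + B y z"
    and scale_left: "\<lbrakk>x \<in> V; y \<in> V\<rbrakk> \<Longrightarrow> B (a *\<^sub>R x) y = a * B x y"
    and sym: "\<lbrakk>x \<in> V; y \<in> V\<rbrakk> \<Longrightarrow> B x y = B y x"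
    and nonneg: "x \<in> V \<Longrightarrow> 0 \<le> B x x"
begin

abbreviation quad :: "'a \<Rightarrow> real" where "quad x \<equiv> B x x"

lemmas closed = subspace_add[OF V] subspace_scale[OF V] subspace_diff[OF V] subspace_0[OF V]
  subspace_neg[OF V] subspace_sum[OF V]

lemma add_right: "\<lbrakk>x \<in> V; y \<in> V; z \<in> V\<rbrakk> \<Longrightarrow> B z (x + y) = B z x + B z y"
  by (metis add_left closed(1) sym)

lemma scale_right: "\<lbrakk>x \<in> V; y \<in> V\<rbrakk> \<Longrightarrow> B y (a *\<^sub>R x) = a * B y x"
  by (metis scale_left closed(2) sym)

lemma diff_left: "\<lbrakk>x \<in> V; y \<in> V; z \<in> V\<rbrakk> \<Longrightarrow> B (x - y) z = B x z - B y z"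
  using add_left[of "x - y" y z] closed(3)[of x y] by simp

lemma diff_right: "\<lbrakk>x \<in> V; y \<in> V; z \<in> V\<rbrakk> \<Longrightarrow> B z (x - y) = B z x - B z y"
  using add_right[of "x - y" y z] closed(3)[of x y] by simp

lemma zero_left: "y \<in> V \<Longrightarrow> B 0 y = 0"
  using scale_left[of 0 y 0] closed(4) by simp

lemma zero_right: "y \<in> V \<Longrightarrow> B y 0 = 0"
  using scale_right[of 0 y 0] closed(4) by simp

lemma sum_left:
  assumes "finite I" "\<And>i. i \<in> I \<Longrightarrow> f i \<in> V" "y \<in> V"
  shows "B (\<Sum>i\<in>I. f i) y = (\<Sum>i\<in>I. B (f i) y)"
  using assms by (induction I) (auto simp: zero_left add_left closed)

lemma sum_right:
  assumes "finite I" "\<And>i. i \<in> I \<Longrightarrow> f i \<in> V" "y \<in> V"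
  shows "B y (\<Sum>i\<in>I. f i) = (\<Sum>i\<in>I. B y (f i))"
  using assms by (induction I) (auto simp: zero_right add_right closed)

lemmas bilin = add_left add_right diff_left diff_right scale_left scale_right closed

lemma quad_add: "\<lbrakk>x \<in> V; y \<in> V\<rbrakk> \<Longrightarrow> quad (x + y) = B x x + 2 * B x y + B y y"
  using sym[of x y] by (simp add: bilin)

lemma quad_diff: "\<lbrakk>x \<in> V; y \<in> V\<rbrakk> \<Longrightarrow> quad (x - y) = B x x - 2 * B x y + B y y"
  using sym[of x y] by (simp add: bilin)

lemma quad_scale: "x \<in> V \<Longrightarrow> quad (a *\<^sub>R x) = a\<^sup>2 * B x x"
  by (simp add: bilin power2_eq_square)

lemma quad_diff_commute: "\<lbrakk>x \<in> V; y \<in> V\<rbrakk> \<Longrightarrow> quad (x - y) = quad (y - x)"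
  using sym[of x y] by (simp add: bilin)

text \<open>If \<open>B y y = 0\<close>, the quadratic in \<open>s\<close> is affine, and an affine
  function bounded below has slope zero. Otherwise \<open>s = - B x y / B y y\<close> minimizes
  it.\<close>

lemma Cauchy_Schwarz:
  assumes "x \<in> V" "y \<in> V"
  shows "(B x y)\<^sup>2 \<le> B x x * B y y"
proof -
  have quad: "0 \<le> B x x + 2 * s * B x y + s\<^sup>2 * B y y" for s
    using nonneg[of "x + s *\<^sub>R y"] assms quad_add[of x "s *\<^sub>R y"]
    by (simp add: bilin power2_eq_square)
  show ?thesis
  proof (cases "B y y = 0")
    case True
    have "B x y = 0"
    proof (rule ccontr)
      assume "B x y \<noteq> 0"
      \<comment> \<open>At this \<open>s\<close> the affine function would take the value
        \<open>-1\<close>.\<close>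
      with quad[of "- (B x x + 1) / (2 * B x y)"] True show False
        by (simp add: field_simps)
    qed
    then show ?thesis using True by simp
  next
    case False
    then have pos: "B y y > 0" using nonneg[OF assms(2)] by simp
    have "0 \<le> B x x - (B x y)\<^sup>2 / B y y"
      using quad[of "- B x y / B y y"] pos by (simp add: field_simps power2_eq_square)
    then show ?thesis using pos by (simp add: field_simps)
  qed
qed

lemma tendsto_inner:
  assumes X: "\<And>k. X k \<in> V" and l: "l \<in> V" and y: "y \<in> V"
    and lim: "(\<lambda>k. quad (X k - l)) \<longlonglongrightarrow> 0"
  shows "(\<lambda>k. B (X k) y) \<longlonglongrightarrow> B l y"
proof -
  have "(\<lambda>k. (B (X k - l) y)\<^sup>2) \<longlonglongrightarrow> 0"
  proof (rule tendsto_sandwich[OF _ _ tendsto_const])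
    show "(\<lambda>k. quad (X k - l) * B y y) \<longlonglongrightarrow> 0"
      using tendsto_mult_left_zero[OF lim] by simp
    show "\<forall>\<^sub>F k in sequentially. (B (X k - l) y)\<^sup>2 \<le> quad (X k - l) * B y y"
      using Cauchy_Schwarz X l y closed by simp
  qed simp
  then have "(\<lambda>k. B (X k - l) y) \<longlonglongrightarrow> 0"
    using tendsto_null_power by (simp add: tendsto_null_power)
  then have "(\<lambda>k. B (X k) y - B l y) \<longlonglongrightarrow> 0"
    using X l y by (simp add: bilin)
  then show ?thesis by (simp add: LIM_zero_iff)
qed

lemma tendsto_quad:
  assumes X: "\<And>k. X k \<in> V" and l: "l \<in> V"
    and lim: "(\<lambda>k. quad (X k - l)) \<longlonglongrightarrow> 0"
  shows "(\<lambda>k. quad (X k)) \<longlonglongrightarrow> B l l"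
proof -
  have "(\<lambda>k. quad (X k - l) + 2 * B (X k) l - B l l) \<longlonglongrightarrow> 0 + 2 * B l l - B l l"
    by (intro tendsto_intros lim tendsto_inner X l)
  moreover have "quad (X k - l) + 2 * B (X k) l - B l l = quad (X k)" for k
    using quad_diff[OF X l] by simp
  ultimately show ?thesis by simp
qed

text \<open>The parallelogram law with \<open>quad (x - y)\<close> dropped. It replaces the triangle
  inequality, which is why errors are split into quarters below.\<close>

lemma quad_add_le:
  assumes "x \<in> V" "y \<in> V"
  shows "quad (x + y) \<le> 2 * B x x + 2 * B y y"
  using quad_add[OF assms] quad_diff[OF assms] nonneg[OF closed(3)[OF assms]] by simp

text \<open>Closure for the seminorm \<open>sqrt (quad v)\<close>, expressed without a topology on
  the type. It serves twice: to define the form domain and to express density in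
  \<open>L2\<close>.\<close>

definition form_closure :: "'a set \<Rightarrow> 'a set" where
  "form_closure S = {v \<in> V. \<forall>e>0. \<exists>s\<in>S. quad (v - s) < e}"

lemma form_closure_superset:
  assumes "S \<subseteq> V"
  shows "S \<subseteq> form_closure S"
proof
  fix x assume "x \<in> S"
  moreover have "quad (x - x) = 0" using zero_left closed(4) by simp
  ultimately show "x \<in> form_closure S"
    unfolding form_closure_def using assms by (intro CollectI conjI allI impI bexI[of _ x]) auto
qed

lemma form_closure_limit:
  assumes S: "S \<subseteq> V" and x: "x \<in> V"
    and lim: "\<And>e. e > 0 \<Longrightarrow> \<exists>y\<in>form_closure S. quad (x - y) < e"
  shows "x \<in> form_closure S"
  unfolding form_closure_def
proof (intro CollectI conjI x allI impI)
  fix e :: real assume "e > 0"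
  then have e4: "e / 4 > 0" by simp
  obtain y where y: "y \<in> form_closure S" "quad (x - y) < e / 4" using lim[OF e4] by blast
  obtain s where s: "s \<in> S" "quad (y - s) < e / 4"
    using y(1) e4 unfolding form_closure_def by blast
  have "x - y \<in> V" "y - s \<in> V" using x y(1) s(1) S closed unfolding form_closure_def by auto
  from quad_add_le[OF this] have "quad (x - s) < e" using y(2) s(2) by simp
  then show "\<exists>s\<in>S. quad (x - s) < e" using s(1) by blast
qed

lemma subspace_form_closure:
  assumes S: "subspace S" "S \<subseteq> V"
  shows "subspace (form_closure S)"
proof (rule subspaceI)
  show "0 \<in> form_closure S" using form_closure_superset[OF S(2)] subspace_0[OF S(1)] by blast
next
  fix x y assume xy: "x \<in> form_closure S" "y \<in> form_closure S"
  then have xyV: "x \<in> V" "y \<in> V" unfolding form_closure_def by auto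
  show "x + y \<in> form_closure S"
    unfolding form_closure_def
  proof (intro CollectI conjI closed(1) xyV allI impI)
    fix e :: real assume "e > 0"
    then have e4: "e / 4 > 0" by simp
    obtain s where s: "s \<in> S" "quad (x - s) < e / 4"
      using xy(1) e4 unfolding form_closure_def by blast
    obtain t where t: "t \<in> S" "quad (y - t) < e / 4"
      using xy(2) e4 unfolding form_closure_def by blast
    have "x - s \<in> V" "y - t \<in> V" using xyV s(1) t(1) S(2) closed by auto
    from quad_add_le[OF this] have "quad (x - s + (y - t)) < e" using s(2) t(2) by simp
    also have "x - s + (y - t) = x + y - (s + t)" by simp
    finally show "\<exists>s\<in>S. quad (x + y - s) < e" using subspace_add[OF S(1) s(1) t(1)] by blast
  qed
next
  fix a x assume x: "x \<in> form_closure S"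
  then have xV: "x \<in> V" unfolding form_closure_def by simp
  show "a *\<^sub>R x \<in> form_closure S"
    unfolding form_closure_def
  proof (intro CollectI conjI closed(2) xV allI impI)
    fix e :: real assume "e > 0"
    \<comment> \<open>The \<open>+ 1\<close> keeps the denominator positive when
      \<open>a = 0\<close>.\<close>
    then have "e / (a\<^sup>2 + 1) > 0" by (simp add: add_nonneg_pos)
    then obtain s where s: "s \<in> S" "quad (x - s) < e / (a\<^sup>2 + 1)"
      using x unfolding form_closure_def by blast
    have V': "x - s \<in> V" using xV s(1) S(2) closed by auto
    have "quad (a *\<^sub>R (x - s)) \<le> (a\<^sup>2 + 1) * quad (x - s)"
      unfolding quad_scale[OF V'] using nonneg[OF V'] by (intro mult_right_mono) auto
    also have "\<dots> < e" using s(2) pos_less_divide_eq[of "a\<^sup>2 + 1"]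
      by (simp add: add_nonneg_pos mult.commute)
    also have "a *\<^sub>R (x - s) = a *\<^sub>R x - a *\<^sub>R s" by (rule scaleR_diff_right)
    finally show "\<exists>s\<in>S. quad (a *\<^sub>R x - s) < e"
      using subspace_scale[OF S(1) s(1)] by blast
  qed
qed

end

text \<open>\<open>compact\<close> yields only a \<open>K\<close>-Cauchy subsequence; limits always
  come from \<open>complete\<close>, in the \<open>B\<close>-seminorm. \<open>definite\<close> turns
  a remainder of zero \<open>K\<close>-norm into one of zero \<open>B\<close>-norm, and
  \<open>infinite_dim\<close> ensures that the construction never runs out of vectors with positive
  \<open>K\<close>.\<close>

locale compact_form_pair =
  B: semi_inner V B + K: semi_inner V K for V :: "'a::real_vector set" and B K +
  assumes K_bound: "\<exists>C. \<forall>x\<in>V. K x x \<le> C * B x x"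
    and definite: "\<lbrakk>x \<in> V; K x x = 0\<rbrakk> \<Longrightarrow> B x x = 0"
    and complete: "\<lbrakk>\<And>k. X k \<in> V;
        \<And>e. e > 0 \<Longrightarrow> \<exists>N. \<forall>m\<ge>N. \<forall>k\<ge>N. B.quad (X m - X k) < e\<rbrakk>
      \<Longrightarrow> \<exists>l\<in>V. (\<lambda>k. B.quad (X k - l)) \<longlonglongrightarrow> 0"
    and compact: "\<lbrakk>\<And>k. X k \<in> V; \<And>k. B.quad (X k) \<le> 1\<rbrakk>
      \<Longrightarrow> \<exists>r::nat\<Rightarrow>nat. strict_mono r \<and>
        (\<forall>e>0. \<exists>N. \<forall>m\<ge>N. \<forall>k\<ge>N. K.quad (X (r m) - X (r k)) < e)"
    and infinite_dim: "\<exists>e::nat\<Rightarrow>'a. \<forall>i. e i \<in> V \<and> 0 < K.quad (e i) \<and>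
        (\<forall>j. i \<noteq> j \<longrightarrow> K (e i) (e j) = 0)"
begin

section \<open>Variational construction of eigenvectors\<close>

text \<open>Each \<open>f\<close> imposes one linear condition, and two consecutive members of a
  \<open>K\<close>-orthogonal sequence have a nontrivial combination satisfying it. Combining the
  members in pairs leaves an infinite \<open>K\<close>-orthogonal sequence, so the induction can
  continue without any dimension count.\<close>

lemma ex_B_orthogonal:
  assumes "finite F" "F \<subseteq> V"
  shows "\<exists>v\<in>V. 0 < K v v \<and> (\<forall>f\<in>F. B f v = 0)"
proof -
  have "\<exists>e::nat\<Rightarrow>'a. \<forall>i. e i \<in> V \<and> 0 < K.quad (e i) \<and>
        (\<forall>j. i \<noteq> j \<longrightarrow> K (e i) (e j) = 0) \<and> (\<forall>f\<in>F. B f (e i) = 0)"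
    using assms
  proof (induction F)
    case empty
    then show ?case using infinite_dim by simp
  next
    case (insert f F)
    have "F \<subseteq> V" using insert.prems by simp
    from insert.IH[OF this] obtain e :: "nat \<Rightarrow> 'a" where e: "\<And>i. e i \<in> V" "\<And>i. 0 < K.quad (e i)"
      "\<And>i j. i \<noteq> j \<Longrightarrow> K (e i) (e j) = 0" "\<And>i g. g \<in> F \<Longrightarrow> B g (e i) = 0" by blast
    have f: "f \<in> V" and FV: "\<And>g. g \<in> F \<Longrightarrow> g \<in> V" using insert by auto
    \<comment> \<open>The combination is \<open>B f (e (2*i+1))\<close> times \<open>e (2*i)\<close>
      minus \<open>B f (e (2*i))\<close> times \<open>e (2*i+1)\<close>. If both coefficients
      vanish, the default 1 makes \<open>h i\<close> equal to \<open>e (2*i)\<close> rather than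
      0.\<close>
    define a where "a i = (if B f (e (2*i+1)) = 0 \<and> B f (e (2*i)) = 0 then 1 else B f (e (2*i+1)))" for i
    define b where "b i = - B f (e (2*i))" for i
    define h where "h i = a i *\<^sub>R e (2*i) + b i *\<^sub>R e (2*i+1)" for i
    have hV: "h i \<in> V" for i unfolding h_def by (intro B.closed e)
    have K_h: "K.quad (h i) = (a i)\<^sup>2 * K.quad (e (2*i)) + (b i)\<^sup>2 * K.quad (e (2*i+1))" for i
      unfolding h_def using e(3)[of "2*i" "2*i+1"] e(3)[of "2*i+1" "2*i"]
      by (simp add: K.bilin e power2_eq_square algebra_simps)
    have pos: "0 < K.quad (h i)" for i
    proof -
      have "a i \<noteq> 0 \<or> b i \<noteq> 0" unfolding a_def b_def by auto
      then show ?thesis unfolding K_h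
        using e(2)[of "2*i"] e(2)[of "2*i+1"]
        by (auto intro: add_pos_nonneg add_nonneg_pos)
    qed
    have orth: "K (h i) (h j) = 0" if "i \<noteq> j" for i j
    proof -
      have "2*i \<noteq> 2*j" "2*i+1 \<noteq> 2*j+1" "2*i \<noteq> 2*j+1" "2*i+1 \<noteq> 2*j" using that by presburger+
      then show ?thesis unfolding h_def by (simp add: K.bilin e)
    qed
    have "B f (h i) = 0" for i
      unfolding h_def a_def b_def using f by (simp add: B.bilin e)
    moreover have "B g (h i) = 0" if "g \<in> F" for g i
      unfolding h_def using FV[OF that] e(4)[OF that] by (simp add: B.bilin e(1))
    ultimately show ?case using hV pos orth by (intro exI[of _ h]) auto
  qed
  then show ?thesis by blast
qed

lemma ex_minimizer:
  assumes F: "finite F" "F \<subseteq> V"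
  defines "U \<equiv> {v\<in>V. \<forall>f\<in>F. B f v = 0}"
  shows "\<exists>u\<in>U. \<exists>l>0. K u u = 1 \<and> B u u = l \<and> (\<forall>v\<in>U. l * K v v \<le> B v v)"
proof -
  have UV: "v \<in> V" if "v \<in> U" for v using that unfolding U_def by simp
  have Uadd: "x + y \<in> U" if "x \<in> U" "y \<in> U" for x y
    using that F(2) unfolding U_def by (auto simp: B.bilin subset_iff)
  have Uscale: "c *\<^sub>R x \<in> U" if "x \<in> U" for x c
    using that F(2) unfolding U_def by (auto simp: B.bilin subset_iff)
  obtain C where C: "\<And>x. x \<in> V \<Longrightarrow> K x x \<le> C * B x x" using K_bound by blast
  obtain u0 where u0: "u0 \<in> U" "0 < K u0 u0"
    using ex_B_orthogonal[OF F] unfolding U_def by blast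
  have Bu0: "0 < B u0 u0"
  proof (rule ccontr)
    assume "\<not> 0 < B u0 u0"
    then have "B u0 u0 = 0" using B.nonneg[OF UV[OF u0(1)]] by simp
    then show False using C[OF UV[OF u0(1)]] u0(2) by simp
  qed
  have Cpos: "0 < C"
    using C[OF UV[OF u0(1)]] u0(2) Bu0 by (smt (verit) mult_nonpos_nonneg)
  define S where "S = {K v v |v. v \<in> U \<and> B v v \<le> 1}"
  have bdd: "bdd_above S"
    unfolding S_def
  proof (rule bdd_aboveI[of _ C], clarify)
    fix v assume v: "v \<in> U" "B v v \<le> 1"
    have "K v v \<le> C * B v v" using C UV v by blast
    also have "\<dots> \<le> C * 1" using v Cpos by (intro mult_left_mono) auto
    finally show "K v v \<le> C" by simp
  qed
  define \<mu> where "\<mu> = Sup S"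
  have normalize: "K v v / B v v \<in> S" if v: "v \<in> U" "0 < B v v" for v
  proof -
    let ?v = "(1 / sqrt (B v v)) *\<^sub>R v"
    have "B ?v ?v = 1" "K ?v ?v = K v v / B v v"
      using v UV[OF v(1)] by (simp_all add: B.quad_scale K.quad_scale power_divide)
    then show ?thesis unfolding S_def using Uscale[OF v(1), of "1 / sqrt (B v v)"]
      by (intro CollectI exI[of _ ?v]) auto
  qed
  \<comment> \<open>Homogeneity carries the supremum bound from the unit ball to all of
    \<open>U\<close>; when \<open>B v v = 0\<close> no normalization is possible and
    \<open>K_bound\<close> takes over.\<close>
  have \<mu>_upper: "K v v \<le> \<mu> * B v v" if v: "v \<in> U" for v
  proof (cases "B v v = 0")
    case True
    then show ?thesis using C[OF UV[OF v]] by simp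
  next
    case False
    then have "0 < B v v" using B.nonneg[OF UV[OF v]] by simp
    then show ?thesis using cSup_upper[OF normalize[OF v] bdd] unfolding \<mu>_def
      by (simp add: field_simps)
  qed
  have \<mu>_pos: "0 < \<mu>"
    using cSup_upper[OF normalize[OF u0(1) Bu0] bdd] u0(2) Bu0 unfolding \<mu>_def
    by (meson divide_pos_pos less_le_trans)
  have "\<exists>v. v \<in> U \<and> B v v \<le> 1 \<and> \<mu> - 1 / real (Suc k) < K v v" for k
  proof -
    have "\<mu> - 1 / real (Suc k) < Sup S" unfolding \<mu>_def by simp
    moreover have "S \<noteq> {}" using normalize[OF u0(1) Bu0] by blast
    ultimately obtain y where "y \<in> S" "\<mu> - 1 / real (Suc k) < y"
      using less_cSup_iff[OF _ bdd] by blast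
    then show ?thesis unfolding S_def by blast
  qed
  then obtain v where v: "\<And>k. v k \<in> U" "\<And>k. B.quad (v k) \<le> 1"
    "\<And>k. \<mu> - 1 / real (Suc k) < K.quad (v k)" by metis
  obtain r :: "nat \<Rightarrow> nat" where r: "strict_mono r"
    and rK: "\<And>e. e > 0 \<Longrightarrow> \<exists>N. \<forall>m\<ge>N. \<forall>k\<ge>N. K.quad (v (r m) - v (r k)) < e"
    using compact[of v] v UV by blast
  define X where "X k = v (r k)" for k
  have XU: "X k \<in> U" for k unfolding X_def using v by simp
  then have XV: "X k \<in> V" for k using UV by simp
  have XB: "B.quad (X k) \<le> 1" for k unfolding X_def using v by simp
  have XK: "\<mu> - 1 / real (Suc k) < K.quad (X k)" for k
  proof -
    have "1 / real (Suc (r k)) \<le> 1 / real (Suc k)"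
      using seq_suble[OF r, of k] by (simp add: frac_le)
    then show ?thesis using v(3)[of "r k"] unfolding X_def by linarith
  qed
  \<comment> \<open>The sum \<open>X m + X k\<close> lies in \<open>U\<close>, so its
    \<open>K\<close> is at most \<mu> times its \<open>B\<close>. Expanding both sides by the
    parallelogram laws, near-maximality of \<open>X m\<close> and \<open>X k\<close> bounds the
    \<open>B\<close>-distance by the \<open>K\<close>-distance plus a null sequence.\<close>
  have B_diff: "B.quad (X m - X k) * \<mu>
      \<le> 2 / real (Suc m) + 2 / real (Suc k) + K.quad (X m - X k)" for m k
  proof -
    have "2 * K.quad (X m) + 2 * K.quad (X k) - K.quad (X m - X k)
        = K.quad (X m + X k)"
      using K.quad_add[OF XV[of m] XV[of k]] K.quad_diff[OF XV[of m] XV[of k]] by simp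
    also have "\<dots> \<le> \<mu> * B.quad (X m + X k)" using \<mu>_upper Uadd XU by blast
    also have "B.quad (X m + X k)
        = 2 * B.quad (X m) + 2 * B.quad (X k) - B.quad (X m - X k)"
      using B.quad_add[OF XV[of m] XV[of k]] B.quad_diff[OF XV[of m] XV[of k]] by simp
    also have "\<mu> * \<dots> \<le> \<mu> * (4 - B.quad (X m - X k))"
      using \<mu>_pos XB[of m] XB[of k] by (intro mult_left_mono) auto
    finally show ?thesis using XK[of m] XK[of k] by (simp add: algebra_simps)
  qed
  have "\<exists>N. \<forall>m\<ge>N. \<forall>k\<ge>N. B.quad (X m - X k) < e" if e: "e > 0" for e
  proof -
    have e': "e * \<mu> / 3 > 0" using e \<mu>_pos by simp
    obtain N1 where N1: "\<And>m k. m \<ge> N1 \<Longrightarrow> k \<ge> N1 \<Longrightarrow> K.quad (X m - X k) < e * \<mu> / 3"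
      using rK[OF e'] unfolding X_def by blast
    obtain N2 where N2: "inverse (real (Suc N2)) < e * \<mu> / 6"
      using reals_Archimedean[of "e * \<mu> / 6"] e' by auto
    have N2': "2 / real (Suc m) < e * \<mu> / 3" if "m \<ge> N2" for m
    proof -
      have "1 / real (Suc m) \<le> inverse (real (Suc N2))"
        using that by (simp add: inverse_eq_divide frac_le)
      moreover have "2 / real (Suc m) = 2 * (1 / real (Suc m))" by simp
      ultimately show ?thesis using N2 by linarith
    qed
    have "B.quad (X m - X k) < e" if "m \<ge> max N1 N2" "k \<ge> max N1 N2" for m k
    proof -
      have "B.quad (X m - X k) * \<mu> < e * \<mu>"
        using B_diff[of m k] N1[of m k] N2'[of m] N2'[of k] that by simp
      then show ?thesis using \<mu>_pos by simp
    qed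
    then show ?thesis by blast
  qed
  with complete[of X] XV obtain l where l: "l \<in> V"
    and lim: "(\<lambda>k. B.quad (X k - l)) \<longlonglongrightarrow> 0" by blast
  have "B f l = 0" if "f \<in> F" for f
  proof -
    have f: "f \<in> V" using that F by blast
    have "B f (X k) = 0" for k using XU[of k] that unfolding U_def by blast
    then have "B (X k) f = 0" for k using B.sym[OF f XV[of k]] by simp
    then show ?thesis using B.tendsto_inner[OF XV l f lim] B.sym[OF f l]
      by (simp add: LIMSEQ_const_iff)
  qed
  then have lU: "l \<in> U" unfolding U_def using l by simp
  have Bl: "B l l \<le> 1"
    using LIMSEQ_le_const2[OF B.tendsto_quad[OF XV l lim]] XB by blast
  have "(\<lambda>k. K.quad (X k - l)) \<longlonglongrightarrow> 0"
  proof (rule tendsto_sandwich[OF _ _ tendsto_const])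
    show "(\<lambda>k. C * B.quad (X k - l)) \<longlonglongrightarrow> 0"
      using tendsto_mult_right_zero[OF lim] by simp
  qed (use C K.nonneg XV l K.closed in auto)
  then have Klim: "(\<lambda>k. K.quad (X k)) \<longlonglongrightarrow> K l l" by (rule K.tendsto_quad[OF XV l])
  have "(\<lambda>k. \<mu> - 1 / real (Suc k)) \<longlonglongrightarrow> \<mu> - 0"
    by (intro tendsto_intros LIMSEQ_Suc[OF lim_1_over_n])
  then have "\<mu> \<le> K l l"
    by (intro LIMSEQ_le[OF _ Klim]) (use XK less_imp_le in auto)
  moreover have "\<mu> * B l l \<le> \<mu> * 1" using Bl \<mu>_pos by (intro mult_left_mono) auto
  \<comment> \<open>The chain \<open>\<mu> \<le> K l l \<le> \<mu> * B l l \<le> \<mu>\<close>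
    forces equality throughout. Rescaling to \<open>K = 1\<close> then turns \<mu>, the supremum of
    \<open>K\<close> over \<open>B\<close>, into the eigenvalue \<open>1 / \<mu>\<close>.\<close>
  ultimately have Kl: "K l l = \<mu>" and "\<mu> * B l l = \<mu>" 
    using \<mu>_upper[OF lU] by linarith+
  then have Bl1: "B l l = 1" using \<mu>_pos by simp
  let ?u = "(1 / sqrt \<mu>) *\<^sub>R l"
  have "?u \<in> U" using Uscale[OF lU] .
  moreover have "K ?u ?u = 1" "B ?u ?u = 1 / \<mu>"
    using Kl Bl1 \<mu>_pos l by (simp_all add: B.quad_scale K.quad_scale power_divide)
  moreover have "\<forall>v\<in>U. (1 / \<mu>) * K v v \<le> B v v" using \<mu>_upper \<mu>_pos by (simp add: field_simps)
  ultimately show ?thesis using \<mu>_pos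
    by (intro bexI[of _ ?u] exI[of _ "1 / \<mu>"]) auto
qed

text \<open>The form \<open>B - l * K\<close> is nonnegative on the complement of \<open>F\<close>
  and vanishes at \<open>u\<close>, so Cauchy-Schwarz for this form gives the equation there; no
  Rayleigh quotient is differentiated. Vectors of \<open>F\<close> are eigenvectors
  \<open>B\<close>-orthogonal to \<open>u\<close>, so both sides vanish on their span.\<close>

lemma minimizer_eigen:
  assumes F: "finite F" "F \<subseteq> V"
    and eig: "\<And>f. f \<in> F \<Longrightarrow> \<exists>a. a > 0 \<and> (\<forall>v\<in>V. B f v = a * K f v)"
    and pos: "\<And>f. f \<in> F \<Longrightarrow> 0 < K f f"
    and orth: "\<And>f g. f \<in> F \<Longrightarrow> g \<in> F \<Longrightarrow> f \<noteq> g \<Longrightarrow> K f g = 0"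
    and u: "u \<in> V" "\<forall>f\<in>F. B f u = 0" "K u u = 1" "B u u = l"
    and min: "\<forall>v\<in>V. (\<forall>f\<in>F. B f v = 0) \<longrightarrow> l * K v v \<le> B v v"
    and v: "v \<in> V"
  shows "B u v = l * K u v"
proof -
  let ?U = "{v\<in>V. \<forall>f\<in>F. B f v = 0}"
  let ?D = "\<lambda>x y. B x y - l * K x y"
  have FV: "f \<in> V" if "f \<in> F" for f using that F by blast
  interpret D: semi_inner ?U ?D
  proof
    show "subspace ?U"
      by (rule subspaceI) (auto simp: B.bilin FV B.zero_right)
  qed (use min in \<open>auto simp: B.bilin K.bilin algebra_simps B.sym K.sym\<close>)
  have "?D u x = 0" if "x \<in> ?U" for x
  proof -
    have "(?D u x)\<^sup>2 \<le> ?D u u * ?D x x"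
      using D.Cauchy_Schwarz[of u x] u that by simp
    also have "?D u u = 0" using u by simp
    finally show ?thesis by simp
  qed
  note on_U = this
  \<comment> \<open>Coefficients of the \<open>B\<close>-orthogonal projection \<open>p\<close> of
    \<open>v\<close> onto the span of \<open>F\<close>; \<open>v - p\<close> lies in the
    complement.\<close>
  define c where "c f = B f v / B f f" for f
  define p where "p = (\<Sum>f\<in>F. c f *\<^sub>R f)"
  have pV: "p \<in> V" unfolding p_def by (intro B.closed FV)
  have Bff: "B f f \<noteq> 0" if "f \<in> F" for f
    using eig[OF that] pos[OF that] FV[OF that] by force
  have Borth: "B f g = 0" if "f \<in> F" "g \<in> F" "f \<noteq> g" for f g
    using eig[OF that(1)] orth[OF that] FV[OF that(2)] by force
  have "B f (v - p) = 0" if f: "f \<in> F" for f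
  proof -
    have "B f p = (\<Sum>g\<in>F. c g * B f g)"
      unfolding p_def using FV f F by (subst B.sum_right) (auto simp: B.bilin intro!: sum.cong)
    also have "\<dots> = (\<Sum>g\<in>F. if g = f then B f v else 0)"
      using Borth Bff f by (intro sum.cong) (auto simp: c_def)
    also have "\<dots> = B f v" using f F by simp
    finally show ?thesis using FV[OF f] v pV by (simp add: B.bilin)
  qed
  then have "?D u (v - p) = 0" using on_U[of "v - p"] v pV B.closed by simp
  moreover have "?D u p = 0"
  proof -
    have "B u f = 0" "K u f = 0" if f: "f \<in> F" for f
    proof -
      obtain a where "a > 0" "B f u = a * K f u" using eig[OF f] u by blast
      moreover have "B f u = 0" using u f by simp
      ultimately show "B u f = 0" "K u f = 0"
        using B.sym[OF u(1) FV[OF f]] K.sym[OF u(1) FV[OF f]] by auto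
    qed
    then have "B u p = 0" "K u p = 0"
      unfolding p_def using FV u F
      by (subst B.sum_right K.sum_right; auto simp: B.bilin K.bilin intro!: sum.neutral)+
    then show ?thesis by simp
  qed
  ultimately show ?thesis using v pV u(1) by (simp add: B.bilin K.bilin algebra_simps)
qed

theorem eigenbasis:
  obtains w :: "nat \<Rightarrow> 'a" and lam :: "nat \<Rightarrow> real"
  where "\<And>i. w i \<in> V" "\<And>i v. v \<in> V \<Longrightarrow> B (w i) v = lam i * K (w i) v"
    "\<And>i j. K (w i) (w j) = (if i = j then 1 else 0)"
    "\<And>i. 0 < lam i" "mono lam" "filterlim lam at_top sequentially"
    "\<And>v e. \<lbrakk>v \<in> V; e > 0\<rbrakk> \<Longrightarrow>
      \<exists>N c. B.quad (v - (\<Sum>i<N. c i *\<^sub>R w i)) < e"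
proof -
  \<comment> \<open>\<open>P f x r\<close> says that the pair \<open>r\<close> of vector and
    eigenvalue is admissible at stage \<open>x\<close>, given the earlier pairs. It reads
    \<open>f\<close> only below \<open>x\<close>, as the choice principle for well-orders
    demands.\<close>
  define P where "P f (x::nat) r \<longleftrightarrow> fst r \<in> V \<and> 0 < snd r \<and> K.quad (fst r) = 1 \<and>
     (\<forall>v\<in>V. B (fst r) v = snd r * K (fst r) v) \<and> (\<forall>i<x. B (fst (f i)) (fst r) = 0) \<and>
     (\<forall>v\<in>V. (\<forall>i<x. B (fst (f i)) v = 0) \<longrightarrow> snd r * K v v \<le> B v v)"
    for f :: "nat \<Rightarrow> 'a \<times> real" and x r
  have "\<exists>f. \<forall>x. P f x (f x)"
  proof (rule dependent_wellorder_choice)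
    fix r and f g :: "nat \<Rightarrow> 'a \<times> real" and x :: nat
    assume "\<And>y. y < x \<Longrightarrow> f y = g y"
    then show "P f x r = P g x r" unfolding P_def by simp
  next
    fix x :: nat and f :: "nat \<Rightarrow> 'a \<times> real"
    assume prev: "\<And>y. y < x \<Longrightarrow> P f y (f y)"
    let ?F = "(\<lambda>i. fst (f i)) ` {..<x}"
    have F: "finite ?F" "?F \<subseteq> V" using prev unfolding P_def by auto
    obtain u l where u: "u \<in> V" "\<forall>f\<in>?F. B f u = 0" "K u u = 1" "B u u = l" "0 < l"
      "\<forall>v\<in>V. (\<forall>f\<in>?F. B f v = 0) \<longrightarrow> l * K v v \<le> B v v"
      using ex_minimizer[OF F] by blast
    have lt_orth: "K (fst (f i)) (fst (f j)) = 0" if "i < j" "j < x" for i j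
      using prev[of i] prev[of j] that unfolding P_def by fastforce
    have eig: "\<exists>a. a > 0 \<and> (\<forall>v\<in>V. B g v = a * K g v)" if g: "g \<in> ?F" for g
    proof -
      obtain i where "i < x" "g = fst (f i)" using g by auto
      then show ?thesis using prev[of i] unfolding P_def by blast
    qed
    have "B u v = l * K u v" if "v \<in> V" for v
    proof (rule minimizer_eigen[OF F eig _ _ u(1-4,6) that])
      fix g h assume "g \<in> ?F" "h \<in> ?F" "g \<noteq> h"
      then obtain i j where ij: "g = fst (f i)" "h = fst (f j)" "i < x" "j < x" "i \<noteq> j" by auto
      have "g \<in> V" "h \<in> V" using F \<open>g \<in> ?F\<close> \<open>h \<in> ?F\<close> by blast+
      then show "K g h = 0"
        using ij lt_orth[of i j] lt_orth[of j i] K.sym[of g h] by (metis linorder_neqE_nat)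
    qed (use prev in \<open>auto simp: P_def\<close>)
    then have "P f x (u, l)" unfolding P_def using u by auto
    then show "\<exists>r. P f x r" by blast
  qed
  then obtain f where f: "\<And>x. P f x (f x)" by blast
  define w where "w i = fst (f i)" for i
  define lam where "lam i = snd (f i)" for i
  have wV: "w i \<in> V" and lam_pos: "0 < lam i" and Kw: "K.quad (w i) = 1"
    and eig: "\<And>v. v \<in> V \<Longrightarrow> B (w i) v = lam i * K (w i) v"
    and Bw: "\<And>j. j < i \<Longrightarrow> B (w j) (w i) = 0"
    and min: "\<And>v. v \<in> V \<Longrightarrow> \<forall>j<i. B (w j) v = 0 \<Longrightarrow> lam i * K v v \<le> B v v" for i
    using f[of i] unfolding P_def w_def lam_def by auto
  have K0: "K (w i) (w j) = 0" if "i < j" for i j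
    using eig[OF wV[of j], of i] Bw[OF that] lam_pos[of i] by simp
  have Kdelta: "K (w i) (w j) = (if i = j then 1 else 0)" for i j
    using K0[of i j] K0[of j i] Kw K.sym[OF wV[of i] wV[of j]]
    by (metis linorder_neqE_nat)
  have Bdelta: "B (w i) (w j) = (if i = j then lam i else 0)" for i j
    using eig[OF wV[of j], of i] Kdelta by simp
  have mono: "mono lam"
  proof (rule monoI)
    fix i j :: nat assume "i \<le> j"
    then have "\<forall>k<i. B (w k) (w j) = 0" by (simp add: Bdelta)
    then show "lam i \<le> lam j" using min[OF wV[of j], of i] by (simp add: Bdelta Kdelta)
  qed
  have top: "filterlim lam at_top sequentially"
  proof (rule ccontr)
    assume "\<not> ?thesis"
    then obtain Z where "\<not> (\<exists>i. lam i \<ge> Z)"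
      using mono unfolding filterlim_at_top eventually_sequentially
      by (meson monoD order_trans)
    then have Z: "lam i < Z" for i using not_le by blast
    then have Zpos: "0 < Z" using lam_pos[of 0] by (meson order.strict_trans)
    \<comment> \<open>Were the eigenvalues bounded by \<open>Z\<close>, these vectors would lie in
      the \<open>B\<close>-unit ball while distinct ones satisfy
      \<open>K.quad (X i - X j) = 2 / Z\<close>, so no subsequence could be
      \<open>K\<close>-Cauchy.\<close>
    define X where "X i = (1 / sqrt Z) *\<^sub>R w i" for i
    have XV: "X i \<in> V" for i unfolding X_def by (intro B.closed wV)
    have "B.quad (X i) \<le> 1" for i
      unfolding X_def using Zpos Z[of i] by (simp add: B.quad_scale wV Bdelta power_divide)
    from compact[of X, OF XV this] obtain r :: "nat \<Rightarrow> nat" where r: "strict_mono r"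
      and rK: "\<forall>e>0. \<exists>N. \<forall>m\<ge>N. \<forall>k\<ge>N. K.quad (X (r m) - X (r k)) < e"
      by (elim exE conjE)
    have "1 / Z > 0" using Zpos by simp
    from rK[rule_format, OF this]
    obtain N where N: "\<And>m k. m \<ge> N \<Longrightarrow> k \<ge> N \<Longrightarrow> K.quad (X (r m) - X (r k)) < 1 / Z"
      by blast
    have "r N \<noteq> r (Suc N)" using r by (simp add: strict_mono_eq)
    moreover have "K.quad (X i - X j) = 2 / Z" if "i \<noteq> j" for i j
      unfolding X_def using that Zpos
      by (simp add: K.quad_diff K.quad_scale wV K.bilin Kdelta power_divide)
    ultimately show False using N[of N "Suc N"] Zpos by (simp add: field_simps)
  qed
  have complete_B: "\<exists>N c. B.quad (v - (\<Sum>i<N. c i *\<^sub>R w i)) < e"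
    if v: "v \<in> V" and e: "e > 0" for v e
  proof -
    define c where "c i = K (w i) v" for i
    define S where "S N = (\<Sum>i<N. c i *\<^sub>R w i)" for N
    have SV: "S N \<in> V" for N unfolding S_def by (intro B.closed wV)
    have BwS: "B (w i) (S N) = (if i < N then lam i * c i else 0)" for i N
    proof -
      have "B (w i) (S N) = (\<Sum>j<N. c j * B (w i) (w j))"
        unfolding S_def by (subst B.sum_right) (auto simp: wV B.bilin)
      also have "\<dots> = (\<Sum>j<N. if i = j then lam i * c i else 0)"
        by (intro sum.cong) (auto simp: Bdelta)
      also have "\<dots> = (if i < N then lam i * c i else 0)" by (simp add: sum.delta')
      finally show ?thesis .
    qed
    have Bwv: "B (w i) v = lam i * c i" for i using eig[OF v] by (simp add: c_def)
    have BSy: "B (S M) y = (\<Sum>i<M. c i * B (w i) y)" if "y \<in> V" for M y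
      unfolding S_def using that by (subst B.sum_left) (auto simp: wV B.bilin)
    \<comment> \<open>\<open>S N\<close> is the \<open>B\<close>-projection of \<open>v\<close> onto
      the first \<open>N\<close> eigenvectors, and \<open>s N\<close> is both its
      \<open>B\<close>-square and its \<open>B\<close>-product with \<open>v\<close>. Bessel's
      inequality bounds \<open>s\<close>, and distances between partial sums are differences of
      \<open>s\<close>.\<close>
    define s where "s N = (\<Sum>i<N. lam i * (c i)\<^sup>2)" for N
    have BSS: "B (S M) (S N) = s M" if "M \<le> N" for M N
      unfolding BSy[OF SV] s_def using that by (intro sum.cong) (auto simp: BwS power2_eq_square)
    have BSv: "B (S M) v = s M" for M
      unfolding BSy[OF v] s_def by (intro sum.cong) (auto simp: Bwv power2_eq_square)
    have s_inc: "incseq s"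
      unfolding s_def by (rule incseq_SucI) (simp add: lam_pos less_imp_le)
    have s_bdd: "s N \<le> B v v" for N
      using B.nonneg[OF B.closed(3)[OF v SV[of N]]] B.quad_diff[OF v SV[of N]] BSv[of N]
        BSS[of N N] B.sym[OF v SV[of N]] by simp
    obtain L where L: "s \<longlonglongrightarrow> L" using incseq_convergent[OF s_inc] s_bdd by blast
    then have "Cauchy s" by (simp add: LIMSEQ_imp_Cauchy)
    have S_diff: "B.quad (S m - S k) = \<bar>s m - s k\<bar>" for m k
    proof -
      have *: "B.quad (S m - S k) = \<bar>s m - s k\<bar>" if "k \<le> m" for m k
        using B.quad_diff[OF SV[of m] SV[of k]] BSS[of k m] BSS[of k k] BSS[of m m] that
          B.sym[OF SV[of m] SV[of k]] incseqD[OF s_inc that] by simp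
      show ?thesis
        using *[of k m] *[of m k] B.quad_diff_commute[OF SV[of k] SV[of m]]
        by (metis abs_minus_commute nle_le)
    qed
    have "\<exists>N. \<forall>m\<ge>N. \<forall>k\<ge>N. B.quad (S m - S k) < e'" if "e' > 0" for e'
      using \<open>Cauchy s\<close> that unfolding S_diff Cauchy_def dist_real_def by blast
    with complete[of S] SV obtain l where l: "l \<in> V"
      and lim: "(\<lambda>k. B.quad (S k - l)) \<longlonglongrightarrow> 0" by blast
    have Bwl: "B (w i) l = lam i * c i" for i
    proof -
      have "(\<lambda>k. B (S k) (w i)) \<longlonglongrightarrow> B l (w i)" by (rule B.tendsto_inner[OF SV l wV lim])
      moreover have "\<forall>\<^sub>F k in sequentially. B (S k) (w i) = lam i * c i"
        using eventually_gt_at_top[of i]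
        by eventually_elim (simp add: BwS B.sym[OF SV wV])
      ultimately have "B l (w i) = lam i * c i"
        by (metis LIMSEQ_unique tendsto_eventually)
      then show ?thesis using B.sym[OF wV l] by simp
    qed
    have vl: "v - l \<in> V" using v l by (intro B.closed)
    have "B (w i) (v - l) = 0" for i using Bwv Bwl wV v l by (simp add: B.bilin)
    \<comment> \<open>The remainder \<open>v - l\<close> is \<open>B\<close>-orthogonal to all
      \<open>w i\<close>, so the minimality of every stage applies to it. Letting
      \<open>lam N\<close> grow forces its \<open>K\<close> to be zero.\<close>
    then have ub: "lam N * K.quad (v - l) \<le> B.quad (v - l)" for N using min[OF vl] by simp
    have "K.quad (v - l) = 0"
    proof (rule ccontr)
      assume "K.quad (v - l) \<noteq> 0"
      then have pos: "K.quad (v - l) > 0" using K.nonneg[OF vl] by simp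
      obtain N where "lam N \<ge> B.quad (v - l) / K.quad (v - l) + 1"
        using top unfolding filterlim_at_top eventually_sequentially by blast
      then have "lam N * K.quad (v - l) \<ge> B.quad (v - l) + K.quad (v - l)"
        using pos by (simp add: field_simps)
      then show False using ub[of N] pos by simp
    qed
    then have B0: "B.quad (v - l) = 0" using definite[OF vl] by simp
    obtain N where N: "B.quad (S N - l) < e"
      using order_tendstoD(2)[OF lim e] unfolding eventually_sequentially by blast
    have Sl: "S N - l \<in> V" using SV l by (intro B.closed)
    \<comment> \<open>A vector of zero \<open>B\<close>-seminorm need not be 0, but Cauchy-Schwarz
      removes its cross terms, so replacing \<open>l\<close> by \<open>v\<close> does not change the
      distance.\<close>
    have "(B (v - l) (S N - l))\<^sup>2 \<le> 0" using B.Cauchy_Schwarz[OF vl Sl] B0 by simp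
    then have "B.quad ((v - l) - (S N - l)) = B.quad (S N - l)"
      using B.quad_diff[OF vl Sl] B0 by simp
    then have "B.quad (v - S N) < e" using N by simp
    then show ?thesis unfolding S_def by blast
  qed
  show ?thesis using that[OF wV eig Kdelta lam_pos mono top complete_B] .
qed

end

section \<open>Smooth test functions\<close>

text \<open>Smoothness demands differentiability of every iterated \<open>vd\<close>, which is
  awkward to check directly. This class is closed under differentiation by its shape and contains
  every smooth function through \<open>base\<close>. The rule \<open>flat\<close> admits all
  polynomials because differentiating \<open>exp (- (1 / t))\<close> produces polynomial factors in
  \<open>1 / t\<close>.\<close>

inductive smooth_gen :: "(real \<Rightarrow> complex) \<Rightarrow> bool" where
  base: "(\<And>k t. ((vd ^^ k) f) differentiable (at t)) \<Longrightarrow> smooth_gen f"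
| const: "smooth_gen (\<lambda>t. c)"
| add: "smooth_gen f \<Longrightarrow> smooth_gen g \<Longrightarrow> smooth_gen (\<lambda>t. f t + g t)"
| mult: "smooth_gen f \<Longrightarrow> smooth_gen g \<Longrightarrow> smooth_gen (\<lambda>t. f t * g t)"
| affine: "smooth_gen f \<Longrightarrow> smooth_gen (\<lambda>t. f (a * t + b))"
| flat: "smooth_gen (\<lambda>t. of_real (if t \<le> 0 then 0 else poly p (1 / t) * exp (- (1 / t))))"
| Re: "smooth_gen f \<Longrightarrow> smooth_gen (\<lambda>t. of_real (Re (f t)))"
| Im: "smooth_gen f \<Longrightarrow> smooth_gen (\<lambda>t. of_real (Im (f t)))"
| prim: "smooth_gen f \<Longrightarrow> (\<And>t. (g has_vector_derivative f t) (at t)) \<Longrightarrow> smooth_gen g"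

lemma poly_times_exp_tendsto_0: "((\<lambda>x::real. poly p x * exp (- x)) \<longlongrightarrow> 0) at_top"
proof -
  have "((\<lambda>x. \<Sum>i\<le>degree p. coeff p i * (x ^ i / exp x)) \<longlongrightarrow> (\<Sum>i\<le>degree p. coeff p i * 0)) at_top"
    by (intro tendsto_intros tendsto_power_div_exp_0)
  then show ?thesis
    by (simp add: poly_altdef sum_distrib_right exp_minus divide_inverse mult.assoc)
qed

text \<open>With \<open>u = 1 / t\<close>, the chain rule contributes \<open>u^2\<close>, which is
  the factor \<open>[:0, 0, 1:]\<close>, and the product rule contributes
  \<open>p - pderiv p\<close>. The family is therefore closed under differentiation, the gluing
  point 0 included.\<close>

lemma flat_has_derivative:
  fixes p :: "real poly"
  defines "F \<equiv> \<lambda>p t. if t \<le> 0 then 0 else poly p (1 / t) * exp (- (1 / t))"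
  shows "(F p has_real_derivative F ([:0, 0, 1:] * (p - pderiv p)) t) (at t)"
proof -
  consider "t < 0" | "t = 0" | "t > 0" by linarith
  then show ?thesis
  proof cases
    case 1
    have "((\<lambda>_. 0) has_real_derivative 0) (at t)" by simp
    then have "(F p has_real_derivative 0) (at t)"
      by (rule DERIV_cong_ev[OF refl _ refl, THEN iffD1, rotated])
        (use 1 in \<open>auto simp: F_def eventually_at_filter intro!: eventually_mono[OF order_tendstoD(2)[OF tendsto_ident_at 1, of UNIV, simplified at_within_def]] eventually_nhds_in_open[of "{..<0}", THEN eventually_mono]\<close>)
    then show ?thesis using 1 by (simp add: F_def)
  next
    case 2
    \<comment> \<open>The difference quotient at 0 divides by \<open>h\<close>, which multiplies the
      polynomial by its variable \<open>1 / h\<close>.\<close>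
    have "((\<lambda>x. poly (pCons 0 p) (inverse x) * exp (- (inverse x))) \<longlongrightarrow> 0) (at_right (0::real))"
      by (rule filterlim_compose[OF poly_times_exp_tendsto_0 filterlim_inverse_at_top_right])
    then have "((\<lambda>h. (F p (0 + h) - F p 0) / h) \<longlongrightarrow> 0) (at_right 0)"
      by (rule Lim_transform_eventually)
        (auto simp: F_def eventually_at_filter field_simps)
    moreover have "((\<lambda>h. (F p (0 + h) - F p 0) / h) \<longlongrightarrow> 0) (at_left 0)"
      by (rule Lim_transform_eventually[OF tendsto_const])
        (auto simp: F_def eventually_at_filter)
    ultimately have "((\<lambda>h. (F p (0 + h) - F p 0) / h) \<longlongrightarrow> 0) (at 0)"
      by (simp add: filterlim_split_at)
    then have "(F p has_real_derivative 0) (at 0)" by (simp add: DERIV_def)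
    then show ?thesis using 2 by (simp add: F_def)
  next
    case 3
    have "((\<lambda>t. poly p (1 / t) * exp (- (1 / t))) has_real_derivative
        F ([:0, 0, 1:] * (p - pderiv p)) t) (at t)"
      using 3 by (auto intro!: derivative_eq_intros simp: F_def field_simps power2_eq_square)
    then show ?thesis
      by (rule DERIV_cong_ev[OF refl _ refl, THEN iffD1, rotated])
        (use 3 in \<open>auto simp: F_def intro!: eventually_nhds_in_open[of "{0<..}", THEN eventually_mono]\<close>)
  qed
qed

text \<open>Each generating rule is matched by a differentiation rule whose result is generated
  again; \<open>prim\<close> already contains its derivative.\<close>

lemma smooth_gen_derivative:
  assumes "smooth_gen f"
  shows "\<exists>f'. smooth_gen f' \<and> (\<forall>t. (f has_vector_derivative f' t) (at t))"
  using assms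
proof induction
  case (base f)
  have "(f has_vector_derivative vd f t) (at t)" for t
    using base[of 0 t] unfolding vd_def by (simp add: vector_derivative_works)
  moreover have "smooth_gen (vd f)"
    by (rule smooth_gen.base) (use base[of "Suc _"] in \<open>simp add: funpow_swap1\<close>)
  ultimately show ?case by blast
next
  case (const c)
  then show ?case using smooth_gen.const[of 0] by (intro exI[of _ "\<lambda>_. 0"]) auto
next
  case (add f g)
  then obtain f' g' where "smooth_gen f'" "\<And>t. (f has_vector_derivative f' t) (at t)"
     "smooth_gen g'" "\<And>t. (g has_vector_derivative g' t) (at t)" by blast
  then show ?case
    by (intro exI[of _ "\<lambda>t. f' t + g' t"])
      (auto intro!: smooth_gen.add has_vector_derivative_add)
next
  case (mult f g)
  then obtain f' g' where "smooth_gen f'" "\<And>t. (f has_vector_derivative f' t) (at t)"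
     "smooth_gen g'" "\<And>t. (g has_vector_derivative g' t) (at t)" by blast
  then show ?case using mult(1,2)
    by (intro exI[of _ "\<lambda>t. f t * g' t + f' t * g t"])
      (auto intro!: smooth_gen.add smooth_gen.mult has_vector_derivative_mult)
next
  case (affine f a b)
  then obtain f' where f': "smooth_gen f'" "\<And>t. (f has_vector_derivative f' t) (at t)" by blast
  have "((\<lambda>t. f (a * t + b)) has_vector_derivative of_real a * f' (a * t + b)) (at t)" for t
  proof -
    have "((\<lambda>t. a * t + b) has_vector_derivative a) (at t)"
      by (auto intro!: derivative_eq_intros simp: has_real_derivative_iff_has_vector_derivative[symmetric])
    from vector_diff_chain_at[OF this f'(2)] show ?thesis
      by (simp add: o_def scaleR_conv_of_real)
  qed
  then show ?case
    by (intro exI[of _ "\<lambda>t. complex_of_real a * f' (a * t + b)"] conjI allI)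
      (auto intro!: smooth_gen.mult[OF smooth_gen.const] smooth_gen.affine f')
next
  case (flat p)
  show ?case
    by (intro exI conjI allI) (rule smooth_gen.flat,
      rule has_vector_derivative_of_real[OF flat_has_derivative])
next
  case (Re f)
  then obtain f' where f': "smooth_gen f'" "\<And>t. (f has_vector_derivative f' t) (at t)" by blast
  then show ?case
    by (intro exI[of _ "\<lambda>t. complex_of_real (Re (f' t))"] conjI allI)
      (auto intro!: smooth_gen.Re has_vector_derivative_of_real
         simp: has_real_derivative_iff_has_vector_derivative
         intro!:         bounded_linear.has_vector_derivative[OF bounded_linear_Re])
next
  case (Im f)
  then obtain f' where f': "smooth_gen f'" "\<And>t. (f has_vector_derivative f' t) (at t)" by blast
  then show ?case
    by (intro exI[of _ "\<lambda>t. complex_of_real (Im (f' t))"] conjI allI)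
      (auto intro!: smooth_gen.Im has_vector_derivative_of_real
         simp: has_real_derivative_iff_has_vector_derivative
         intro!:         bounded_linear.has_vector_derivative[OF bounded_linear_Im])
next
  case (prim f g)
  then show ?case by blast
qed

lemma smooth_gen_vd:
  assumes "smooth_gen f"
  shows "smooth_gen (vd f)" "(f has_vector_derivative vd f t) (at t)"
proof -
  obtain f' where f': "smooth_gen f'" "\<And>t. (f has_vector_derivative f' t) (at t)"
    using smooth_gen_derivative[OF assms] by blast
  then have "vd f = f'" unfolding vd_def by (auto intro: vector_derivative_at)
  with f' show "smooth_gen (vd f)" "(f has_vector_derivative vd f t) (at t)" by auto
qed

text \<open>Iterating \<open>smooth_gen_vd\<close> shows that the rules generate nothing beyond the
  smooth functions.\<close>

lemma smooth_gen_iff: "smooth_gen f \<longleftrightarrow> (\<forall>k t. ((vd ^^ k) f) differentiable (at t))"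
proof
  assume f: "smooth_gen f"
  have "smooth_gen ((vd ^^ k) f)" for k
    by (induction k) (auto simp: f smooth_gen_vd)
  then show "\<forall>k t. ((vd ^^ k) f) differentiable (at t)"
    using smooth_gen_vd(2) differentiableI_vector by blast
qed (simp add: smooth_gen.base)

section \<open>Real test functions and operations on them\<close>

lemma test_fun_iff:
  "test_fun f \<longleftrightarrow> smooth_gen f \<and> (\<exists>a b. 0 < a \<and> a < b \<and> (\<forall>t. t \<notin> {a..b} \<longrightarrow> f t = 0))"
  unfolding test_fun_def smooth_gen_iff by simp

text \<open>The derivative is carried along explicitly, matching the pairs of a function and its
  weak derivative in \<open>in_H\<close>.\<close>

definition test_pair :: "(real \<Rightarrow> real) \<Rightarrow> (real \<Rightarrow> real) \<Rightarrow> bool" where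
  "test_pair f f' \<longleftrightarrow> test_fun (\<lambda>t. of_real (f t)) \<and>
     (\<forall>t. (f has_real_derivative f' t) (at t))"

lemma test_pairI:
  assumes "smooth_gen (\<lambda>t. of_real (f t))" "0 < a" "a < b"
    "\<And>t. t \<notin> {a..b} \<Longrightarrow> f t = 0" "\<And>t. (f has_real_derivative f' t) (at t)"
  shows "test_pair f f'"
  unfolding test_pair_def test_fun_iff using assms by auto

lemma test_pair_vd:
  assumes "test_pair f f'"
  shows "vd (\<lambda>t. of_real (f t)) = (\<lambda>t. of_real (f' t))"
proof
  fix t
  have "(f has_vector_derivative f' t) (at t)"
    using assms unfolding test_pair_def has_real_derivative_iff_has_vector_derivative by blast
  then show "vd (\<lambda>t. of_real (f t)) t = of_real (f' t)"
    unfolding vd_def by (intro vector_derivative_at has_vector_derivative_of_real)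
      (simp add: has_real_derivative_iff_has_vector_derivative)
qed

lemma test_pairD:
  assumes "test_pair f f'"
  shows "smooth_gen (\<lambda>t. of_real (f t))" "smooth_gen (\<lambda>t. of_real (f' t))"
    "(f has_real_derivative f' t) (at t)"
    "continuous_on UNIV f" "continuous_on UNIV f'"
    "f \<in> borel_measurable borel" "f' \<in> borel_measurable borel"
    "\<exists>a b. 0 < a \<and> a < b \<and> (\<forall>t. t \<notin> {a..b} \<longrightarrow> f t = 0 \<and> f' t = 0)"
proof -
  show sm: "smooth_gen (\<lambda>t. of_real (f t))"
    using assms unfolding test_pair_def test_fun_iff by blast
  then show sm': "smooth_gen (\<lambda>t. of_real (f' t))"
    using smooth_gen_vd(1) test_pair_vd[OF assms] by metis
  have d: "(f has_real_derivative f' t) (at t)" for t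
    using assms unfolding test_pair_def by blast
  show "(f has_real_derivative f' t) (at t)" by (rule d)
  show c: "continuous_on UNIV f"
    using d by (meson DERIV_continuous continuous_at_imp_continuous_on)
  have "continuous_on UNIV (\<lambda>t. Re (of_real (f' t)))"
    by (intro continuous_on_Re continuous_at_imp_continuous_on ballI
        has_vector_derivative_continuous[OF smooth_gen_vd(2)[OF sm']])
  then show c': "continuous_on UNIV f'" by simp
  show "f \<in> borel_measurable borel" "f' \<in> borel_measurable borel"
    using c c' by (auto intro: borel_measurable_continuous_onI)
  obtain a b where ab: "0 < a" "a < b" "\<And>t. t \<notin> {a..b} \<Longrightarrow> f t = 0"
    using assms unfolding test_pair_def test_fun_iff by auto
  have "f' t = 0" if "t \<notin> {a..b}" for t
  proof -
    have "open (- {a..b})" by (simp add: open_Compl)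
    then have "\<forall>\<^sub>F x in nhds t. x \<in> - {a..b}" using that by (intro eventually_nhds_in_open) auto
    then have "\<forall>\<^sub>F x in nhds t. f x = 0" by eventually_elim (use ab in auto)
    then have "(f has_real_derivative 0) (at t)"
      using DERIV_cong_ev[of t t f "\<lambda>_. 0" 0 0] by simp
    then show ?thesis using d DERIV_unique by blast
  qed
  then show "\<exists>a b. 0 < a \<and> a < b \<and> (\<forall>t. t \<notin> {a..b} \<longrightarrow> f t = 0 \<and> f' t = 0)"
    using ab by blast
qed

lemma test_pair_deriv:
  assumes "test_pair f f'"
  obtains f'' where "test_pair f' f''"
proof -
  note D = test_pairD[OF assms]
  define f'' where "f'' t = Re (vd (\<lambda>t. of_real (f' t)) t)" for t
  obtain a b where "0 < a" "a < b" "\<And>t. t \<notin> {a..b} \<Longrightarrow> f' t = 0" using D(8) by blast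
  moreover have "(f' has_real_derivative f'' t) (at t)" for t
    using bounded_linear.has_vector_derivative[OF bounded_linear_Re smooth_gen_vd(2)[OF D(2)]]
    unfolding f''_def has_real_derivative_iff_has_vector_derivative by simp
  ultimately have "test_pair f' f''" by (intro test_pairI D(2))
  then show ?thesis by (rule that)
qed

lemma test_pair_add:
  assumes "test_pair f f'" "test_pair g g'"
  shows "test_pair (\<lambda>t. f t + g t) (\<lambda>t. f' t + g' t)"
proof -
  note F = test_pairD[OF assms(1)] note G = test_pairD[OF assms(2)]
  obtain a b where ab: "0 < a" "a < b" "\<And>t. t \<notin> {a..b} \<Longrightarrow> f t = 0" using F(8) by blast
  obtain c d where cd: "0 < c" "c < d" "\<And>t. t \<notin> {c..d} \<Longrightarrow> g t = 0" using G(8) by blast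
  show ?thesis
  proof (rule test_pairI[of _ "min a c" "max b d"])
    show "smooth_gen (\<lambda>t. of_real (f t + g t))"
      using smooth_gen.add[OF F(1) G(1)] by simp
    show "f t + g t = 0" if "t \<notin> {min a c..max b d}" for t
    proof -
      have "t \<notin> {a..b}" "t \<notin> {c..d}" using that by auto
      then show ?thesis using ab(3) cd(3) by simp
    qed
  qed (use ab cd in \<open>auto intro!: DERIV_add F(3) G(3)\<close>)
qed

lemma test_pair_scale:
  assumes "test_pair f f'"
  shows "test_pair (\<lambda>t. c * f t) (\<lambda>t. c * f' t)"
proof -
  note F = test_pairD[OF assms]
  obtain a b where ab: "0 < a" "a < b" "\<And>t. t \<notin> {a..b} \<Longrightarrow> f t = 0" using F(8) by blast
  show ?thesis
  proof (rule test_pairI[of _ a b])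
    show "smooth_gen (\<lambda>t. of_real (c * f t))"
      using smooth_gen.mult[OF smooth_gen.const F(1), of c] by simp
  qed (use ab in \<open>auto intro!: DERIV_cmult F(3)\<close>)
qed

lemma test_pair_zero: "test_pair (\<lambda>_. 0) (\<lambda>_. 0)"
  by (rule test_pairI[of _ 1 2]) (use smooth_gen.const[of 0] in auto)

text \<open>The sign of \<open>s\<close> matters: a shift to the right keeps the support at a
  positive distance from 0.\<close>

lemma test_pair_shift:
  assumes "test_pair f f'" "0 \<le> s"
  shows "test_pair (\<lambda>t. f (t - s)) (\<lambda>t. f' (t - s))"
proof -
  note F = test_pairD[OF assms(1)]
  obtain a b where ab: "0 < a" "a < b" "\<And>t. t \<notin> {a..b} \<Longrightarrow> f t = 0" using F(8) by blast
  show ?thesis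
  proof (rule test_pairI[of _ "a + s" "b + s"])
    show "smooth_gen (\<lambda>t. of_real (f (t - s)))"
      using smooth_gen.affine[OF F(1), of 1 "- s"] by simp
    show "((\<lambda>t. f (t - s)) has_real_derivative f' (t - s)) (at t)" for t
      using DERIV_chain2[OF F(3) DERIV_diff[OF DERIV_ident DERIV_const], of s t UNIV] by simp
  qed (use ab assms(2) in auto)
qed

lemma test_fun_Re_Im:
  assumes "test_fun \<phi>"
  shows "test_pair (\<lambda>t. Re (\<phi> t)) (\<lambda>t. Re (vd \<phi> t))" "test_pair (\<lambda>t. Im (\<phi> t)) (\<lambda>t. Im (vd \<phi> t))"
proof -
  have sm: "smooth_gen \<phi>" using assms test_fun_iff by blast
  obtain a b where ab: "0 < a" "a < b" "\<And>t. t \<notin> {a..b} \<Longrightarrow> \<phi> t = 0"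
    using assms test_fun_iff by blast
  show "test_pair (\<lambda>t. Re (\<phi> t)) (\<lambda>t. Re (vd \<phi> t))" "test_pair (\<lambda>t. Im (\<phi> t)) (\<lambda>t. Im (vd \<phi> t))"
    using bounded_linear.has_vector_derivative[OF bounded_linear_Re smooth_gen_vd(2)[OF sm]]
      bounded_linear.has_vector_derivative[OF bounded_linear_Im smooth_gen_vd(2)[OF sm]]
      ab(3)
    by (auto intro!: test_pairI[of _ a b] smooth_gen.Re smooth_gen.Im sm ab(1,2)
        simp: has_real_derivative_iff_has_vector_derivative)
qed

text \<open>A product of two functions \<open>exp (- 1 / x)\<close>, one flat at each endpoint.
  Stretching the arguments by \<open>Suc k\<close> sends the exponents to 0, so the bumps increase
  to the indicator of the open interval.\<close>

lemma test_pair_bump: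
  assumes "0 < a" "a < b"
  obtains \<beta> \<beta>' :: "nat \<Rightarrow> real \<Rightarrow> real"
  where "\<And>k. test_pair (\<beta> k) (\<beta>' k)" "\<And>k t. 0 \<le> \<beta> k t" "\<And>k t. \<beta> k t \<le> 1"
    "\<And>k t. t \<notin> {a<..<b} \<Longrightarrow> \<beta> k t = 0" "\<And>k t. t \<in> {a<..<b} \<Longrightarrow> 0 < \<beta> k t"
    "\<And>t. t \<in> {a<..<b} \<Longrightarrow> (\<lambda>k. \<beta> k t) \<longlonglongrightarrow> 1"
proof -
  define h where "h t = (if t \<le> 0 then 0 else exp (- (1 / t)))" for t :: real
  have h: "0 \<le> h t" "h t \<le> 1" for t unfolding h_def by auto
  have sm: "smooth_gen (\<lambda>t. of_real (h t))"
    using smooth_gen.flat[of 1] unfolding h_def poly_1 mult_1_left .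
  define \<beta> where "\<beta> k t = h (real (Suc k) * (t - a)) * h (real (Suc k) * (b - t))" for k t
  define \<beta>' where "\<beta>' k t = Re (vd (\<lambda>t. of_real (\<beta> k t)) t)" for k t
  have sm\<beta>: "smooth_gen (\<lambda>t. of_real (\<beta> k t))" for k
    using smooth_gen.mult[OF smooth_gen.affine[OF sm, of "real (Suc k)" "- real (Suc k) * a"]
      smooth_gen.affine[OF sm, of "- real (Suc k)" "real (Suc k) * b"]]
    by (simp add: \<beta>_def algebra_simps)
  have supp: "\<beta> k t = 0" if "t \<notin> {a<..<b}" for k t
    using that unfolding \<beta>_def h_def by (auto simp: mult_le_0_iff)
  have "test_pair (\<beta> k) (\<beta>' k)" for k
  proof (rule test_pairI[OF sm\<beta> assms])
    show "(\<beta> k has_real_derivative \<beta>' k t) (at t)" for t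
      using bounded_linear.has_vector_derivative[OF bounded_linear_Re smooth_gen_vd(2)[OF sm\<beta>]]
      unfolding \<beta>'_def has_real_derivative_iff_has_vector_derivative by simp
  qed (use supp in auto)
  moreover have "0 \<le> \<beta> k t" "\<beta> k t \<le> 1" for k t
    unfolding \<beta>_def using h by (auto intro: mult_le_one)
  moreover have "0 < \<beta> k t" if "t \<in> {a<..<b}" for k t
    using that unfolding \<beta>_def h_def by (auto simp: mult_le_0_iff)
  moreover have "(\<lambda>k. \<beta> k t) \<longlonglongrightarrow> 1" if "t \<in> {a<..<b}" for t
  proof -
    have *: "(\<lambda>k. h (real (Suc k) * c)) \<longlonglongrightarrow> 1" if "c > 0" for c
    proof -
      have "(\<lambda>k. exp (- ((1 / real (Suc k)) * (1 / c)))) \<longlonglongrightarrow> exp (- (0 * (1 / c)))"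
        by (intro tendsto_intros LIMSEQ_Suc[OF lim_1_over_n])
      then show ?thesis using that by (simp add: h_def mult_le_0_iff)
    qed
    have "(\<lambda>k. \<beta> k t) \<longlonglongrightarrow> 1 * 1"
      unfolding \<beta>_def using that by (intro tendsto_mult *) auto
    then show ?thesis by simp
  qed
  ultimately show ?thesis using supp by (intro that)
qed

text \<open>The vanishing integral is exactly what makes the primitive vanish to the right of the
  support.\<close>

lemma test_pair_primitive:
  assumes "test_pair f f'" and zero: "integral UNIV f = 0"
  obtains F where "test_pair F f"
proof -
  note D = test_pairD[OF assms(1)]
  obtain a b where ab: "0 < a" "a < b" "\<And>t. t \<notin> {a..b} \<Longrightarrow> f t = 0" using D(8) by blast
  \<comment> \<open>Starting at \<open>a/2\<close>, strictly left of the support, makes every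
    \<open>t \<ge> a\<close> an interior point of the interval on which \<open>F\<close> is
    differentiated.\<close>
  define F where "F t = integral {a/2..t} f" for t
  have int: "f integrable_on {x..y}" for x y
    by (rule integrable_continuous_interval) (rule continuous_on_subset[OF D(4)], simp)
  have before: "F t = 0" if "t < a" for t
  proof -
    have "F t = integral {a/2..t} (\<lambda>_. 0)"
      unfolding F_def using that ab by (intro integral_cong) auto
    then show ?thesis by simp
  qed
  have after: "F t = 0" if "t > b" for t
  proof -
    have "F t = integral UNIV f"
      unfolding F_def using that ab
      by (intro integral_spike_set) (auto intro!: negligible_subset[OF negligible_empty])
    then show ?thesis using zero by simp
  qed
  have deriv: "(F has_real_derivative f t) (at t)" for t
  proof (cases "t < a")
    case True
    have "\<forall>\<^sub>F x in nhds t. x \<in> {..<a}" using True by (intro eventually_nhds_in_open) auto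
    then have "\<forall>\<^sub>F x in nhds t. F x = 0" by eventually_elim (use before in auto)
    then show ?thesis
      using DERIV_cong_ev[of t t F "\<lambda>_. 0" "f t" 0] ab True by simp
  next
    case False
    have "(F has_real_derivative f t) (at t within {a/2..t+1})"
      unfolding F_def using False ab
      by (intro integral_has_real_derivative continuous_on_subset[OF D(4)]) auto
    moreover have "at t within {a/2..t+1} = at t"
      using False ab by (intro at_within_interior) auto
    ultimately show ?thesis by simp
  qed
  have "smooth_gen (\<lambda>t. of_real (F t))"
    using deriv by (intro smooth_gen.prim[OF D(1)] has_vector_derivative_of_real)
      (simp add: has_real_derivative_iff_has_vector_derivative)
  then have "test_pair F f"
    using before after deriv ab by (intro test_pairI[of F a b]) force+
  then show ?thesis by (rule that)
qed

section \<open>Square-integrable functions\<close>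

text \<open>Pointwise scaling lets sets of functions, and of pairs of functions, serve as the
  carrier \<open>V\<close> of a form.\<close>

instantiation "fun" :: (type, real_vector) real_vector
begin

definition scaleR_fun where "scaleR_fun c f = (\<lambda>x. c *\<^sub>R f x)"

instance
  by standard (auto simp: scaleR_fun_def fun_eq_iff scaleR_add_right scaleR_add_left)

end

lemma scaleR_fun_apply [simp]: "(c *\<^sub>R f) x = c *\<^sub>R f x"
  by (simp add: scaleR_fun_def)

text \<open>Functions are not identified modulo null sets, so that membership and point values stay
  meaningful; the price is that \<open>L2_inner\<close> is only semidefinite.\<close>

definition L2 :: "'a measure \<Rightarrow> ('a \<Rightarrow> real) set" where
  "L2 M = {f \<in> borel_measurable M. integrable M (\<lambda>x. (f x)\<^sup>2)}"

definition L2_inner :: "'a measure \<Rightarrow> ('a \<Rightarrow> real) \<Rightarrow> ('a \<Rightarrow> real) \<Rightarrow> real" where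
  "L2_inner M f g = (\<integral>x. f x * g x \<partial>M)"

abbreviation L2_sq :: "'a measure \<Rightarrow> ('a \<Rightarrow> real) \<Rightarrow> real" where "L2_sq M f \<equiv> L2_inner M f f"

lemma L2_measurable: "f \<in> L2 M \<Longrightarrow> f \<in> borel_measurable M"
  unfolding L2_def by simp

lemma L2_square_integrable: "f \<in> L2 M \<Longrightarrow> integrable M (\<lambda>x. (f x)\<^sup>2)"
  unfolding L2_def by simp

lemma L2_inner_same: "L2_inner M f f = (\<integral>x. (f x)\<^sup>2 \<partial>M)"
  unfolding L2_inner_def power2_eq_square ..

lemma L2_mult_integrable:
  assumes "f \<in> L2 M" "g \<in> L2 M"
  shows "integrable M (\<lambda>x. f x * g x)"
proof (rule Bochner_Integration.integrable_bound)
  show "integrable M (\<lambda>x. (f x)\<^sup>2 + (g x)\<^sup>2)"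
    using assms by (auto intro: L2_square_integrable)
  show "(\<lambda>x. f x * g x) \<in> borel_measurable M"
    using assms by (intro borel_measurable_times L2_measurable)
  have "\<bar>a * b\<bar> \<le> a\<^sup>2 + b\<^sup>2" for a b :: real
  proof -
    have "0 \<le> (\<bar>a\<bar> - \<bar>b\<bar>)\<^sup>2" by simp
    then have "2 * \<bar>a * b\<bar> \<le> a\<^sup>2 + b\<^sup>2" by (simp add: power2_diff abs_mult)
    then show ?thesis using abs_ge_zero[of "a * b"] by linarith
  qed
  then show "AE x in M. norm (f x * g x) \<le> norm ((f x)\<^sup>2 + (g x)\<^sup>2)"
    by (simp add: abs_of_nonneg)
qed

lemma L2_bound:
  assumes "g \<in> L2 M" "f \<in> borel_measurable M" "AE x in M. \<bar>f x\<bar> \<le> \<bar>g x\<bar>"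
  shows "f \<in> L2 M"
  unfolding L2_def
proof (intro CollectI conjI assms(2) Bochner_Integration.integrable_bound[OF L2_square_integrable[OF assms(1)]])
  show "AE x in M. norm ((f x)\<^sup>2) \<le> norm ((g x)\<^sup>2)"
    using assms(3) by eventually_elim (simp add: abs_le_square_iff)
qed (use assms(2) in auto)

lemma L2_scale: "f \<in> L2 M \<Longrightarrow> (\<lambda>x. c * f x) \<in> L2 M"
  unfolding L2_def by (auto simp: power_mult_distrib)

lemma L2_add:
  assumes f: "f \<in> L2 M" and g: "g \<in> L2 M"
  shows "(\<lambda>x. f x + g x) \<in> L2 M"
proof -
  have "integrable M (\<lambda>x. (f x)\<^sup>2 + 2 * (f x * g x) + (g x)\<^sup>2)"
    by (intro Bochner_Integration.integrable_add integrable_mult_right L2_square_integrable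
        L2_mult_integrable f g)
  then show ?thesis using f g unfolding L2_def by (auto simp: power2_sum algebra_simps)
qed

lemma L2_diff:
  assumes f: "f \<in> L2 M" and g: "g \<in> L2 M"
  shows "(\<lambda>x. f x - g x) \<in> L2 M"
  using L2_add[OF f L2_scale[OF g, of "-1"]] by simp

lemma L2_zero: "(\<lambda>_. 0) \<in> L2 M"
  unfolding L2_def by simp

lemma semi_inner_L2: "semi_inner (L2 M) (L2_inner M)"
proof
  show "subspace (L2 M)"
    by (rule subspaceI)
      (use L2_add L2_scale L2_zero in \<open>auto simp: plus_fun_def scaleR_fun_def zero_fun_def\<close>)
next
  fix f g h assume "f \<in> L2 M" "g \<in> L2 M" "h \<in> L2 M"
  then show "L2_inner M (f + g) h = L2_inner M f h + L2_inner M g h"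
    unfolding L2_inner_def
    by (simp add: L2_mult_integrable distrib_right)
qed (simp_all add: L2_inner_def mult.assoc, simp add: mult.commute)

interpretation L2: semi_inner "L2 M" "L2_inner M" for M
  by (rule semi_inner_L2)

lemma L2_nn_integral:
  assumes "f \<in> L2 M"
  shows "(\<integral>\<^sup>+x. ennreal ((f x)\<^sup>2) \<partial>M) = ennreal (\<integral>x. (f x)\<^sup>2 \<partial>M)"
  by (rule nn_integral_eq_integral) (use assms L2_square_integrable in auto)

lemma L2_iff_nn_integral:
  "f \<in> L2 M \<longleftrightarrow> f \<in> borel_measurable M \<and> (\<integral>\<^sup>+x. ennreal ((f x)\<^sup>2) \<partial>M) < \<infinity>"
  unfolding L2_def by (auto simp: integrable_iff_bounded)

lemma AE_eq_0_if_L2_inner_0: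
  assumes "f \<in> L2 M" "L2_inner M f f = 0"
  shows "AE x in M. f x = 0"
  using integral_nonneg_eq_0_iff_AE[OF L2_square_integrable[OF assms(1)]] assms(2)
  unfolding L2_inner_same by simp

lemma L2_AE_subseq:
  assumes f: "\<And>k. f k \<in> L2 M" and lim: "(\<lambda>k. L2_sq M (f k)) \<longlonglongrightarrow> 0"
  obtains r :: "nat \<Rightarrow> nat" where "strict_mono r" "AE x in M. (\<lambda>k. f (r k) x) \<longlonglongrightarrow> 0"
proof -
  have "\<exists>r::nat\<Rightarrow>nat. strict_mono r \<and> (AE x in M. (\<lambda>k. (f (r k) x)\<^sup>2) \<longlonglongrightarrow> 0)"
    by (rule tendsto_L1_AE_subseq) (use f lim in \<open>auto simp: L2_square_integrable L2_inner_same\<close>)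
  then show ?thesis using that by auto
qed

text \<open>The Riesz-Fischer argument: a fast subsequence converges almost everywhere, and Fatou's
  lemma shows that its limit is also the limit in mean square.\<close>

lemma L2_complete:
  assumes f: "\<And>k. f k \<in> L2 M"
    and cauchy: "\<And>e. e > 0 \<Longrightarrow> \<exists>N. \<forall>m\<ge>N. \<forall>k\<ge>N. L2_sq M (f m - f k) < e"
  obtains g where "g \<in> L2 M" "(\<lambda>k. L2_sq M (f k - g)) \<longlonglongrightarrow> 0"
proof -
  note [measurable] = L2_measurable[OF f]
  have fd: "f m - f k \<in> L2 M" for m k using f by (intro L2.closed)
  have nn: "(\<integral>\<^sup>+x. ennreal ((f m x - f k x)\<^sup>2) \<partial>M) = ennreal (L2_sq M (f m - f k))" for m k
    using L2_nn_integral[OF fd] by (simp add: L2_inner_same)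
  have "\<exists>N. \<forall>m\<ge>N. \<forall>k\<ge>N. L2_sq M (f m - f k) < (1/4)^j" for j
    by (rule cauchy) simp
  then obtain N where N: "\<And>j m k. m \<ge> N j \<Longrightarrow> k \<ge> N j \<Longrightarrow> L2_sq M (f m - f k) < (1/4)^j"
    by metis
  \<comment> \<open>Adding up all earlier thresholds makes both \<open>r j\<close> and
    \<open>r (Suc j)\<close> at least \<open>N j\<close>, and \<open>r j \<ge> j\<close>, without a
    recursive choice.\<close>
  define r where "r j = j + (\<Sum>i\<le>j. N i)" for j
  have rN: "N j \<le> r j" "N j \<le> r (Suc j)" and rj: "j \<le> r j" for j
    using member_le_sum[of j "{..j}" N] unfolding r_def by auto
  \<comment> \<open>The squares of \<open>d j\<close> have integral at most \<open>(1/4)^j\<close>.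
    Weighting them by \<open>2^j\<close> keeps the sum integrable, and a finite weighted sum at a
    point bounds \<open>d j\<close> there by a geometric sequence, so the increments are
    summable.\<close>
  define d where "d j x = f (r (Suc j)) x - f (r j) x" for j x
  have [measurable]: "d j \<in> borel_measurable M" for j unfolding d_def by simp
  have "(\<integral>\<^sup>+x. (\<Sum>j. ennreal (2^j * (d j x)\<^sup>2)) \<partial>M) = (\<Sum>j. \<integral>\<^sup>+x. ennreal (2^j * (d j x)\<^sup>2) \<partial>M)"
    by (rule nn_integral_suminf) simp
  also have "\<dots> \<le> (\<Sum>j. ennreal ((1/2)^j))"
  proof (rule suminf_le)
    fix j
    have "(\<integral>\<^sup>+x. ennreal (2^j * (d j x)\<^sup>2) \<partial>M) = ennreal (2^j) * (\<integral>\<^sup>+x. ennreal ((d j x)\<^sup>2) \<partial>M)"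
      by (simp add: ennreal_mult nn_integral_cmult)
    also have "\<dots> \<le> ennreal (2^j) * ennreal ((1/4)^j)"
      unfolding d_def nn using N[OF rN(2) rN(1), of j]
      by (intro mult_left_mono ennreal_leI) auto
    also have "\<dots> = ennreal ((1/2)^j)"
      by (simp flip: ennreal_mult power_mult_distrib)
    finally show "(\<integral>\<^sup>+x. ennreal (2^j * (d j x)\<^sup>2) \<partial>M) \<le> ennreal ((1/2)^j)" .
  qed auto
  also have "\<dots> < \<infinity>"
    by (subst suminf_ennreal2) (auto simp: summable_geometric)
  finally have "AE x in M. (\<Sum>j. ennreal (2^j * (d j x)\<^sup>2)) \<noteq> \<infinity>"
    by (intro nn_integral_PInf_AE) auto
  then have conv: "AE x in M. convergent (\<lambda>j. f (r j) x)"
  proof eventually_elim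
    case (elim x)
    let ?S = "\<Sum>j. ennreal (2^j * (d j x)\<^sup>2)"
    define S where "S = enn2real ?S"
    have S: "0 \<le> S" "?S = ennreal S"
      using elim unfolding S_def by (simp_all only: enn2real_nonneg ennreal_enn2real_if infinity_ennreal_def if_False)
    have bound: "\<bar>d j x\<bar> \<le> sqrt S * (sqrt (1/2))^j" for j
    proof -
      have "ennreal (2^j * (d j x)\<^sup>2) \<le> ?S"
        by (rule order_trans[OF _ sum_le_suminf[of _ "{j}"]]) (simp_all only: sum.insert_remove
            finite.emptyI finite.insertI empty_Diff sum.empty add_0_right summableI zero_le order_refl)
      then have "2^j * (d j x)\<^sup>2 \<le> S" using S(1) unfolding S(2) by (simp only: ennreal_le_iff)
      then have "(d j x)\<^sup>2 \<le> S * (1/2)^j" by (simp add: field_simps power_one_over)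
      then have "sqrt ((d j x)\<^sup>2) \<le> sqrt (S * (1/2)^j)" by (rule real_sqrt_le_mono)
      moreover have "sqrt (S * (1/2)^j) = sqrt S * (sqrt (1/2))^j"
        by (simp only: real_sqrt_mult real_sqrt_power)
      ultimately show ?thesis by (simp only: real_sqrt_abs)
    qed
    have "sqrt (1/2) < 1" by simp
    then have "summable (\<lambda>j. sqrt S * (sqrt (1/2))^j)"
      by (intro summable_mult summable_geometric) simp
    then have "summable (\<lambda>j. d j x)"
      by (rule summable_comparison_test') (use bound in simp)
    then have "convergent (\<lambda>n. \<Sum>j<n. d j x)" using summable_iff_convergent by blast
    moreover have "(\<Sum>j<n. d j x) = f (r n) x - f (r 0) x" for n
      unfolding d_def by (rule sum_lessThan_telescope)
    ultimately have "convergent (\<lambda>n. f (r n) x - f (r 0) x + f (r 0) x)"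
      by (intro convergent_add convergent_const) simp
    then show ?case by simp
  qed
  define g where "g x = lim (\<lambda>j. f (r j) x)" for x
  have gm [measurable]: "g \<in> borel_measurable M" unfolding g_def by simp
  have limit: "AE x in M. (\<lambda>j. f (r j) x) \<longlonglongrightarrow> g x"
    using conv by eventually_elim (simp add: g_def convergent_LIMSEQ_iff)
  \<comment> \<open>Fatou's lemma along the subsequence transfers the Cauchy bound to the limit
    \<open>g\<close>.\<close>
  have le: "(\<integral>\<^sup>+x. ennreal ((f k x - g x)\<^sup>2) \<partial>M) \<le> ennreal e"
    if k: "\<And>m. m \<ge> n \<Longrightarrow> L2_sq M (f k - f m) < e" for k n e
  proof -
    have "(\<integral>\<^sup>+x. ennreal ((f k x - g x)\<^sup>2) \<partial>M)
        = (\<integral>\<^sup>+x. liminf (\<lambda>j. ennreal ((f k x - f (r j) x)\<^sup>2)) \<partial>M)"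
    proof (rule nn_integral_cong_AE)
      show "AE x in M. ennreal ((f k x - g x)\<^sup>2) = liminf (\<lambda>j. ennreal ((f k x - f (r j) x)\<^sup>2))"
        using limit
      proof eventually_elim
        case (elim x)
        have "(\<lambda>j. ennreal ((f k x - f (r j) x)\<^sup>2)) \<longlonglongrightarrow> ennreal ((f k x - g x)\<^sup>2)"
          by (intro tendsto_ennrealI tendsto_intros elim)
        then show ?case by (intro lim_imp_Liminf[symmetric]) simp_all
      qed
    qed
    also have "\<dots> \<le> liminf (\<lambda>j. \<integral>\<^sup>+x. ennreal ((f k x - f (r j) x)\<^sup>2) \<partial>M)"
      by (rule nn_integral_liminf) simp
    also have "\<dots> \<le> ennreal e"
    proof (rule Liminf_le)
      show "\<forall>\<^sub>F j in sequentially. (\<integral>\<^sup>+x. ennreal ((f k x - f (r j) x)\<^sup>2) \<partial>M) \<le> ennreal e"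
        using eventually_ge_at_top[of n]
      proof eventually_elim
        case (elim j)
        then have "r j \<ge> n" using rj[of j] by simp
        then show ?case unfolding nn using k[of "r j"] by (intro ennreal_leI) simp
      qed
    qed simp
    finally show ?thesis .
  qed
  obtain n where "\<And>m k. m \<ge> n \<Longrightarrow> k \<ge> n \<Longrightarrow> L2_sq M (f m - f k) < 1"
    using cauchy[of 1] by auto
  then have "(\<integral>\<^sup>+x. ennreal ((f n x - g x)\<^sup>2) \<partial>M) \<le> ennreal 1" by (intro le[of n]) auto
  then have "(\<integral>\<^sup>+x. ennreal ((f n x - g x)\<^sup>2) \<partial>M) < \<infinity>"
    using ennreal_less_top le_less_trans by (metis infinity_ennreal_def)
  then have "(\<lambda>x. f n x - g x) \<in> L2 M" by (simp add: L2_iff_nn_integral)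
  from L2_diff[OF f[of n] this] have g: "g \<in> L2 M" by simp
  have "(\<lambda>k. L2_sq M (f k - g)) \<longlonglongrightarrow> 0"
  proof (rule LIMSEQ_I)
    fix e :: real assume "0 < e"
    then obtain n where n: "\<And>m k. m \<ge> n \<Longrightarrow> k \<ge> n \<Longrightarrow> L2_sq M (f m - f k) < e / 2"
      using cauchy[of "e/2"] by auto
    have "norm (L2_sq M (f k - g) - 0) < e" if "k \<ge> n" for k
    proof -
      have L: "f k - g \<in> L2 M" using f g by (intro L2.closed)
      have "(\<integral>\<^sup>+x. ennreal ((f k x - g x)\<^sup>2) \<partial>M) \<le> ennreal (e/2)"
        using n that by (intro le[of n]) auto
      then have "ennreal (L2_sq M (f k - g)) \<le> ennreal (e/2)"
        using L2_nn_integral[OF L] by (simp add: L2_inner_same)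
      then show ?thesis using \<open>0 < e\<close> L2.nonneg[OF L] by (simp add: ennreal_le_iff)
    qed
    then show "\<exists>n. \<forall>k\<ge>n. norm (L2_sq M (f k - g) - 0) < e" by blast
  qed
  with g show ?thesis by (rule that)
qed

text \<open>A measure on the whole line that ignores nonpositive points: functions remain total and
  measurability remains that of \<open>borel\<close>.\<close>

definition half_line :: "real measure" where
  "half_line = density lborel (indicator {0<..})"

abbreviation "hl_inner \<equiv> L2_inner half_line"

abbreviation "hl_sq \<equiv> L2_sq half_line"

lemma sets_half_line [simp, measurable_cong]: "sets half_line = sets borel"
  and space_half_line [simp]: "space half_line = UNIV"
  unfolding half_line_def by simp_all

lemma nn_integral_half_line:
  assumes "f \<in> borel_measurable borel"
  shows "(\<integral>\<^sup>+t. f t \<partial>half_line) = (\<integral>\<^sup>+t\<in>{0<..}. f t \<partial>lborel)"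
  using assms unfolding half_line_def
  by (subst nn_integral_density) (auto simp: mult.commute)

lemma AE_half_line: "(AE t in half_line. P t) \<longleftrightarrow> (AE t in lborel. 0 < t \<longrightarrow> P t)"
  unfolding half_line_def by (subst AE_density) (auto simp: indicator_def)

lemma half_line_eq: "half_line = density lborel (\<lambda>t. ennreal (indicator {0<..} t))"
  unfolding half_line_def by (simp add: ennreal_indicator)

lemma integral_half_line:
  fixes f :: "real \<Rightarrow> 'b::{banach, second_countable_topology}"
  assumes "f \<in> borel_measurable borel"
  shows "(\<integral>t. f t \<partial>half_line) = (LINT t:{0<..}|lborel. f t)"
  unfolding half_line_eq set_lebesgue_integral_def
  by (rule integral_density) (use assms in auto)

lemma emeasure_half_line_finite: "emeasure half_line {a<..<b} < \<infinity>"
proof -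
  have "emeasure half_line {a<..<b} \<le> emeasure lborel {a<..<b}"
    unfolding half_line_def
    by (subst emeasure_density)
      (auto simp flip: nn_integral_indicator intro!: nn_integral_mono split: split_indicator)
  also have "\<dots> < \<infinity>" by (cases "a \<le> b") auto
  finally show ?thesis .
qed

lemma bounded_support_L2:
  assumes [measurable]: "f \<in> borel_measurable borel"
    and f: "\<And>t. \<bar>f t\<bar> \<le> C * indicator {a<..<b} t"
  shows "f \<in> L2 half_line"
proof (rule L2_bound[of "\<lambda>t. C * indicator {a<..<b} t"])
  have "integrable half_line (\<lambda>t. indicator {a<..<b} t :: real)"
    using emeasure_half_line_finite[of a b] by (simp add: integrable_indicator_iff)
  moreover have "(indicator {a<..<b} t)\<^sup>2 = (indicator {a<..<b} t :: real)" for t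
    by (simp add: indicator_def)
  ultimately have "indicator {a<..<b} \<in> L2 half_line" unfolding L2_def by simp
  then show "(\<lambda>t. C * indicator {a<..<b} t) \<in> L2 half_line" by (rule L2_scale)
qed (use f in \<open>auto intro: order_trans[OF _ abs_ge_self]\<close>)

lemma test_pair_bounded:
  assumes "test_pair f f'"
  obtains C a b where "0 < a" "a < b" "0 \<le> C" "\<And>t. \<bar>f t\<bar> \<le> C * indicator {a<..<b} t"
proof -
  note D = test_pairD[OF assms]
  obtain a b where ab: "0 < a" "a < b" "\<And>t. t \<notin> {a..b} \<Longrightarrow> f t = 0" using D(8) by blast
  have "compact (f ` {a..b})"
    by (intro compact_continuous_image continuous_on_subset[OF D(4)]) auto
  then obtain C where C: "\<And>t. t \<in> {a..b} \<Longrightarrow> \<bar>f t\<bar> \<le> C"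
    using compact_imp_bounded bounded_iff by (metis imageI real_norm_def)
  have "0 \<le> C" using C[of a] ab by simp
  moreover have "\<bar>f t\<bar> \<le> C * indicator {a/2<..<b+1} t" for t
    using ab C \<open>0 \<le> C\<close> by (cases "t \<in> {a..b}") (auto simp: indicator_def)
  ultimately show ?thesis using ab by (intro that[of "a/2" "b+1" C]) auto
qed

lemma test_pair_L2:
  assumes "test_pair f f'"
  shows "f \<in> L2 half_line"
proof -
  obtain C a b where "\<And>t. \<bar>f t\<bar> \<le> C * indicator {a<..<b} t"
    using test_pair_bounded[OF assms] by metis
  then show ?thesis by (rule bounded_support_L2[OF test_pairD(6)[OF assms]])
qed

section \<open>Density of test functions in \<open>L2\<close> of the half-line\<close>

definition test_functions :: "(real \<Rightarrow> real) set" where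
  "test_functions = {f. \<exists>f'. test_pair f f'}"

lemma test_functions_subset: "test_functions \<subseteq> L2 half_line"
  unfolding test_functions_def using test_pair_L2 by blast

lemma subspace_test_functions: "subspace test_functions"
  unfolding test_functions_def
  by (rule subspaceI)
    (use test_pair_zero test_pair_add test_pair_scale in
      \<open>auto simp: zero_fun_def plus_fun_def scaleR_fun_def, blast+\<close>)

definition test_closure :: "(real \<Rightarrow> real) set" where
  "test_closure = semi_inner.form_closure (L2 half_line) hl_inner test_functions"

lemma test_closure_L2: "v \<in> test_closure \<Longrightarrow> v \<in> L2 half_line"
  unfolding test_closure_def L2.form_closure_def by simp

lemmas test_closure_limit = L2.form_closure_limit[OF test_functions_subset, folded test_closure_def]

lemma test_pair_in_closure: "test_pair f f' \<Longrightarrow> f \<in> test_closure"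
  unfolding test_closure_def using L2.form_closure_superset[OF test_functions_subset]
  by (auto simp: test_functions_def)

lemma
  shows test_closure_add: "\<lbrakk>u \<in> test_closure; v \<in> test_closure\<rbrakk> \<Longrightarrow> (\<lambda>t. u t + v t) \<in> test_closure"
    and test_closure_scale: "u \<in> test_closure \<Longrightarrow> (\<lambda>t. c * u t) \<in> test_closure"
  using L2.subspace_form_closure[OF subspace_test_functions test_functions_subset]
  unfolding subspace_def test_closure_def by (auto simp: plus_fun_def scaleR_fun_def)

lemma L2_dominated_convergence:
  assumes u: "\<And>i. u i \<in> borel_measurable M" and g: "g \<in> L2 M"
    and bound: "\<And>i. AE x in M. \<bar>u i x\<bar> \<le> g x"
    and lim: "AE x in M. (\<lambda>i. u i x) \<longlonglongrightarrow> v x" and v: "v \<in> borel_measurable M"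
  shows "v \<in> L2 M" "(\<lambda>i. L2_sq M (v - u i)) \<longlonglongrightarrow> 0"
proof -
  note [measurable] = u v L2_measurable[OF g]
  have "AE x in M. \<forall>i. \<bar>u i x\<bar> \<le> g x" using bound by (simp add: AE_all_countable)
  with lim have vg: "AE x in M. \<bar>v x\<bar> \<le> g x"
  proof eventually_elim
    case (elim x)
    then show ?case by (intro LIMSEQ_le_const2[OF tendsto_rabs]) auto
  qed
  then show "v \<in> L2 M" by (intro L2_bound[OF g]) auto
  have "(\<lambda>i. \<integral>x. (v x - u i x)\<^sup>2 \<partial>M) \<longlonglongrightarrow> (\<integral>x. 0 \<partial>M)"
  proof (rule integral_dominated_convergence)
    show "integrable M (\<lambda>x. (2 * g x)\<^sup>2)" by (intro L2_square_integrable L2_scale g)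
    show "AE x in M. (\<lambda>i. (v x - u i x)\<^sup>2) \<longlonglongrightarrow> 0"
      using lim by eventually_elim (auto intro!: tendsto_eq_intros)
    show "AE x in M. norm ((v x - u i x)\<^sup>2) \<le> (2 * g x)\<^sup>2" for i
      using vg bound[of i]
    proof eventually_elim
      case (elim x)
      then have "\<bar>v x - u i x\<bar> \<le> \<bar>2 * g x\<bar>" by linarith
      then show ?case unfolding abs_le_square_iff by simp
    qed
  qed auto
  then show "(\<lambda>i. L2_sq M (v - u i)) \<longlonglongrightarrow> 0"
    by (simp add: L2_inner_same)
qed

text \<open>Dominated convergence in \<open>L2\<close>, combined with closedness of the closure,
  supplies every limit passage in the density proof.\<close>

lemma test_closure_dominated:
  assumes u: "\<And>i. u i \<in> test_closure" and g: "g \<in> L2 half_line"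
    and bound: "\<And>i. AE x in half_line. \<bar>u i x\<bar> \<le> g x"
    and lim: "AE x in half_line. (\<lambda>i. u i x) \<longlonglongrightarrow> v x" and v: "v \<in> borel_measurable borel"
  shows "v \<in> test_closure"
proof (rule test_closure_limit)
  have um: "u i \<in> borel_measurable half_line" for i
    using L2_measurable[OF test_closure_L2[OF u]]  .
  have vm: "v \<in> borel_measurable half_line" using v by simp
  show "v \<in> L2 half_line" by (rule L2_dominated_convergence(1)[OF um g bound lim vm])
  fix e :: real assume "e > 0"
  then have "\<forall>\<^sub>F i in sequentially. hl_sq (v - u i) < e"
    using order_tendstoD(2)[OF L2_dominated_convergence(2)[OF um g bound lim vm]] by blast
  then show "\<exists>u\<in>test_closure. hl_sq (v - u) < e"
    using u unfolding eventually_sequentially by blast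
qed

lemma indicator_Ioo_L2: "(indicator {a<..<b} :: real \<Rightarrow> real) \<in> L2 half_line"
  by (rule bounded_support_L2[of _ 1 a b]) auto

text \<open>Rays \<open>{..<x}\<close> form an intersection-stable generator of the Borel sets and
  cut \<open>{a<..<b}\<close> in intervals, whose indicators are limits of bumps because
  \<open>a > 0\<close>. Complements and disjoint unions stay in the closure, dominated by the
  indicator of \<open>{a<..<b}\<close>.\<close>

lemma indicator_in_test_closure:
  assumes a: "0 < a" and A: "A \<in> sets borel"
  shows "(indicator (A \<inter> {a<..<b}) :: real \<Rightarrow> real) \<in> test_closure"
proof -
  have Ioo: "(indicator {a<..<c} :: real \<Rightarrow> real) \<in> test_closure" for c
  proof (cases "a < c")
    case True
    obtain \<beta> \<beta>' :: "nat \<Rightarrow> real \<Rightarrow> real" where \<beta>: "\<And>k. test_pair (\<beta> k) (\<beta>' k)"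
      "\<And>k t. 0 \<le> \<beta> k t" "\<And>k t. \<beta> k t \<le> 1" "\<And>k t. t \<notin> {a<..<c} \<Longrightarrow> \<beta> k t = 0"
      "\<And>t. t \<in> {a<..<c} \<Longrightarrow> (\<lambda>k. \<beta> k t) \<longlonglongrightarrow> 1"
      using test_pair_bump[OF a True] by metis
    show ?thesis
    proof (rule test_closure_dominated[OF test_pair_in_closure[OF \<beta>(1)] indicator_Ioo_L2[of a c]])
      show "AE t in half_line. \<bar>\<beta> i t\<bar> \<le> indicator {a<..<c} t" for i
        using \<beta>(2,3,4) by (auto simp: indicator_def)
      show "AE t in half_line. (\<lambda>i. \<beta> i t) \<longlonglongrightarrow> indicator {a<..<c} t"
      proof (rule AE_I2)
        fix t show "(\<lambda>i. \<beta> i t) \<longlonglongrightarrow> indicator {a<..<c} t"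
          using \<beta>(4,5)[of t] by (cases "t \<in> {a<..<c}") auto
      qed
    qed auto
  next
    case False
    then have "(indicator {a<..<c} :: real \<Rightarrow> real) = (\<lambda>_. 0)" by auto
    then show ?thesis using test_pair_in_closure[OF test_pair_zero] by simp
  qed
  let ?G = "range (\<lambda>x::real. {..<x})"
  have "Int_stable ?G"
  proof (rule Int_stableI)
    fix A B :: "real set" assume "A \<in> ?G" "B \<in> ?G"
    then obtain x y where "A = {..<x}" "B = {..<y}" by blast
    then have "A \<inter> B = {..<min x y}" by auto
    then show "A \<inter> B \<in> ?G" by blast
  qed
  moreover have "?G \<subseteq> Pow UNIV" by simp
  moreover have "A \<in> sigma_sets UNIV ?G"
    using A by (simp add: borel_Iio)
  ultimately show ?thesis
  proof (induction rule: sigma_sets_induct_disjoint)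
    case (basic A)
    then obtain x where "A = {..<x}" by blast
    then have "A \<inter> {a<..<b} = {a<..<min x b}" by auto
    then show ?case using Ioo by simp
  next
    case empty
    then show ?case using test_pair_in_closure[OF test_pair_zero] by (simp add: zero_fun_def)
  next
    case (compl A)
    have "(indicator ((UNIV - A) \<inter> {a<..<b}) :: real \<Rightarrow> real)
        = (\<lambda>t. indicator {a<..<b} t + (-1) * indicator (A \<inter> {a<..<b}) t)"
      by (auto simp: indicator_def)
    then show ?case using test_closure_add[OF Ioo test_closure_scale[OF compl(2), of "-1"]] by simp
  next
    case (union A)
    have Am: "A i \<in> sets borel" for i
      using union(2) by (auto simp: borel_Iio)
    have part: "(\<lambda>t. \<Sum>i<n. indicator (A i \<inter> {a<..<b}) t :: real) \<in> test_closure" for n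
    proof (induction n)
      case 0
      then show ?case using test_pair_in_closure[OF test_pair_zero] by simp
    next
      case (Suc n)
      then show ?case using test_closure_add[OF Suc union(3)[of n]] by simp
    qed
    have disj: "disjoint_family (\<lambda>i. A i \<inter> {a<..<b})"
      using union(1) unfolding disjoint_family_on_def by blast
    have part_eq: "(\<Sum>i<n. indicator (A i \<inter> {a<..<b}) t :: real) = indicator (\<Union>i<n. A i \<inter> {a<..<b}) t" for n t
      by (rule indicator_UN_disjoint[symmetric])
        (use disj in \<open>auto intro: disjoint_family_on_mono\<close>)
    show ?case
    proof (rule test_closure_dominated[OF part indicator_Ioo_L2[of a b]])
      show "AE t in half_line. \<bar>\<Sum>i<n. indicator (A i \<inter> {a<..<b}) t\<bar> \<le> (indicator {a<..<b} t :: real)" for n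
        unfolding part_eq by (auto simp: indicator_def)
      show "AE t in half_line. (\<lambda>n. \<Sum>i<n. indicator (A i \<inter> {a<..<b}) t)
          \<longlonglongrightarrow> (indicator (\<Union> (range A) \<inter> {a<..<b}) t :: real)"
      proof (rule AE_I2)
        fix t
        show "(\<lambda>n. \<Sum>i<n. indicator (A i \<inter> {a<..<b}) t)
          \<longlonglongrightarrow> (indicator (\<Union> (range A) \<inter> {a<..<b}) t :: real)"
          unfolding part_eq using LIMSEQ_indicator_UN[of "\<lambda>i. A i \<inter> {a<..<b}" t] by simp
      qed
    qed (use Am in auto)
  qed
qed

text \<open>Bounded nonnegative functions cut off to a bounded interval away from 0 come from
  indicators by measurable induction; the positive and negative parts of \<open>v\<close> are then
  truncated in height and in support.\<close>

theorem test_functions_dense_L2: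
  assumes v: "v \<in> L2 half_line"
  shows "v \<in> test_closure"
proof -
  \<comment> \<open>The bound \<open>C\<close> and the interval are quantified inside the induction
    statement, since scaling changes the bound and monotone limits need it as a dominating
    constant.\<close>
  have bounded: "\<forall>a b C. 0 < a \<longrightarrow> (\<forall>x. u x \<le> C) \<longrightarrow> (\<lambda>t. u t * indicator {a<..<b} t) \<in> test_closure"
    if "u \<in> borel_measurable borel" "\<And>x. 0 \<le> u x" for u :: "real \<Rightarrow> real"
    using that
  proof (induction rule: borel_measurable_induct_real)
    case (set A)
    then show ?case using indicator_in_test_closure[of _ A]
      by (simp flip: indicator_inter_arith)
  next
    case (mult u c)
    show ?case
    proof (intro allI impI)
      fix a b C :: real assume a: "0 < a" and C: "\<forall>x. c * u x \<le> C"
      show "(\<lambda>t. c * u t * indicator {a<..<b} t) \<in> test_closure"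
      proof (cases "c = 0")
        case True
        then show ?thesis using test_pair_in_closure[OF test_pair_zero] by simp
      next
        case False
        then have "\<forall>x. u x \<le> C / c" using C \<open>0 \<le> c\<close> by (simp add: field_simps)
        then have "(\<lambda>t. u t * indicator {a<..<b} t) \<in> test_closure" using mult(4) a by blast
        from test_closure_scale[OF this, of c] show ?thesis by (simp add: mult.assoc)
      qed
    qed
  next
    case (add u v)
    show ?case
    proof (intro allI impI)
      fix a b C :: real assume a: "0 < a" and C: "\<forall>x. v x + u x \<le> C"
      have "u x \<le> C" "v x \<le> C" for x
        using C[rule_format, of x] add.hyps(2)[of x] add.hyps(4)[of x]
        by linarith+
      then have "(\<lambda>t. u t * indicator {a<..<b} t) \<in> test_closure"
        "(\<lambda>t. v t * indicator {a<..<b} t) \<in> test_closure" using add.IH a by blast+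
      from test_closure_add[OF this(2,1)]
      show "(\<lambda>t. (v t + u t) * indicator {a<..<b} t) \<in> test_closure"
        by (simp add: distrib_right)
    qed
  next
    case (seq U)
    show ?case
    proof (intro allI impI)
      fix a b C :: real assume a: "0 < a" and C: "\<forall>x. u x \<le> C"
      have lim: "(\<lambda>i. U i x) \<longlonglongrightarrow> u x" for x using seq by simp
      have UC: "U i x \<le> C" for i x
      proof -
        have "incseq (\<lambda>i. U i x)" using \<open>incseq U\<close> by (auto simp: incseq_def le_fun_def)
        then have "U i x \<le> u x" by (rule incseq_le[OF _ lim])
        then show ?thesis using C order_trans by blast
      qed
      show "(\<lambda>t. u t * indicator {a<..<b} t) \<in> test_closure"
      proof (rule test_closure_dominated[of "\<lambda>i t. U i t * indicator {a<..<b} t"])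
        show "(\<lambda>t. U i t * indicator {a<..<b} t) \<in> test_closure" for i
          using seq.IH[of i] a UC by blast
        show "(\<lambda>t. C * indicator {a<..<b} t) \<in> L2 half_line" by (intro L2_scale indicator_Ioo_L2)
        show "AE t in half_line. \<bar>U i t * indicator {a<..<b} t\<bar> \<le> C * indicator {a<..<b} t" for i
          using UC seq(2) by (auto simp: indicator_def)
        show "AE t in half_line. (\<lambda>i. U i t * indicator {a<..<b} t) \<longlonglongrightarrow> u t * indicator {a<..<b} t"
          by (intro AE_I2 tendsto_intros lim)
      qed (use that(1) in auto)
    qed
  qed
  have vm [measurable]: "v \<in> borel_measurable borel" using L2_measurable[OF v] by simp
  \<comment> \<open>Both parts of \<open>v\<close> are capped at height \<open>n\<close> and
    restricted to \<open>inverse (n+1) < t < n\<close>. At every \<open>t > 0\<close> the value is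
    eventually \<open>v t\<close>, and \<open>v\<close> itself dominates.\<close>
  define T where "T n t = (min (max (v t) 0) (real n)) * indicator {inverse (real (Suc n))<..<real n} t
      + (-1) * ((min (max (- v t) 0) (real n)) * indicator {inverse (real (Suc n))<..<real n} t)" for n t
  show ?thesis
  proof (rule test_closure_dominated[of T "\<lambda>t. \<bar>v t\<bar>"])
    show "T n \<in> test_closure" for n
      unfolding T_def
      by (intro test_closure_add test_closure_scale bounded[rule_format, of _ _ "real n"]) auto
    show "(\<lambda>t. \<bar>v t\<bar>) \<in> L2 half_line" by (rule L2_bound[OF v]) auto
    show "AE t in half_line. \<bar>T n t\<bar> \<le> \<bar>v t\<bar>" for n
      by (rule AE_I2) (auto simp: T_def indicator_def)
    show "AE t in half_line. (\<lambda>n. T n t) \<longlonglongrightarrow> v t"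
      unfolding AE_half_line
    proof (rule AE_I2, rule impI)
      fix t :: real assume t: "0 < t"
      obtain n1 where n1: "inverse (real (Suc n1)) < t" using reals_Archimedean[OF t] by blast
      obtain n2 where n2: "\<bar>v t\<bar> + t < real n2" using reals_Archimedean2 by blast
      have "T n t = v t" if "n \<ge> max n1 n2" for n
      proof -
        have "inverse (real (Suc n)) \<le> inverse (real (Suc n1))" using that by simp
        moreover have "real n2 \<le> real n" using that by simp
        ultimately have "t \<in> {inverse (real (Suc n))<..<real n}" "\<bar>v t\<bar> \<le> real n"
          using n1 n2 t by (simp_all only: greaterThanLessThan_iff) linarith+
        then show ?thesis by (auto simp: T_def min_def max_def)
      qed
      then show "(\<lambda>n. T n t) \<longlonglongrightarrow> v t"
        by (intro tendsto_eventually eventually_sequentiallyI)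
    qed
  qed simp
qed

section \<open>The form domain\<close>

text \<open>Both forms arise by pulling back \<open>L2_inner\<close> along linear weight maps, so
  their axioms need no integration.\<close>

lemma semi_inner_pullback:
  assumes "semi_inner W B" "subspace V" "linear T" "\<And>x. x \<in> V \<Longrightarrow> T x \<in> W"
  shows "semi_inner V (\<lambda>x y. B (T x) (T y))"
proof -
  interpret semi_inner W B by fact
  interpret T: linear T by fact
  show ?thesis
    by standard (use assms(2,4) in \<open>auto simp: T.add T.scale bilin sym nonneg\<close>)
qed

lemma semi_inner_sum:
  assumes "semi_inner V B" "semi_inner V B'"
  shows "semi_inner V (\<lambda>x y. B x y + B' x y)"
proof -
  interpret B: semi_inner V B by fact
  interpret B': semi_inner V B' by fact
  show ?thesis
    by standard (auto simp: B.V B.bilin B'.bilin B.nonneg B'.nonneg B.sym B'.sym algebra_simps)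
qed

lemma semi_inner_subspace:
  assumes "semi_inner W B" "subspace V" "V \<subseteq> W"
  shows "semi_inner V B"
  using semi_inner_pullback[OF assms(1,2), of "\<lambda>x. x"] assms(3) by (auto simp: linear_iff)

lemma indicator_power2: "(indicator A x :: real)\<^sup>2 = indicator A x"
  by (simp add: indicator_def)

lemma L2_inner_cong_AE:
  assumes "AE x in M. f x = f' x" "AE x in M. g x = g' x"
    "f \<in> borel_measurable M" "f' \<in> borel_measurable M"
    "g \<in> borel_measurable M" "g' \<in> borel_measurable M"
  shows "L2_inner M f g = L2_inner M f' g'"
  unfolding L2_inner_def
proof (rule integral_cong_AE)
  show "AE x in M. f x * g x = f' x * g' x" using assms(1,2) by eventually_elim simp
qed (use assms(3-) in \<open>auto intro: borel_measurable_times\<close>)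

text \<open>The source of the Hoelder exponent one half: the indicator of \<open>(s, t)\<close> has
  \<open>L2\<close>-norm equal to the square root of \<open>t - s\<close>.\<close>

lemma L2_indicator_diff:
  assumes "0 \<le> s" "s \<le> t"
  shows "hl_sq (indicator {0<..<t} - indicator {0<..<s})
    = t - s"
proof -
  have "hl_sq (indicator {0<..<t} - indicator {0<..<s})
     = (LINT x:{0<..}|lborel. ((indicator {0<..<t} x - indicator {0<..<s} x) :: real)\<^sup>2)"
    unfolding L2_inner_same by (subst integral_half_line) auto
  also have "\<dots> = (\<integral>x. indicator {s<..t} x \<partial>lborel)"
    unfolding set_lebesgue_integral_def
  proof (rule integral_cong_AE)
    show "AE x in lborel. indicator {0<..} x *\<^sub>R (indicator {0<..<t} x - indicator {0<..<s} x)\<^sup>2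
        = (indicator {s<..t} x :: real)"
      using AE_lborel_singleton[of t] AE_lborel_singleton[of s]
      by eventually_elim (use assms in \<open>auto simp: indicator_def\<close>)
  qed auto
  also have "\<dots> = t - s" using assms by simp
  finally show ?thesis .
qed

text \<open>Written as an inner product with an indicator, point evaluation becomes a bounded
  functional of the derivative and so survives limits. The boundary term \<open>f 0\<close> vanishes
  by the support condition.\<close>

lemma test_pair_integral:
  assumes f: "test_pair f f'" and t: "0 \<le> t"
  shows "hl_inner f' (indicator {0<..<t}) = f t"
proof -
  note D = test_pairD[OF f]
  obtain a b where ab: "0 < a" "\<And>t. t \<notin> {a..b} \<Longrightarrow> f t = 0 \<and> f' t = 0" using D(8) by blast
  have [measurable]: "f' \<in> borel_measurable borel" by (rule D(7))
  have "hl_inner f' (indicator {0<..<t}) = (LINT x:{0<..}|lborel. f' x * indicator {0<..<t} x)"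
    unfolding L2_inner_def by (rule integral_half_line) simp
  also have "\<dots> = (\<integral>x. f' x * indicator {0..t} x \<partial>lborel)"
    unfolding set_lebesgue_integral_def
  proof (rule integral_cong_AE)
    show "AE x in lborel. indicator {0<..} x *\<^sub>R (f' x * indicator {0<..<t} x) = f' x * indicator {0..t} x"
      using AE_lborel_singleton[of t] AE_lborel_singleton[of 0]
      by eventually_elim (auto simp: indicator_def)
  qed auto
  also have "\<dots> = f t - f 0"
    by (rule integral_FTC_Icc_real[OF t D(3)])
      (use D(5) in \<open>simp add: continuous_on_eq_continuous_at\<close>)
  also have "f 0 = 0" using ab by auto
  finally show ?thesis by simp
qed

lemma test_pair_deriv_integral:
  assumes f: "test_pair f f'"
  shows "(\<integral>t. f' t \<partial>half_line) = 0"
proof -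
  obtain a b where ab: "0 < a" "a < b" "\<And>t. t \<notin> {a..b} \<Longrightarrow> f t = 0 \<and> f' t = 0"
    using test_pairD(8)[OF f] by blast
  have "f' x * indicator {0<..<b+1} x = f' x" for x
    using ab by (cases "x \<in> {a..b}") auto
  then have "(\<integral>t. f' t \<partial>half_line) = hl_inner f' (indicator {0<..<b+1})"
    unfolding L2_inner_def by (simp only:)
  also have "\<dots> = f (b + 1)" using ab by (intro test_pair_integral[OF f]) simp
  finally show ?thesis using ab(3)[of "b+1"] by simp
qed

lemma test_pair_mult:
  assumes "test_pair f f'" "test_pair g g'"
  shows "test_pair (\<lambda>t. f t * g t) (\<lambda>t. f' t * g t + f t * g' t)"
proof -
  note F = test_pairD[OF assms(1)] note G = test_pairD[OF assms(2)]
  obtain a b where ab: "0 < a" "a < b" "\<And>t. t \<notin> {a..b} \<Longrightarrow> f t = 0" using F(8) by blast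
  show ?thesis
  proof (rule test_pairI[of _ a b])
    show "smooth_gen (\<lambda>t. of_real (f t * g t))"
      using smooth_gen.mult[OF F(1) G(1)] by simp
    show "((\<lambda>t. f t * g t) has_real_derivative f' t * g t + f t * g' t) (at t)" for t
      using DERIV_mult[OF F(3) G(3), of t] by (simp add: algebra_simps)
  qed (use ab in auto)
qed

type_synonym fun_pair = "(real \<Rightarrow> real) \<times> (real \<Rightarrow> real)"

text \<open>The real problem \<open>- c w'' + \<kappa> t^2 w = l t^p w\<close> on the half-line, to
  be used with \<open>c = cB n\<close>, \<open>\<kappa> = n |\<Lambda>|\<close> and
  \<open>p = 2 - 4/n\<close>.\<close>

locale weighted_oscillator =
  fixes c \<kappa> p :: real
  assumes c_pos: "0 < c" and \<kappa>_pos: "0 < \<kappa>" and p_pos: "0 < p" and p_less: "p < 2"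
begin

text \<open>The square root of the weight is attached to the function, so that weighted forms become
  plain \<open>L2\<close> inner products. Besides \<open>q = p\<close>, which gives
  \<open>K\<close>, the case \<open>q = 0\<close> yields the unweighted \<open>L2\<close>
  bound.\<close>

definition wt_fun :: "real \<Rightarrow> fun_pair \<Rightarrow> real \<Rightarrow> real" where
  "wt_fun q x t = t powr (q / 2) * fst x t"

definition B_fun :: "fun_pair \<Rightarrow> real \<Rightarrow> real" where
  "B_fun x t = sqrt \<kappa> * t * fst x t"

definition B_deriv :: "fun_pair \<Rightarrow> real \<Rightarrow> real" where
  "B_deriv x t = sqrt c * snd x t"

definition B :: "fun_pair \<Rightarrow> fun_pair \<Rightarrow> real" where
  "B x y = hl_inner (B_fun x) (B_fun y) + hl_inner (B_deriv x) (B_deriv y)"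

definition K :: "fun_pair \<Rightarrow> fun_pair \<Rightarrow> real" where
  "K x y = hl_inner (wt_fun p x) (wt_fun p y)"

text \<open>The ambient space where \<open>B\<close> is finite. Nothing relates the two components
  here; they become function and weak derivative only on the closure \<open>H\<close> of the test
  pairs.\<close>

definition H0 :: "fun_pair set" where
  "H0 = {x. fst x \<in> borel_measurable borel \<and> snd x \<in> borel_measurable borel \<and>
     B_fun x \<in> L2 half_line \<and> B_deriv x \<in> L2 half_line}"

lemma linear_parts: "linear (wt_fun q)" "linear B_fun" "linear B_deriv"
  by (auto simp: linear_iff wt_fun_def B_fun_def B_deriv_def fun_eq_iff algebra_simps)

lemmas parts_diff = linear_diff[OF linear_parts(1)] linear_diff[OF linear_parts(2)]
  linear_diff[OF linear_parts(3)]

lemma subspace_H0: "subspace H0"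
proof (rule subspaceI)
  show "0 \<in> H0"
    by (auto simp: H0_def linear_0[OF linear_parts(2)] linear_0[OF linear_parts(3)] L2.closed
        zero_fun_def L2_zero)
next
  fix x y assume "x \<in> H0" "y \<in> H0"
  then show "x + y \<in> H0"
    by (auto simp: H0_def linear_add[OF linear_parts(2)] linear_add[OF linear_parts(3)] L2.closed
        plus_fun_def L2_add)
next
  fix a x assume "x \<in> H0"
  then show "a *\<^sub>R x \<in> H0"
    by (auto simp: H0_def linear_scale[OF linear_parts(2)] linear_scale[OF linear_parts(3)] L2.closed
        scaleR_fun_def L2_scale)
qed

lemma semi_inner_H0: "semi_inner H0 B"
  unfolding B_def
  by (intro semi_inner_sum semi_inner_pullback[OF semi_inner_L2] subspace_H0 linear_parts)
    (auto simp: H0_def)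

sublocale B0: semi_inner H0 B by (rule semi_inner_H0)

lemma test_pair_H0:
  assumes "test_pair f f'"
  shows "(f, f') \<in> H0"
proof -
  obtain f'' where f'': "test_pair f' f''" using test_pair_deriv[OF assms] .
  note [measurable] = test_pairD(6,7)[OF assms]
  obtain C a b where C: "0 \<le> C" "0 < a" "\<And>t. \<bar>f t\<bar> \<le> C * indicator {a<..<b} t"
    using test_pair_bounded[OF assms] by metis
  have "(\<lambda>t. t * f t) \<in> L2 half_line"
  proof (rule bounded_support_L2)
    show "\<bar>t * f t\<bar> \<le> (\<bar>b\<bar> * C) * indicator {a<..<b} t" for t
      using C(1,2) C(3)[of t] by (cases "t \<in> {a<..<b}") (auto simp: abs_mult intro!: mult_mono)
  qed simp
  then have "B_fun (f, f') \<in> L2 half_line"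
    using L2_scale[of "\<lambda>t. t * f t" half_line "sqrt \<kappa>"] by (simp add: B_fun_def[abs_def] mult.assoc)
  moreover have "B_deriv (f, f') \<in> L2 half_line"
    using L2_scale[OF test_pair_L2[OF f''], of "sqrt c"] by (simp add: B_deriv_def[abs_def])
  ultimately show ?thesis by (simp add: H0_def)
qed

definition H :: "fun_pair set" where
  "H = B0.form_closure {(f, f'). test_pair f f'}"

lemma test_pairs_subset: "{(f, f'). test_pair f f'} \<subseteq> H0"
  using test_pair_H0 by auto

lemma H_iff: "x \<in> H \<longleftrightarrow> x \<in> H0 \<and> (\<forall>e>0. \<exists>f f'. test_pair f f' \<and> B0.quad (x - (f, f')) < e)"
  unfolding H_def B0.form_closure_def by auto

lemmas H_limit = B0.form_closure_limit[OF test_pairs_subset, folded H_def]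

lemma test_pair_H: "test_pair f f' \<Longrightarrow> (f, f') \<in> H"
  unfolding H_def using B0.form_closure_superset[OF test_pairs_subset] by auto

lemma H_subset: "H \<subseteq> H0"
  unfolding H_iff subset_iff by simp

lemma H_approx:
  assumes "x \<in> H"
  obtains f f' :: "nat \<Rightarrow> real \<Rightarrow> real" where "\<And>k. test_pair (f k) (f' k)"
    "(\<lambda>k. B0.quad (x - (f k, f' k))) \<longlonglongrightarrow> 0"
proof -
  have "\<exists>f f'. test_pair f f' \<and> B0.quad (x - (f, f')) < inverse (real (Suc k))" for k
    using assms unfolding H_iff by simp
  then obtain f f' where f: "\<And>k. test_pair (f k) (f' k)"
    and le: "\<And>k. B0.quad (x - (f k, f' k)) < inverse (real (Suc k))" by metis
  have "(\<lambda>k. B0.quad (x - (f k, f' k))) \<longlonglongrightarrow> 0"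
  proof (rule tendsto_sandwich[OF _ _ tendsto_const LIMSEQ_inverse_real_of_nat])
    show "\<forall>\<^sub>F k in sequentially. 0 \<le> B0.quad (x - (f k, f' k))"
      using assms H_subset by (intro always_eventually allI B0.nonneg B0.closed test_pair_H0 f) auto
  qed (intro always_eventually allI less_imp_le le)
  with f show ?thesis by (rule that)
qed

lemma subspace_H: "subspace H"
  unfolding H_def
proof (rule B0.subspace_form_closure[OF subspaceI test_pairs_subset])
  show "0 \<in> {(f, f'). test_pair f f'}"
    using test_pair_zero by (simp add: zero_prod_def zero_fun_def)
next
  fix x y assume "x \<in> {(f, f'). test_pair f f'}" "y \<in> {(f, f'). test_pair f f'}"
  then show "x + y \<in> {(f, f'). test_pair f f'}"
    using test_pair_add by (auto simp: plus_fun_def)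
next
  fix a x assume "x \<in> {(f, f'). test_pair f f'}"
  then show "a *\<^sub>R x \<in> {(f, f'). test_pair f f'}"
    using test_pair_scale by (auto simp: scaleR_fun_def)
qed

sublocale BH: semi_inner H B
  by (rule semi_inner_subspace[OF semi_inner_H0 subspace_H H_subset])

lemma H_measurable:
  assumes "x \<in> H0"
  shows "fst x \<in> borel_measurable borel" "snd x \<in> borel_measurable borel"
  using assms by (auto simp: H0_def)

lemma snd_L2:
  assumes "x \<in> H0"
  shows "snd x \<in> L2 half_line" "c * hl_sq (snd x) \<le> B x x"
proof -
  have D: "B_deriv x \<in> L2 half_line" and E: "B_fun x \<in> L2 half_line" using assms by (auto simp: H0_def)
  have eq: "B_deriv x = sqrt c *\<^sub>R snd x" by (auto simp: B_deriv_def fun_eq_iff)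
  then have "snd x = (1 / sqrt c) *\<^sub>R B_deriv x" using c_pos by (auto simp: fun_eq_iff)
  then show s: "snd x \<in> L2 half_line" using L2.closed(2)[OF D] by metis
  have "hl_sq (B_deriv x) = c * hl_sq (snd x)"
    unfolding eq using c_pos by (simp add: L2.quad_scale[OF s])
  then show "c * hl_sq (snd x) \<le> B x x"
    unfolding B_def using L2.nonneg[OF E] by simp
qed

text \<open>The two weighted components converge in \<open>L2\<close> separately; dividing out the
  weights gives a pair in \<open>H0\<close>, and \<open>H\<close> is closed.\<close>

lemma B_complete:
  assumes X: "\<And>k. X k \<in> H"
    and cauchy: "\<And>e. e > 0 \<Longrightarrow> \<exists>N. \<forall>m\<ge>N. \<forall>k\<ge>N. B0.quad (X m - X k) < e"
  shows "\<exists>l\<in>H. (\<lambda>k. B0.quad (X k - l)) \<longlonglongrightarrow> 0"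
proof -
  have X0: "X k \<in> H0" for k using X H_subset by blast
  have E: "B_fun (X k) \<in> L2 half_line" and D: "B_deriv (X k) \<in> L2 half_line" for k
    using X0[of k] by (auto simp: H0_def)
  have le: "hl_sq (B_fun (X m) - B_fun (X k)) \<le> B0.quad (X m - X k)"
    "hl_sq (B_deriv (X m) - B_deriv (X k)) \<le> B0.quad (X m - X k)"
    for m k
    unfolding B_def parts_diff using L2.nonneg[OF L2.closed(3)[OF E[of m] E[of k]]]
      L2.nonneg[OF L2.closed(3)[OF D[of m] D[of k]]] by simp_all
  have cau: "\<exists>N. \<forall>m\<ge>N. \<forall>k\<ge>N.
      hl_sq (B_fun (X m) - B_fun (X k)) < e"
    "\<exists>N. \<forall>m\<ge>N. \<forall>k\<ge>N.
      hl_sq (B_deriv (X m) - B_deriv (X k)) < e"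
    if "e > 0" for e
    using cauchy[OF that] le_less_trans[OF le(1)] le_less_trans[OF le(2)] by blast+
  obtain g where g: "g \<in> L2 half_line"
    "(\<lambda>k. hl_sq (B_fun (X k) - g)) \<longlonglongrightarrow> 0"
    using L2_complete[of "\<lambda>k. B_fun (X k)", OF E cau(1)] by blast
  obtain h where h: "h \<in> L2 half_line"
    "(\<lambda>k. hl_sq (B_deriv (X k) - h)) \<longlonglongrightarrow> 0"
    using L2_complete[of "\<lambda>k. B_deriv (X k)", OF D cau(2)] by blast
  have [measurable]: "g \<in> borel_measurable borel" "h \<in> borel_measurable borel"
    using L2_measurable[OF g(1)] L2_measurable[OF h(1)] by simp_all
  \<comment> \<open>The weight of the first component is invertible only for
    \<open>t \<noteq> 0\<close>, so \<open>B_fun l\<close> is compared with \<open>g\<close> almost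
    everywhere on the half-line.\<close>
  define l where "l = (\<lambda>t. g t / (sqrt \<kappa> * t), \<lambda>t. h t / sqrt c)"
  have Dl: "B_deriv l = h" using c_pos by (auto simp: l_def B_deriv_def fun_eq_iff)
  have El: "B_fun l t = g t" if "0 < t" for t
    using that \<kappa>_pos by (simp add: l_def B_fun_def)
  have Elm [measurable]: "B_fun l \<in> borel_measurable borel" unfolding l_def B_fun_def[abs_def] by simp
  have AE_El: "AE t in half_line. B_fun l t = g t" unfolding AE_half_line using El by simp
  have El2: "B_fun l \<in> L2 half_line"
    by (rule L2_bound[OF g(1)]) (use AE_El in auto)
  have l0: "l \<in> H0" unfolding H0_def using El2 Dl h(1) by (simp add: l_def)
  have "hl_sq (B_fun (X k) - B_fun l)
      = hl_sq (B_fun (X k) - g)" for k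
  proof (rule L2_inner_cong_AE)
    show "AE t in half_line. (B_fun (X k) - B_fun l) t = (B_fun (X k) - g) t"
      using AE_El by eventually_elim simp
    then show "AE t in half_line. (B_fun (X k) - B_fun l) t = (B_fun (X k) - g) t" .
  qed (intro L2_measurable L2.closed E El2 g(1))+
  then have "(\<lambda>k. B0.quad (X k - l)) \<longlonglongrightarrow> 0 + 0"
    unfolding B_def parts_diff Dl by (intro tendsto_add) (simp_all add: g(2) h(2))
  then have lim: "(\<lambda>k. B0.quad (X k - l)) \<longlonglongrightarrow> 0" by simp
  have "l \<in> H"
  proof (rule H_limit[OF l0])
    fix e :: real assume "e > 0"
    then obtain k where "B0.quad (X k - l) < e"
      using order_tendstoD(2)[OF lim] unfolding eventually_sequentially by blast
    then show "\<exists>y\<in>H. B0.quad (l - y) < e"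
      using X B0.quad_diff_commute[OF X0 l0] by metis
  qed
  with lim show ?thesis by blast
qed

text \<open>The continuous representative of \<open>fst x\<close>, as the integral of the weak derivative from 0.\<close>

definition rep :: "fun_pair \<Rightarrow> real \<Rightarrow> real" where
  "rep x t = hl_inner (snd x) (indicator {0<..<t})"

lemma rep_0 [simp]: "rep x 0 = 0"
  unfolding rep_def by (simp add: L2_inner_def)

lemma rep_diff: "x \<in> H0 \<Longrightarrow> y \<in> H0 \<Longrightarrow> rep (x - y) t = rep x t - rep y t"
  unfolding rep_def by (simp add: snd_L2 indicator_Ioo_L2 L2.diff_left)

text \<open>Cauchy-Schwarz between the weak derivative and the indicator of the interval from
  \<open>s\<close> to \<open>t\<close>.\<close>

lemma rep_Hoelder:
  assumes x: "x \<in> H0" and st: "0 \<le> s" "0 \<le> t"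
  shows "(rep x t - rep x s)\<^sup>2 \<le> \<bar>t - s\<bar> * (B x x / c)"
proof -
  have *: "(rep x t - rep x s)\<^sup>2 \<le> \<bar>t - s\<bar> * (B x x / c)" if "0 \<le> s" "s \<le> t" for s t
  proof -
    let ?I = "indicator {0<..<t} - indicator {0<..<s} :: real \<Rightarrow> real"
    have I: "?I \<in> L2 half_line" by (intro L2.closed indicator_Ioo_L2)
    have "rep x t - rep x s = hl_inner (snd x) ?I"
      unfolding rep_def by (simp add: L2.diff_right snd_L2[OF x] indicator_Ioo_L2)
    then have "(rep x t - rep x s)\<^sup>2 \<le> hl_sq (snd x) * hl_inner ?I ?I"
      using L2.Cauchy_Schwarz[OF snd_L2(1)[OF x] I] by simp
    also have "hl_inner ?I ?I = t - s" by (rule L2_indicator_diff[OF that])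
    also have "hl_sq (snd x) * (t - s) \<le> (B x x / c) * (t - s)"
      using snd_L2(2)[OF x] c_pos that by (intro mult_right_mono) (auto simp: field_simps)
    finally show ?thesis using that by (simp add: mult.commute)
  qed
  show ?thesis
    using *[OF st(1), of t] *[OF st(2), of s]
    by (cases "s \<le> t") (auto simp: power2_commute abs_minus_commute)
qed

lemma rep_bound:
  assumes "x \<in> H0" "0 \<le> t"
  shows "(rep x t)\<^sup>2 \<le> t * (B x x / c)"
  using rep_Hoelder[OF assms(1) order_refl assms(2)] assms(2) by simp

lemma rep_test: "test_pair f f' \<Longrightarrow> 0 \<le> t \<Longrightarrow> rep (f, f') t = f t"
  unfolding rep_def by (simp add: test_pair_integral)

lemma tendsto_null_square_bound:
  fixes f g :: "nat \<Rightarrow> real"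
  assumes "g \<longlonglongrightarrow> 0" "\<And>k. (f k)\<^sup>2 \<le> C * g k"
  shows "f \<longlonglongrightarrow> 0"
proof -
  have "(\<lambda>k. (f k)\<^sup>2) \<longlonglongrightarrow> 0"
    by (rule tendsto_sandwich[OF _ _ tendsto_const tendsto_mult_right_zero[OF assms(1), of C]])
      (use assms(2) in auto)
  then show ?thesis by simp
qed

text \<open>Approximating test functions agree with their own representatives. They converge to
  \<open>rep x\<close> at every point by \<open>rep_bound\<close>, and a subsequence converges to
  \<open>fst x\<close> almost everywhere by convergence in the \<open>B\<close>-norm.\<close>

lemma rep_AE:
  assumes x: "x \<in> H"
  shows "AE t in half_line. fst x t = rep x t"
proof -
  have x0: "x \<in> H0" using x H_subset by blast
  obtain f f' :: "nat \<Rightarrow> real \<Rightarrow> real" where f: "\<And>k. test_pair (f k) (f' k)"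
    and lim: "(\<lambda>k. B0.quad (x - (f k, f' k))) \<longlonglongrightarrow> 0"
    using H_approx[OF x] by blast
  let ?d = "\<lambda>k. x - (f k, f' k)"
  have d0: "?d k \<in> H0" for k using x0 test_pair_H0[OF f] by (rule B0.closed)
  then have E: "B_fun (?d k) \<in> L2 half_line" and D: "B_deriv (?d k) \<in> L2 half_line" for k
    by (auto simp: H0_def)
  have "(\<lambda>k. hl_sq (B_fun (?d k))) \<longlonglongrightarrow> 0"
  proof (rule tendsto_sandwich[OF _ _ tendsto_const lim])
    show "\<forall>\<^sub>F k in sequentially. hl_sq (B_fun (?d k))
        \<le> B0.quad (?d k)"
      unfolding B_def using L2.nonneg[OF D] by simp
  qed (use L2.nonneg[OF E] in simp)
  from L2_AE_subseq[OF E this] obtain r :: "nat \<Rightarrow> nat" where r: "strict_mono r"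
    and AE: "AE t in half_line. (\<lambda>k. B_fun (x - (f (r k), f' (r k))) t) \<longlonglongrightarrow> 0" by blast
  show ?thesis
    using AE unfolding AE_half_line
  proof eventually_elim
    case (elim t)
    show ?case
    proof
      assume t: "0 < t"
      have "(\<lambda>k. rep (?d k) t) \<longlonglongrightarrow> 0"
        by (rule tendsto_null_square_bound[OF lim, of _ "t / c"])
          (use rep_bound[OF d0, of t] t in \<open>simp add: field_simps\<close>)
      then have "(\<lambda>k. rep x t - f k t) \<longlonglongrightarrow> 0"
        using t by (simp add: rep_diff x0 test_pair_H0[OF f] rep_test[OF f])
      then have 1: "(\<lambda>k. rep x t - f (r k) t) \<longlonglongrightarrow> 0"
        using LIMSEQ_subseq_LIMSEQ[OF _ r] by (simp add: o_def)
      have "(\<lambda>k. (1 / (sqrt \<kappa> * t)) * B_fun (x - (f (r k), f' (r k))) t) \<longlonglongrightarrow> 0"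
        using elim t by (intro tendsto_mult_right_zero) simp
      then have 2: "(\<lambda>k. fst x t - f (r k) t) \<longlonglongrightarrow> 0"
        using t \<kappa>_pos by (simp add: B_fun_def)
      have "(\<lambda>k. (rep x t - f (r k) t) - (fst x t - f (r k) t)) \<longlonglongrightarrow> 0 - 0"
        by (intro tendsto_diff 1 2)
      then show "fst x t = rep x t" by (simp add: LIMSEQ_const_iff)
    qed
  qed
qed

lemma integral_indicator_half_line: "0 \<le> b \<Longrightarrow> (\<integral>t. indicator {0<..<b} t \<partial>half_line) = b"
  using L2_indicator_diff[of 0 b] by (simp add: L2_inner_same indicator_power2)

text \<open>On \<open>(0, 1)\<close> the weight is at most 1 and \<open>rep_bound\<close> controls
  the function, which costs \<open>B x x / c\<close>; from 1 onwards
  \<open>t powr q \<le> t^2\<close> and the second term of \<open>B\<close> costs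
  \<open>B x x / \<kappa>\<close>. This is the origin of the constant.\<close>

lemma wt_fun_L2:
  assumes x: "x \<in> H" and q: "0 \<le> q" "q \<le> 2"
  shows "wt_fun q x \<in> L2 half_line"
    "hl_sq (wt_fun q x) \<le> (1 / \<kappa> + 1 / c) * B x x"
proof -
  have x0: "x \<in> H0" using x H_subset by blast
  note [measurable] = H_measurable[OF x0]
  have E: "B_fun x \<in> L2 half_line" and D: "B_deriv x \<in> L2 half_line" using x0 by (auto simp: H0_def)
  have Bnn: "0 \<le> B x x" by (rule B0.nonneg[OF x0])
  let ?g = "\<lambda>t. (B_fun x t)\<^sup>2 / \<kappa> + (B x x / c) * indicator {0<..<1} t"
  have g_int: "integrable half_line ?g"
    using L2_square_integrable[OF E] L2_square_integrable[OF indicator_Ioo_L2[of 0 1]]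
    by (intro Bochner_Integration.integrable_add integrable_mult_right integrable_divide)
      (simp_all add: indicator_power2)
  have bound: "AE t in half_line. (wt_fun q x t)\<^sup>2 \<le> ?g t"
    using rep_AE[OF x] AE_lborel_singleton[of 1] unfolding AE_half_line
  proof eventually_elim
    case (elim t)
    show ?case
    proof
      assume t: "0 < t"
      have sq: "(wt_fun q x t)\<^sup>2 = t powr q * (fst x t)\<^sup>2"
        using t by (simp add: wt_fun_def power_mult_distrib powr_power)
      have Esq: "(B_fun x t)\<^sup>2 / \<kappa> = t\<^sup>2 * (fst x t)\<^sup>2"
        using \<kappa>_pos by (simp add: B_fun_def power_mult_distrib)
      show "(wt_fun q x t)\<^sup>2 \<le> ?g t"
      proof (cases "t < 1")
        case True
        have "t powr q \<le> 1" using powr_mono2[of q t 1] t True q by simp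
        then have "t powr q * (fst x t)\<^sup>2 \<le> 1 * (fst x t)\<^sup>2" by (intro mult_right_mono) auto
        also have "\<dots> \<le> t * (B x x / c)" using rep_bound[OF x0, of t] elim t by simp
        also have "\<dots> \<le> 1 * (B x x / c)" using True Bnn c_pos by (intro mult_right_mono) auto
        finally show ?thesis unfolding sq using True t \<kappa>_pos by (simp add: add_increasing)
      next
        case False
        then have "t powr q \<le> t powr 2" using q by (intro powr_mono) auto
        then have "t powr q * (fst x t)\<^sup>2 \<le> t\<^sup>2 * (fst x t)\<^sup>2"
          using t by (intro mult_right_mono) auto
        then show ?thesis unfolding sq Esq using False by simp
      qed
    qed
  qed
  have wm [measurable]: "wt_fun q x \<in> borel_measurable borel" unfolding wt_fun_def[abs_def] by simp
  have int: "integrable half_line (\<lambda>t. (wt_fun q x t)\<^sup>2)"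
    by (rule Bochner_Integration.integrable_bound[OF g_int])
      (use bound in \<open>auto elim!: eventually_mono\<close>)
  then show "wt_fun q x \<in> L2 half_line" unfolding L2_def by simp
  have "(\<integral>t. (wt_fun q x t)\<^sup>2 \<partial>half_line) \<le> (\<integral>t. ?g t \<partial>half_line)"
    by (rule integral_mono_AE[OF int g_int bound])
  also have "\<dots> = (\<integral>t. (B_fun x t)\<^sup>2 \<partial>half_line) / \<kappa> + (B x x / c) * 1"
    using L2_square_integrable[OF E] L2_square_integrable[OF indicator_Ioo_L2[of 0 1]]
      integral_indicator_half_line[of 1]
    by (subst Bochner_Integration.integral_add) (simp_all add: indicator_power2)
  also have "\<dots> \<le> B x x / \<kappa> + (B x x / c) * 1"
    using L2.nonneg[OF D] \<kappa>_pos by (intro add_right_mono divide_right_mono) (auto simp: B_def L2_inner_same)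
  finally show "hl_sq (wt_fun q x) \<le> (1 / \<kappa> + 1 / c) * B x x"
    by (simp add: L2_inner_same algebra_simps)
qed

lemma semi_inner_K: "semi_inner H K"
  unfolding K_def
  by (intro semi_inner_pullback[OF semi_inner_L2] subspace_H linear_parts wt_fun_L2)
    (use p_pos p_less in auto)

lemma fst_L2:
  assumes x: "x \<in> H"
  shows "fst x \<in> L2 half_line" "hl_sq (fst x) \<le> (1 / \<kappa> + 1 / c) * B x x"
proof -
  have m [measurable]: "fst x \<in> borel_measurable borel" using x H_subset H_measurable by blast
  have AE: "AE t in half_line. wt_fun 0 x t = fst x t"
    unfolding AE_half_line by (simp add: wt_fun_def)
  note w = wt_fun_L2[OF x, of 0]
  show f: "fst x \<in> L2 half_line"
    by (rule L2_bound[of "wt_fun 0 x"]) (use w AE in \<open>auto elim: eventually_mono\<close>)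
  have "hl_sq (wt_fun 0 x) = hl_sq (fst x)"
    by (rule L2_inner_cong_AE[OF AE AE]) (use w f in \<open>auto intro: L2_measurable\<close>)
  then show "hl_sq (fst x) \<le> (1 / \<kappa> + 1 / c) * B x x" using w by simp
qed

text \<open>For test pairs the product rule and compact support suffice. Both sides are continuous
  in the \<open>B\<close>-norm, by \<open>snd_L2\<close> and \<open>fst_L2\<close>, so the identity
  passes to the closure.\<close>

lemma integration_by_parts:
  assumes x: "x \<in> H" and f: "test_pair f f'" "test_pair f' f''"
  shows "hl_inner (snd x) f' = - hl_inner (fst x) f''"
proof -
  have x0: "x \<in> H0" using x H_subset by blast
  obtain f''' where f''': "test_pair f'' f'''" using test_pair_deriv[OF f(2)] .
  have L: "f' \<in> L2 half_line" "f'' \<in> L2 half_line" using f(2) f''' by (auto intro: test_pair_L2)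
  have *: "hl_inner g' f' = - hl_inner g f''" if g: "test_pair g g'" for g g'
  proof -
    obtain g'' where "test_pair g' g''" using test_pair_deriv[OF g] .
    then have Lg: "g \<in> L2 half_line" "g' \<in> L2 half_line" using g by (auto intro: test_pair_L2)
    have "0 = (\<integral>t. g' t * f' t + g t * f'' t \<partial>half_line)"
      using test_pair_deriv_integral[OF test_pair_mult[OF g f(2)]] by simp
    also have "\<dots> = hl_inner g' f' + hl_inner g f''"
      unfolding L2_inner_def by (intro Bochner_Integration.integral_add L2_mult_integrable Lg L)
    finally show ?thesis by simp
  qed
  obtain g g' :: "nat \<Rightarrow> real \<Rightarrow> real" where g: "\<And>k. test_pair (g k) (g' k)"
    and lim: "(\<lambda>k. B0.quad (x - (g k, g' k))) \<longlonglongrightarrow> 0"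
    using H_approx[OF x] by blast
  let ?d = "\<lambda>k. x - (g k, g' k)"
  have dH: "?d k \<in> H" for k using x test_pair_H[OF g] by (rule BH.closed)
  then have d0: "?d k \<in> H0" for k using H_subset by blast
  have "(\<lambda>k. hl_inner (snd (?d k)) f') \<longlonglongrightarrow> 0"
  proof (rule tendsto_null_square_bound[OF lim, of _ "hl_inner f' f' / c"])
    fix k
    have "(hl_inner (snd (?d k)) f')\<^sup>2
      \<le> hl_sq (snd (?d k)) * hl_inner f' f'"
      by (intro L2.Cauchy_Schwarz snd_L2 d0 L)
    also have "\<dots> \<le> (B0.quad (?d k) / c) * hl_inner f' f'"
      using snd_L2(2)[OF d0, of k] c_pos by (intro mult_right_mono L2.nonneg L) (simp add: field_simps)
    finally show "(hl_inner (snd (?d k)) f')\<^sup>2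
      \<le> hl_inner f' f' / c * B0.quad (?d k)" by (simp add: mult.commute)
  qed
  moreover have "hl_inner (snd (?d k)) f'
      = hl_inner (snd x) f' - hl_inner (g' k) f'" for k
    using snd_L2(1)[OF x0] snd_L2(1)[OF test_pair_H0[OF g[of k]]] L by (simp add: L2.diff_left)
  moreover have "(\<lambda>k. hl_inner (fst (?d k)) f'') \<longlonglongrightarrow> 0"
  proof (rule tendsto_null_square_bound[OF lim, of _ "hl_inner f'' f'' * (1 / \<kappa> + 1 / c)"])
    fix k
    have "(hl_inner (fst (?d k)) f'')\<^sup>2
      \<le> hl_sq (fst (?d k)) * hl_inner f'' f''"
      by (intro L2.Cauchy_Schwarz fst_L2 dH L)
    also have "\<dots> \<le> ((1 / \<kappa> + 1 / c) * B0.quad (?d k)) * hl_inner f'' f''"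
      by (intro mult_right_mono fst_L2 dH L2.nonneg L)
    finally show "(hl_inner (fst (?d k)) f'')\<^sup>2
      \<le> hl_inner f'' f'' * (1 / \<kappa> + 1 / c) * B0.quad (?d k)"
      by (simp add: mult_ac)
  qed
  moreover have "hl_inner (fst (?d k)) f''
      = hl_inner (fst x) f'' - hl_inner (g k) f''" for k
    using fst_L2(1)[OF x] fst_L2(1)[OF test_pair_H[OF g[of k]]] L by (simp add: L2.diff_left)
  ultimately have "(\<lambda>k. (hl_inner (snd x) f' - hl_inner (g' k) f')
      + (hl_inner (fst x) f'' - hl_inner (g k) f'')) \<longlonglongrightarrow> 0 + 0"
    by (intro tendsto_add) simp_all
  then show ?thesis by (simp add: *[OF g] LIMSEQ_const_iff)
qed

text \<open>If \<open>fst x\<close> vanishes almost everywhere, integration by parts makes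
  \<open>x\<close> \<open>B\<close>-orthogonal to all test pairs. These are dense in
  \<open>H\<close>, hence \<open>x\<close> is \<open>B\<close>-orthogonal to itself.\<close>

lemma wt_fun_definite:
  assumes x: "x \<in> H" and "K x x = 0"
  shows "B x x = 0"
proof -
  have x0: "x \<in> H0" using x H_subset by blast
  note [measurable] = H_measurable[OF x0]
  have "AE t in half_line. wt_fun p x t = 0"
    using assms(2) wt_fun_L2(1)[OF x, of p] p_pos p_less
    by (intro AE_eq_0_if_L2_inner_0) (auto simp: K_def)
  then have AE: "AE t in half_line. fst x t = 0"
    unfolding AE_half_line by eventually_elim (simp add: wt_fun_def)
  then have B_eq: "B x y = hl_inner (B_deriv x) (B_deriv y)" if "y \<in> H" for y
  proof -
    have "hl_inner (B_fun x) (B_fun y) = (\<integral>t. 0 \<partial>half_line)"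
      unfolding L2_inner_def
    proof (rule integral_cong_AE)
      show "AE t in half_line. B_fun x t * B_fun y t = 0"
        using AE by eventually_elim (simp add: B_fun_def)
      have "y \<in> H0" using that H_subset by blast
      then show "(\<lambda>t. B_fun x t * B_fun y t) \<in> borel_measurable half_line"
        using x0 by (intro borel_measurable_times L2_measurable) (auto simp: H0_def)
    qed simp
    then show ?thesis unfolding B_def by simp
  qed
  have test0: "B x (f, f') = 0" if f: "test_pair f f'" for f f'
  proof -
    obtain f'' where f'': "test_pair f' f''" using test_pair_deriv[OF f] .
    have "hl_inner (fst x) f'' = (\<integral>t. 0 \<partial>half_line)"
      unfolding L2_inner_def
      by (rule integral_cong_AE) (use AE test_pairD(7)[OF f''] in auto)
    then have 0: "hl_inner (snd x) f' = 0" using integration_by_parts[OF x f f''] by simp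
    have "B x (f, f') = c * hl_inner (snd x) f'"
    proof -
      have *: "sqrt c * snd x t * (sqrt c * f' t) = c * (snd x t * f' t)" for t
        using c_pos by simp
      show ?thesis
        unfolding B_eq[OF test_pair_H[OF f]] L2_inner_def B_deriv_def snd_conv *
        by (rule integral_mult_right_zero)
    qed
    with 0 show ?thesis by simp
  qed
  obtain g g' :: "nat \<Rightarrow> real \<Rightarrow> real" where g: "\<And>k. test_pair (g k) (g' k)"
    and lim: "(\<lambda>k. B0.quad (x - (g k, g' k))) \<longlonglongrightarrow> 0"
    using H_approx[OF x] by blast
  have gH: "(g k, g' k) \<in> H" for k using test_pair_H[OF g] .
  have "(\<lambda>k. B0.quad ((g k, g' k) - x)) \<longlonglongrightarrow> 0"
    using lim BH.quad_diff_commute[OF x gH] by simp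
  from BH.tendsto_inner[of "\<lambda>k. (g k, g' k)", OF gH x x this]
  have "(\<lambda>k. B (g k, g' k) x) \<longlonglongrightarrow> B x x" .
  then show ?thesis using test0[OF g] BH.sym[OF gH x] by (simp add: LIMSEQ_const_iff)
qed

text \<open>Bumps on the disjoint intervals \<open>(i+1, i+2)\<close>, the first of which already
  avoids 0.\<close>

lemma K_infinite_dim:
  "\<exists>e::nat \<Rightarrow> fun_pair. \<forall>i. e i \<in> H \<and> 0 < K (e i) (e i) \<and>
        (\<forall>j. i \<noteq> j \<longrightarrow> K (e i) (e j) = 0)"
proof -
  have "\<exists>f f'. test_pair f f' \<and> (\<forall>t. t \<notin> {real (Suc i)<..<real (Suc i) + 1} \<longrightarrow> f t = 0) \<and>
      (\<forall>t. t \<in> {real (Suc i)<..<real (Suc i) + 1} \<longrightarrow> 0 < f t)" for i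
    using test_pair_bump[of "real (Suc i)" "real (Suc i) + 1"] by (metis less_add_one of_nat_0_less_iff zero_less_Suc)
  then obtain f f' where f: "\<And>i. test_pair (f i) (f' i)"
    "\<And>i t. t \<notin> {real (Suc i)<..<real (Suc i) + 1} \<Longrightarrow> f i t = 0"
    "\<And>i t. t \<in> {real (Suc i)<..<real (Suc i) + 1} \<Longrightarrow> 0 < f i t" by metis
  let ?e = "\<lambda>i. (f i, f' i)"
  interpret K: semi_inner H K by (rule semi_inner_K)
  have eH: "?e i \<in> H" for i using test_pair_H[OF f(1)] .
  have "K (?e i) (?e i) \<noteq> 0" for i
  proof
    assume "K (?e i) (?e i) = 0"
    then have "AE t in half_line. wt_fun p (?e i) t = 0"
      using wt_fun_L2(1)[OF eH, of p] p_pos p_less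
      by (intro AE_eq_0_if_L2_inner_0) (auto simp: K_def)
    then have "AE t in lborel. t \<notin> {real (Suc i)<..<real (Suc i) + 1}"
      unfolding AE_half_line
    proof eventually_elim
      case (elim t)
      then show ?case using f(3)[of t i] by (auto simp: wt_fun_def)
    qed
    then have "emeasure lborel {real (Suc i)<..<real (Suc i) + 1} = 0"
      by (subst (asm) AE_iff_measurable[of "{real (Suc i)<..<real (Suc i) + 1}"]) auto
    then show False by simp
  qed
  then have "0 < K (?e i) (?e i)" for i using K.nonneg[OF eH, of i] by (simp add: order.not_eq_order_implies_strict)
  moreover have "K (?e i) (?e j) = 0" if "i \<noteq> j" for i j
  proof -
    have "wt_fun p (?e i) t * wt_fun p (?e j) t = 0" for t
    proof (cases "t \<in> {real (Suc i)<..<real (Suc i) + 1}")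
      case True
      have "t \<notin> {real (Suc j)<..<real (Suc j) + 1}"
      proof
        assume "t \<in> {real (Suc j)<..<real (Suc j) + 1}"
        then have "real i < real j + 1" "real j < real i + 1" using True by auto
        then show False using that by linarith
      qed
      then show ?thesis using f(2) by (simp add: wt_fun_def)
    next
      case False
      then show ?thesis using f(2) by (simp add: wt_fun_def)
    qed
    then show ?thesis unfolding K_def L2_inner_def by (simp only: Bochner_Integration.integral_zero)
  qed
  ultimately show ?thesis using eH by (intro exI[of _ ?e] allI conjI impI)
qed

lemma K_compact:
  assumes X: "\<And>k. X k \<in> H" and B1: "\<And>k. B0.quad (X k) \<le> 1"
  shows "\<exists>r::nat\<Rightarrow>nat. strict_mono r \<and>
    (\<forall>e>0. \<exists>N. \<forall>m\<ge>N. \<forall>k\<ge>N. K (X (r m) - X (r k)) (X (r m) - X (r k)) < e)"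
proof -
  have X0: "X k \<in> H0" for k using X H_subset by blast
  have hoelder: "(rep (X k) t - rep (X k) s)\<^sup>2 \<le> \<bar>t - s\<bar> / c" if "0 \<le> s" "0 \<le> t" for k s t
  proof -
    have "\<bar>t - s\<bar> * (B0.quad (X k) / c) \<le> \<bar>t - s\<bar> * (1 / c)"
      using B1 c_pos by (intro mult_left_mono divide_right_mono) auto
    then show ?thesis using rep_Hoelder[OF X0 that, of k] by simp
  qed
  have bound: "(rep (X k) t)\<^sup>2 \<le> t / c" if "0 \<le> t" for k t
    using hoelder[OF order_refl that, of k] that by simp
  \<comment> \<open>The diagonal argument wants one bound for all points, while \<open>rep\<close>
    may grow like \<open>sqrt t\<close>; dividing by \<open>1 + t\<close> supplies it.\<close>
  have "norm (rep (X k) t / (1 + t)) \<le> sqrt (1 / c)" if "t \<in> \<rat> \<inter> {0<..}" for k t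
  proof -
    have t: "0 < t" using that by simp
    have "\<bar>rep (X k) t\<bar> \<le> sqrt (t / c)"
      using bound[of t k] t by (intro real_le_rsqrt) simp
    also have "sqrt (t / c) = sqrt t * sqrt (1 / c)" by (simp flip: real_sqrt_mult)
    also have "\<dots> \<le> (1 + t) * sqrt (1 / c)"
    proof (rule mult_right_mono)
      have "sqrt t \<le> sqrt ((1 + t)\<^sup>2)" using t by (intro real_sqrt_le_mono) (simp add: power2_eq_square algebra_simps)
      then show "sqrt t \<le> 1 + t" using t by simp
    qed (use c_pos in simp)
    finally show ?thesis using t by (simp add: field_simps)
  qed
  moreover have "countable (\<rat> \<inter> {0::real<..})" using countable_rat by blast
  ultimately obtain r :: "nat \<Rightarrow> nat" where r: "strict_mono r"
    and conv: "\<And>t. t \<in> \<rat> \<inter> {0<..} \<Longrightarrow> \<exists>l. (\<lambda>k. rep (X (r k)) t / (1 + t)) \<longlonglongrightarrow> l"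
    using function_convergent_subsequence[of "\<rat> \<inter> {0::real<..}" "\<lambda>k t. rep (X k) t / (1 + t)"] by blast
  have conv_rat: "Cauchy (\<lambda>k. rep (X (r k)) t)" if t: "t \<in> \<rat>" "0 < t" for t
  proof -
    obtain l where "(\<lambda>k. rep (X (r k)) t / (1 + t)) \<longlonglongrightarrow> l" using conv[of t] t by auto
    from tendsto_mult[OF this tendsto_const[of "1 + t"]] have "convergent (\<lambda>k. rep (X (r k)) t)"
      using t by (auto simp: convergent_def)
    then show ?thesis by (simp add: Cauchy_convergent_iff)
  qed
  have "convergent (\<lambda>k. rep (X (r k)) t)" if t: "0 < t" for t
  proof -
    have "Cauchy (\<lambda>k. rep (X (r k)) t)"
    proof (rule metric_CauchyI)
      fix e :: real assume e: "0 < e"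
      \<comment> \<open>Within this distance, Hoelder continuity changes every
        \<open>rep (X k)\<close> by less than \<open>e / 3\<close>, so convergence at a rational
        point nearby decides the Cauchy property at \<open>t\<close>.\<close>
      have "t < t + c * (e / 3)\<^sup>2" using e c_pos by simp
      then obtain s where s: "s \<in> \<rat>" "t < s" "s < t + c * (e / 3)\<^sup>2" using Rats_dense_in_real by blast
      have close: "\<bar>rep (X k) t - rep (X k) s\<bar> < e / 3" for k
      proof -
        have "(rep (X k) t - rep (X k) s)\<^sup>2 \<le> \<bar>t - s\<bar> / c" using s t by (intro hoelder) auto
        also have "\<dots> < (e / 3)\<^sup>2" using s c_pos by (simp add: field_simps)
        finally show ?thesis using e by (intro power2_less_imp_less[of _ "e / 3"]) auto
      qed
      obtain N where N: "\<And>m k. m \<ge> N \<Longrightarrow> k \<ge> N \<Longrightarrow> \<bar>rep (X (r m)) s - rep (X (r k)) s\<bar> < e / 3"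
      proof -
        have "Cauchy (\<lambda>k. rep (X (r k)) s)" using s t by (intro conv_rat) auto
        moreover have "0 < e / 3" using e by simp
        ultimately show ?thesis unfolding Cauchy_def dist_real_def using that by blast
      qed
      have "dist (rep (X (r m)) t) (rep (X (r k)) t) < e" if "m \<ge> N" "k \<ge> N" for m k
        using N[OF that] close[of "r m"] close[of "r k"] unfolding dist_real_def by linarith
      then show "\<exists>N. \<forall>m\<ge>N. \<forall>k\<ge>N. dist (rep (X (r m)) t) (rep (X (r k)) t) < e" by blast
    qed
    then show ?thesis by (simp add: Cauchy_convergent_iff)
  qed
  then obtain Y where Y: "\<And>t. 0 < t \<Longrightarrow> (\<lambda>k. rep (X (r k)) t) \<longlonglongrightarrow> Y t"
    unfolding convergent_def by metis
  have p02: "0 \<le> p" "p \<le> 2" using p_pos p_less by auto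
  have "\<exists>N. \<forall>m\<ge>N. \<forall>k\<ge>N. K (X (r m) - X (r k)) (X (r m) - X (r k)) < e" if e: "0 < e" for e
  proof -
    \<comment> \<open>Beyond \<open>T\<close> the weight \<open>t powr p\<close> is at most
      \<open>T powr (p - 2) / \<kappa>\<close> times the weight of \<open>B\<close>, and a
      difference of two vectors of the unit ball has \<open>B\<close> at most 4. The bound
      \<open>e * \<kappa> / 8\<close> therefore makes the tail smaller than
      \<open>e / 2\<close>.\<close>
    have "((\<lambda>T. T powr (p - 2)) \<longlongrightarrow> 0) at_top"
      using p_less by (intro tendsto_neg_powr filterlim_ident) auto
    then have "\<forall>\<^sub>F T in at_top. T powr (p - 2) < e * \<kappa> / 8"
      using e \<kappa>_pos by (intro order_tendstoD(2)) auto
    then obtain T where T: "0 < T" "T powr (p - 2) < e * \<kappa> / 8"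
      using eventually_conj[OF eventually_gt_at_top[of "0::real"]]
      by (metis (mono_tags, lifting) eventually_happens' trivial_limit_at_top_linorder)
    define h where "h k t = wt_fun p (X (r k)) t * indicator {0<..<T} t" for k t
    have hm: "h k \<in> borel_measurable half_line" for k
      using L2_measurable[OF wt_fun_L2(1)[OF X p02]] unfolding h_def by simp
    have h_lim: "AE t in half_line. (\<lambda>k. h k t) \<longlonglongrightarrow> (if 0 < t then t powr (p / 2) * Y t * indicator {0<..<T} t else 0)"
    proof -
      have "AE t in half_line. \<forall>k. fst (X (r k)) t = rep (X (r k)) t"
        unfolding AE_all_countable using rep_AE[OF X] by simp
      then show ?thesis unfolding AE_half_line
      proof eventually_elim
        case (elim t)
        show ?case
        proof
          assume t: "0 < t"
          have "h k t = t powr (p / 2) * rep (X (r k)) t * indicator {0<..<T} t" for k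
            using elim t by (simp add: h_def wt_fun_def)
          then show "(\<lambda>k. h k t) \<longlonglongrightarrow> (if 0 < t then t powr (p / 2) * Y t * indicator {0<..<T} t else 0)"
            using t Y[OF t] by (auto intro!: tendsto_intros)
        qed
      qed
    qed
    let ?C = "T powr (p / 2) * sqrt (T / c)"
    have h_bound: "AE t in half_line. \<bar>h k t\<bar> \<le> ?C * indicator {0<..<T} t" for k
      using rep_AE[OF X[of "r k"]] unfolding AE_half_line
    proof eventually_elim
      case (elim t)
      show ?case
      proof
        assume t: "0 < t"
        show "\<bar>h k t\<bar> \<le> ?C * indicator {0<..<T} t"
        proof (cases "t < T")
          case True
          have "\<bar>rep (X (r k)) t\<bar> \<le> sqrt (t / c)"
            using bound[of t "r k"] t by (intro real_le_rsqrt) simp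
          also have "\<dots> \<le> sqrt (T / c)" using True c_pos by (intro real_sqrt_le_mono divide_right_mono) auto
          finally have "t powr (p / 2) * \<bar>rep (X (r k)) t\<bar> \<le> ?C"
            using True t p_pos by (intro mult_mono powr_mono2) auto
          then show ?thesis using elim t True by (simp add: h_def wt_fun_def abs_mult)
        qed (simp add: h_def)
      qed
    qed
    have gL: "(\<lambda>t. ?C * indicator {0<..<T} t) \<in> L2 half_line" by (intro L2_scale indicator_Ioo_L2)
    \<comment> \<open>Taking \<open>lim\<close> of the measurable \<open>h k\<close> gives a
      measurable function outright, with no measurability argument for \<open>Y\<close>.\<close>
    define v where "v t = lim (\<lambda>k. h k t)" for t
    have vm: "v \<in> borel_measurable half_line" unfolding v_def using hm by (rule borel_measurable_lim_metric)
    have v_lim: "AE t in half_line. (\<lambda>k. h k t) \<longlonglongrightarrow> v t"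
      using h_lim by eventually_elim (simp add: v_def convergent_LIMSEQ_iff[symmetric] convergentI)
    have hL: "h k \<in> L2 half_line" for k
      by (rule L2_bound[OF gL hm]) (use h_bound[of k] in \<open>auto elim: eventually_mono intro: order_trans[OF _ abs_ge_self]\<close>)
    note v = L2_dominated_convergence[OF hm gL h_bound v_lim vm]
    obtain N where N: "\<And>k. k \<ge> N \<Longrightarrow> hl_sq (v - h k) < e / 8"
      using order_tendstoD(2)[OF v(2), of "e / 8"] e unfolding eventually_sequentially by auto
    have "K (X (r m) - X (r k)) (X (r m) - X (r k)) < e" if mk: "m \<ge> N" "k \<ge> N" for m k
    proof -
      let ?z = "X (r m) - X (r k)"
      have zH: "?z \<in> H" by (intro BH.closed X)
      then have z0: "?z \<in> H0" using H_subset by blast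
      have Bz: "B ?z ?z \<le> 4"
        using B0.quad_add_le[OF X0[of "r m"] B0.closed(5)[OF X0[of "r k"]]]
          B1[of "r m"] B1[of "r k"] B0.quad_scale[OF X0[of "r k"], of "-1"] by simp
      have zE: "B_fun ?z \<in> L2 half_line" and zD: "B_deriv ?z \<in> L2 half_line" using z0 by (auto simp: H0_def)
      have hd: "h m - h k \<in> L2 half_line" using hL by (intro L2.closed)
      have "hl_sq ((v - h k) + (h m - v))
        \<le> 2 * hl_sq (v - h k) + 2 * hl_sq (h m - v)"
        by (intro L2.quad_add_le L2.closed hL v(1))
      also have "\<dots> < e / 2"
        using N[OF mk(1)] N[OF mk(2)] L2.quad_diff_commute[OF v(1) hL[of m]] by simp
      finally have near: "hl_sq (h m - h k) < e / 2" by simp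
      have pw: "AE t in half_line. (wt_fun p ?z t)\<^sup>2
        \<le> ((h m - h k) t)\<^sup>2 + (T powr (p - 2) / \<kappa>) * (B_fun ?z t)\<^sup>2"
        unfolding AE_half_line
      proof (intro AE_I2 impI)
        fix t :: real assume t: "0 < t"
        show "(wt_fun p ?z t)\<^sup>2 \<le> ((h m - h k) t)\<^sup>2 + (T powr (p - 2) / \<kappa>) * (B_fun ?z t)\<^sup>2"
        proof (cases "t < T")
          case True
          then have "(h m - h k) t = wt_fun p ?z t" using t by (simp add: h_def parts_diff)
          then show ?thesis using \<kappa>_pos by simp
        next
          case False
          have "(wt_fun p ?z t)\<^sup>2 = t powr p * (fst ?z t)\<^sup>2"
            using t by (simp add: wt_fun_def power_mult_distrib powr_power)
          also have "t powr p = t powr (p - 2) * t\<^sup>2"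
            using t by (simp add: powr_diff)
          also have "t powr (p - 2) * t\<^sup>2 * (fst ?z t)\<^sup>2 \<le> T powr (p - 2) * t\<^sup>2 * (fst ?z t)\<^sup>2"
            using False T p_less by (intro mult_right_mono powr_mono2') auto
          also have "\<dots> = (T powr (p - 2) / \<kappa>) * (B_fun ?z t)\<^sup>2"
            using \<kappa>_pos by (simp add: B_fun_def power_mult_distrib)
          finally show ?thesis by (simp add: add_increasing)
        qed
      qed
      have "K ?z ?z \<le> (\<integral>t. ((h m - h k) t)\<^sup>2 + (T powr (p - 2) / \<kappa>) * (B_fun ?z t)\<^sup>2 \<partial>half_line)"
        unfolding K_def L2_inner_same
        by (rule integral_mono_AE[OF _ _ pw])
          (intro L2_square_integrable wt_fun_L2 zH p02 Bochner_Integration.integrable_add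
            integrable_mult_right hd zE)+
      also have "\<dots> = hl_sq (h m - h k)
          + (T powr (p - 2) / \<kappa>) * hl_sq (B_fun ?z)"
        unfolding L2_inner_same
        using L2_square_integrable[OF hd] L2_square_integrable[OF zE]
        by (subst Bochner_Integration.integral_add) auto
      also have "\<dots> \<le> hl_sq (h m - h k) + (T powr (p - 2) / \<kappa>) * 4"
        using Bz L2.nonneg[OF zD] \<kappa>_pos unfolding B_def
        by (intro add_left_mono mult_left_mono) auto
      also have "\<dots> < e / 2 + e / 2"
        using near T \<kappa>_pos by (intro add_strict_mono) (auto simp: field_simps)
      finally show ?thesis by simp
    qed
    then show ?thesis by blast
  qed
  with r show ?thesis by blast
qed

sublocale KB: compact_form_pair H B K
proof (intro compact_form_pair.intro compact_form_pair_axioms.intro)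
  show "semi_inner H B" by (rule BH.semi_inner_axioms)
  show "semi_inner H K" by (rule semi_inner_K)
  show "\<exists>C. \<forall>x\<in>H. K x x \<le> C * B x x"
    unfolding K_def using wt_fun_L2(2)[of _ p] p_pos p_less by (intro exI[of _ "1 / \<kappa> + 1 / c"]) auto
qed (fact wt_fun_definite B_complete K_compact K_infinite_dim)+

end

section \<open>Simplicity of the eigenvalues\<close>

text \<open>One-sided derivatives at 0 are kept for the fundamental theorem on
  \<open>[0, T]\<close>. For negative \<open>t\<close> the interval is empty and \<open>G\<close>
  vanishes, the normalization that \<open>half_line_measurable\<close> expects.\<close>

lemma primitive_half_line:
  fixes g :: "real \<Rightarrow> real"
  assumes g: "continuous_on {0..} g"
  defines "G \<equiv> \<lambda>t. integral {0..t} g"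
  shows "\<And>t T. 0 \<le> t \<Longrightarrow> t \<le> T \<Longrightarrow> (G has_real_derivative g t) (at t within {0..T})"
    and "\<And>t. 0 < t \<Longrightarrow> (G has_real_derivative g t) (at t)"
    and "continuous_on {0..} G" "G 0 = 0" "\<And>t. t < 0 \<Longrightarrow> G t = 0"
proof -
  show within: "(G has_real_derivative g t) (at t within {0..T})" if "0 \<le> t" "t \<le> T" for t T
    unfolding G_def using that
    by (intro integral_has_real_derivative continuous_on_subset[OF g]) auto
  show "(G has_real_derivative g t) (at t)" if "0 < t" for t
  proof -
    have "at t within {0..t+1} = at t" using that by (intro at_within_interior) auto
    then show ?thesis using within[of t "t+1"] that by simp
  qed
  show "continuous_on {0..} G"
    unfolding continuous_on_eq_continuous_within
  proof
    fix t :: real assume t: "t \<in> {0..}"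
    have "continuous (at t within {0..t+1}) G"
      using within[of t "t+1"] t by (intro DERIV_continuous) auto
    moreover have "at t within {0..t+1} = at t within {0..}"
      using t by (intro at_within_nhd[of _ "{..<t+1}"]) auto
    ultimately show "continuous (at t within {0..}) G" by (simp add: continuous_within)
  qed
qed (simp_all add: G_def)

lemma half_line_measurable:
  fixes g :: "real \<Rightarrow> real"
  assumes "continuous_on {0..} g" "\<And>t. t < 0 \<Longrightarrow> g t = 0"
  shows "g \<in> borel_measurable borel"
proof -
  have "(\<lambda>t. indicator {0..} t *\<^sub>R g t) \<in> borel_measurable borel"
    by (rule borel_measurable_continuous_on_indicator) (use assms(1) in auto)
  moreover have "(\<lambda>t. indicator {0..} t *\<^sub>R g t) = g"
    using assms(2) by (auto simp: fun_eq_iff indicator_def)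
  ultimately show ?thesis by simp
qed

lemma continuous_cutoff_L2:
  fixes g :: "real \<Rightarrow> real"
  assumes g: "continuous_on {0..} g" "\<And>t. t < 0 \<Longrightarrow> g t = 0"
  shows "(\<lambda>t. g t * indicator {0<..<T} t) \<in> L2 half_line"
proof -
  note [measurable] = half_line_measurable[OF g]
  have "compact (g ` {0..T})"
    by (intro compact_continuous_image continuous_on_subset[OF g(1)]) auto
  then obtain C where C: "\<And>t. t \<in> {0..T} \<Longrightarrow> \<bar>g t\<bar> \<le> C"
    using compact_imp_bounded bounded_iff by (metis imageI real_norm_def)
  show ?thesis
    by (rule bounded_support_L2[of _ C 0 T]) (use C in \<open>auto simp: indicator_def\<close>)
qed

lemma integral_half_line_FTC:
  fixes F f :: "real \<Rightarrow> real"
  assumes T: "0 \<le> T" and F: "\<And>t. 0 \<le> t \<Longrightarrow> t \<le> T \<Longrightarrow> (F has_real_derivative f t) (at t within {0..T})"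
    and f: "continuous_on {0..T} f" and fm: "f \<in> borel_measurable borel"
  shows "(\<integral>t. f t * indicator {0<..<T} t \<partial>half_line) = F T - F 0"
proof -
  note [measurable] = fm
  have "(\<integral>t. f t * indicator {0<..<T} t \<partial>half_line) = (LINT t:{0<..}|lborel. f t * indicator {0<..<T} t)"
    by (rule integral_half_line) simp
  also have "\<dots> = (\<integral>t. indicator {0..T} t *\<^sub>R f t \<partial>lborel)"
    unfolding set_lebesgue_integral_def
  proof (rule integral_cong_AE)
    show "AE t in lborel. indicator {0<..} t *\<^sub>R (f t * indicator {0<..<T} t) = indicator {0..T} t *\<^sub>R f t"
      using AE_lborel_singleton[of T] AE_lborel_singleton[of 0]
      by eventually_elim (auto simp: indicator_def)
  qed auto
  also have "\<dots> = F T - F 0"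
    by (rule integral_FTC_atLeastAtMost[OF T _ f])
      (use F in \<open>simp add: has_real_derivative_iff_has_vector_derivative\<close>)
  finally show ?thesis .
qed

text \<open>Integrating \<open>X (t + u) = X t + X u\<close> over \<open>u \<in> [0, 1]\<close> shows that a continuous
  additive function is differentiable.\<close>

lemma additive_has_derivative:
  fixes X :: "real \<Rightarrow> real"
  assumes X: "continuous_on {0..} X" and add: "\<And>b s. 0 < b \<Longrightarrow> 0 \<le> s \<Longrightarrow> X (b + s) = X b + X s"
    and t: "0 < t"
  shows "(X has_real_derivative X 1) (at t)"
proof -
  define I where "I t = integral {0..t} X" for t
  note I = primitive_half_line[OF X, folded I_def]
  have int: "X integrable_on {a..b}" if "0 \<le> a" for a b
    by (rule integrable_continuous_interval) (use that in \<open>auto intro: continuous_on_subset[OF X]\<close>)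
  have eq: "X t = I (t + 1) - I t - I 1" if t: "0 < t" for t
  proof -
    have "integral {0..1} (X \<circ> (\<lambda>u. u + t)) = integral {0 + t..1 + t} X"
      by (rule integral_shift) (use t in \<open>auto intro: continuous_on_subset[OF X]\<close>)
    moreover have "integral {0..1} (X \<circ> (\<lambda>u. u + t)) = integral {0..1} (\<lambda>u. X u + X t)"
    proof (rule integral_cong)
      fix u :: real assume "u \<in> {0..1}"
      then have "X (t + u) = X t + X u" using add t by simp
      then show "(X \<circ> (\<lambda>u. u + t)) u = X u + X t" by (simp add: add.commute)
    qed
    moreover have "integral {0..1} (\<lambda>u. X u + X t) = I 1 + X t"
      unfolding I_def by (subst integral_add) (auto intro: int)
    moreover have "I t + integral {t..t + 1} X = I (t + 1)"
      unfolding I_def using t by (intro Henstock_Kurzweil_Integration.integral_combine int) auto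
    ultimately show ?thesis by (simp add: add.commute)
  qed
  have "((\<lambda>t. I (t + 1) - I t - I 1) has_real_derivative X (t + 1) - X t - 0) (at t)"
  proof (intro DERIV_diff DERIV_const I(2) t)
    have "(I has_real_derivative X (t + 1)) (at (t + 1))" using t by (intro I(2)) simp
    then show "((\<lambda>t. I (t + 1)) has_real_derivative X (t + 1)) (at t)"
      by (simp add: DERIV_shift)
  qed
  then have "((\<lambda>t. I (t + 1) - I t - I 1) has_real_derivative X 1) (at t)"
    using add[OF t, of 1] by simp
  then show ?thesis
    by (rule has_field_derivative_transform_within_open[of _ _ _ "{0<..}"]) (use t eq in auto)
qed

text \<open>An energy estimate of Gronwall type: since \<open>2 * |y z| \<le> z^2 + y^2\<close>, the
  derivative of the energy is at most \<open>|q - 1|\<close> times the energy, and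
  \<open>D = 1 + C\<close> bounds this factor on \<open>[0, T]\<close>. Derivatives are needed only
  for \<open>t > 0\<close>; continuity handles the initial time.\<close>

lemma linear_ode_unique:
  fixes z y q :: "real \<Rightarrow> real"
  assumes cont: "continuous_on {0..} z" "continuous_on {0..} y" and init: "z 0 = 0" "y 0 = 0"
    and dz: "\<And>t. 0 < t \<Longrightarrow> (z has_real_derivative - y t) (at t)"
    and dy: "\<And>t. 0 < t \<Longrightarrow> (y has_real_derivative q t * z t) (at t)"
    and q: "continuous_on {0..} q" and T: "0 \<le> T"
  shows "z T = 0"
proof (cases "T = 0")
  case False
  then have T': "0 < T" using T by simp
  have "compact (q ` {0..T})"
    by (intro compact_continuous_image continuous_on_subset[OF q]) auto
  then obtain C where C: "\<And>t. t \<in> {0..T} \<Longrightarrow> \<bar>q t\<bar> \<le> C"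
    using compact_imp_bounded bounded_iff by (metis imageI real_norm_def)
  define D where "D = 1 + C"
  define F where "F t = ((z t)\<^sup>2 + (y t)\<^sup>2) * exp (- D * t)" for t
  have "F T \<le> F 0"
  proof (rule DERIV_nonpos_imp_decreasing_open[OF T])
    fix t assume t: "0 < t" "t < T"
    have "(F has_real_derivative
        (2 * z t * (- y t) + 2 * y t * (q t * z t)) * exp (- D * t)
        + ((z t)\<^sup>2 + (y t)\<^sup>2) * (exp (- D * t) * (- D))) (at t)"
      unfolding F_def using dz[OF t(1)] dy[OF t(1)]
      by (auto intro!: derivative_eq_intros simp: power2_eq_square algebra_simps)
    moreover have "(2 * z t * (- y t) + 2 * y t * (q t * z t)) * exp (- D * t)
        + ((z t)\<^sup>2 + (y t)\<^sup>2) * (exp (- D * t) * (- D)) \<le> 0"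
    proof -
      have "2 * z t * (- y t) + 2 * y t * (q t * z t) = (q t - 1) * (2 * (y t * z t))"
        by (simp add: algebra_simps)
      also have "\<dots> \<le> \<bar>q t - 1\<bar> * (2 * \<bar>y t * z t\<bar>)"
        by (metis abs_ge_self abs_mult abs_numeral)
      also have "\<dots> \<le> D * ((z t)\<^sup>2 + (y t)\<^sup>2)"
      proof (rule mult_mono)
        show "\<bar>q t - 1\<bar> \<le> D" using C[of t] t unfolding D_def by auto
        have "0 \<le> (\<bar>y t\<bar> - \<bar>z t\<bar>)\<^sup>2" by simp
        then show "2 * \<bar>y t * z t\<bar> \<le> (z t)\<^sup>2 + (y t)\<^sup>2"
          by (simp add: power2_diff abs_mult)
        show "0 \<le> D" using C[of 0] T unfolding D_def by auto
      qed simp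
      finally have "(2 * z t * (- y t) + 2 * y t * (q t * z t)) * exp (- D * t)
        \<le> D * ((z t)\<^sup>2 + (y t)\<^sup>2) * exp (- D * t)" by (intro mult_right_mono) auto
      then show ?thesis by (simp add: algebra_simps)
    qed
    ultimately show "\<exists>d. (F has_real_derivative d) (at t) \<and> d \<le> 0" by blast
  next
    show "continuous_on {0..T} F"
      unfolding F_def by (intro continuous_intros continuous_on_subset[OF cont(1)]
          continuous_on_subset[OF cont(2)]) auto
  qed
  also have "F 0 = 0" unfolding F_def using init by simp
  finally have "(z T)\<^sup>2 + (y T)\<^sup>2 \<le> 0" unfolding F_def by (simp add: mult_le_0_iff)
  then show ?thesis by (simp add: sum_power2_le_zero_iff)
qed (simp add: init)

text \<open>This supplies the zero mean that \<open>test_pair_primitive\<close> requires of a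
  difference of translates.\<close>

lemma integral_shift_UNIV:
  fixes f :: "real \<Rightarrow> real"
  assumes "test_pair f f'" "0 \<le> s"
  shows "integral UNIV (\<lambda>t. f t - f (t - s)) = 0"
proof -
  note F = test_pairD[OF assms(1)]
  obtain a b where ab: "a < b" "\<And>t. t \<notin> {a..b} \<Longrightarrow> f t = 0" using F(8) by blast
  have c: "continuous_on A f" for A by (rule continuous_on_subset[OF F(4)]) simp
  have cs: "continuous_on A (\<lambda>t. f (t - s))" for A
    by (rule continuous_on_compose2[OF F(4)]) (auto intro!: continuous_intros)
  have 1: "(f has_integral integral {a..b} f) UNIV"
    by (rule has_integral_on_superset[of _ _ "{a..b}"])
      (use ab in \<open>auto intro!: integrable_integral integrable_continuous_interval c\<close>)
  have "((\<lambda>t. f (t - s)) has_integral integral {a + s..b + s} (\<lambda>t. f (t - s))) UNIV"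
    by (rule has_integral_on_superset[of _ _ "{a + s..b + s}"])
      (use ab in \<open>auto intro!: integrable_integral integrable_continuous_interval cs\<close>)
  moreover have "integral {a + s..b + s} (\<lambda>t. f (t - s)) = integral {a..b} f"
    using integral_shift[of a s b "\<lambda>t. f (t - s)", OF cs] by (simp add: o_def)
  ultimately have "((\<lambda>t. f t - f (t - s)) has_integral integral {a..b} f - integral {a..b} f) UNIV"
    using 1 by (intro has_integral_diff) auto
  then show ?thesis by (simp add: integral_unique)
qed

section \<open>From the weak eigenvalue equation to the differential equation\<close>

context weighted_oscillator
begin

lemma rep_neg: "t < 0 \<Longrightarrow> rep x t = 0"
  unfolding rep_def L2_inner_def by simp

lemma rep_continuous:
  assumes x: "x \<in> H0"
  shows "continuous_on {0..} (rep x)"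
  unfolding continuous_on_iff dist_real_def
proof (intro ballI allI impI)
  fix t e :: real assume t: "t \<in> {0..}" and e: "0 < e"
  define M where "M = B x x / c + 1"
  have M: "0 < M" "B x x / c \<le> M"
    unfolding M_def using B0.nonneg[OF x] c_pos by (auto simp: add_nonneg_pos)
  have "\<bar>rep x s - rep x t\<bar> < e" if s: "s \<in> {0..}" "\<bar>s - t\<bar> < e\<^sup>2 / M" for s
  proof -
    have "(rep x s - rep x t)\<^sup>2 \<le> \<bar>s - t\<bar> * (B x x / c)" using rep_Hoelder[OF x] s t by simp
    also have "\<dots> \<le> \<bar>s - t\<bar> * M" using M by (intro mult_left_mono) auto
    also have "\<dots> < e\<^sup>2" using s M by (simp add: field_simps)
    finally show ?thesis using e by (intro power2_less_imp_less[of _ e]) auto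
  qed
  then show "\<exists>d>0. \<forall>s\<in>{0..}. \<bar>s - t\<bar> < d \<longrightarrow> \<bar>rep x s - rep x t\<bar> < e"
    using e M by (intro exI[of _ "e\<^sup>2 / M"]) auto
qed

text \<open>With this coefficient the eigenvalue equation reads
  \<open>w'' = - potential l * w\<close>.\<close>

definition potential :: "real \<Rightarrow> real \<Rightarrow> real" where
  "potential l t = (l * t powr p - \<kappa> * t\<^sup>2) / c"

lemma potential_continuous: "continuous_on {0..} (potential l)"
  unfolding potential_def using p_pos c_pos
  by (intro continuous_intros continuous_on_powr') auto

text \<open>Only test pairs are inserted, and \<open>fst x\<close> is replaced by its continuous
  representative, so that the right-hand side has a classical primitive.\<close>

lemma eigenfunction_weak:
  assumes x: "x \<in> H" and eig: "\<forall>y\<in>H. B x y = l * K x y" and f: "test_pair f f'"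
  shows "hl_inner (snd x) f' = (\<integral>t. potential l t * rep x t * f t \<partial>half_line)"
proof -
  have x0: "x \<in> H0" using x H_subset by blast
  note fH = test_pair_H[OF f] note f0 = test_pair_H0[OF f]
  have E: "B_fun x \<in> L2 half_line" "B_fun (f, f') \<in> L2 half_line"
    using x0 f0 by (auto simp: H0_def)
  have W: "wt_fun p x \<in> L2 half_line" "wt_fun p (f, f') \<in> L2 half_line"
    using wt_fun_L2(1)[OF x] wt_fun_L2(1)[OF fH] p_pos p_less by auto
  have *: "sqrt c * snd x t * (sqrt c * f' t) = c * (snd x t * f' t)" for t
    using c_pos by simp
  have "hl_inner (B_deriv x) (B_deriv (f, f')) = c * hl_inner (snd x) f'"
    unfolding L2_inner_def B_deriv_def snd_conv * by (rule integral_mult_right_zero)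
  then have "c * hl_inner (snd x) f'
      = l * K x (f, f') - hl_inner (B_fun x) (B_fun (f, f'))"
    using bspec[OF eig fH] unfolding B_def by simp
  also have "\<dots> = (\<integral>t. l * (wt_fun p x t * wt_fun p (f, f') t) - B_fun x t * B_fun (f, f') t \<partial>half_line)"
    unfolding K_def L2_inner_def
    using L2_mult_integrable[OF E] L2_mult_integrable[OF W] by simp
  also have "\<dots> = (\<integral>t. c * (potential l t * rep x t * f t) \<partial>half_line)"
  proof (rule integral_cong_AE)
    show "AE t in half_line. l * (wt_fun p x t * wt_fun p (f, f') t) - B_fun x t * B_fun (f, f') t
        = c * (potential l t * rep x t * f t)"
      using rep_AE[OF x] unfolding AE_half_line
    proof eventually_elim
      case (elim t)
      show ?case
      proof
        assume t: "0 < t"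
        then have fx: "fst x t = rep x t" using elim by simp
        have "wt_fun p x t * wt_fun p (f, f') t = t powr p * (rep x t * f t)"
          using t by (simp add: wt_fun_def fx powr_add[symmetric] mult_ac)
        moreover have "B_fun x t * B_fun (f, f') t = \<kappa> * t\<^sup>2 * (rep x t * f t)"
          using \<kappa>_pos by (simp add: B_fun_def fx power2_eq_square)
        moreover have "c * (potential l t * rep x t * f t)
          = (l * t powr p - \<kappa> * t\<^sup>2) * (rep x t * f t)"
        proof -
          have "c * (potential l t * rep x t * f t) = (c * potential l t) * (rep x t * f t)" by simp
          also have "c * potential l t = l * t powr p - \<kappa> * t\<^sup>2"
            using c_pos by (simp add: potential_def)
          finally show ?thesis .
        qed
        ultimately show "l * (wt_fun p x t * wt_fun p (f, f') t) - B_fun x t * B_fun (f, f') t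
          = c * (potential l t * rep x t * f t)"
          by (simp add: algebra_simps)
      qed
    qed
    show "(\<lambda>t. l * (wt_fun p x t * wt_fun p (f, f') t) - B_fun x t * B_fun (f, f') t)
        \<in> borel_measurable half_line"
      by (intro borel_measurable_diff borel_measurable_times borel_measurable_const L2_measurable E W)
    have "rep x \<in> borel_measurable borel"
      by (rule half_line_measurable[OF rep_continuous[OF x0] rep_neg])
    then show "(\<lambda>t. c * (potential l t * rep x t * f t)) \<in> borel_measurable half_line"
      using test_pairD(6)[OF f] unfolding potential_def by measurable
  qed
  also have "\<dots> = c * (\<integral>t. potential l t * rep x t * f t \<partial>half_line)"
    by (rule integral_mult_right_zero)
  finally show ?thesis using c_pos by simp
qed

text \<open>A du Bois-Reymond argument: \<open>snd x + G\<close> annihilates all derivatives of test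
  functions and should be constant. To avoid a statement about almost every point, its integral
  \<open>X = rep x + J\<close> is shown to be additive, hence differentiable with constant
  derivative \<xi>.\<close>

lemma eigenfunction_ode:
  assumes x: "x \<in> H" and eig: "\<forall>y\<in>H. B x y = l * K x y"
  shows "\<exists>\<xi> G. continuous_on {0..} G \<and> G 0 = 0 \<and>
    (\<forall>t>0. (rep x has_real_derivative \<xi> - G t) (at t) \<and>
      (G has_real_derivative potential l t * rep x t) (at t))"
proof -
  have x0: "x \<in> H0" using x H_subset by blast
  define g where "g t = potential l t * rep x t" for t
  have g: "continuous_on {0..} g"
    unfolding g_def by (intro continuous_intros potential_continuous rep_continuous x0)
  have g_neg: "g t = 0" if "t < 0" for t using that rep_neg by (simp add: g_def)
  define G where "G t = integral {0..t} g" for t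
  note G = primitive_half_line[OF g, folded G_def]
  note gm = half_line_measurable[OF g g_neg] note Gm = half_line_measurable[OF G(3,5)]
  note [measurable] = gm Gm
  define J where "J t = integral {0..t} G" for t
  note J = primitive_half_line[OF G(3), folded J_def]
  define X where "X t = rep x t + J t" for t
  have X_cont: "continuous_on {0..} X"
    unfolding X_def by (intro continuous_intros rep_continuous x0 J(3))
  have X0: "X 0 = 0" unfolding X_def using J(4) by simp
  \<comment> \<open>Integrating the right-hand side by parts, with boundary terms killed by
    \<open>G 0 = 0\<close> and the support of \<open>f\<close>, puts \<open>f'\<close> on both
    sides.\<close>
  have weak: "hl_inner (snd x) f' = - (\<integral>t. G t * f' t \<partial>half_line)"
    if f: "test_pair f f'" for f f'
  proof -
    note F = test_pairD[OF f]
    note [measurable] = F(6,7)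
    obtain a b where ab: "0 < a" "a < b" "\<And>t. t \<notin> {a..b} \<Longrightarrow> f t = 0 \<and> f' t = 0" using F(8) by blast
    define T where "T = b + 1"
    have T: "0 \<le> T" using ab by (simp add: T_def)
    have cut: "f t = f t * indicator {0<..<T} t" "f' t = f' t * indicator {0<..<T} t" for t
      using ab by (cases "t \<in> {a..b}"; auto simp: T_def)+
    obtain f'' where f'': "test_pair f' f''" using test_pair_deriv[OF f] .
    have gI: "integrable half_line (\<lambda>t. g t * f t)"
      using L2_mult_integrable[OF continuous_cutoff_L2[OF g g_neg, of T] test_pair_L2[OF f]]
      by (subst cut(1)) (simp add: mult_ac)
    have GI: "integrable half_line (\<lambda>t. G t * f' t)"
      using L2_mult_integrable[OF continuous_cutoff_L2[OF G(3,5), of T] test_pair_L2[OF f'']]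
      by (subst cut(2)) (simp add: mult_ac)
    have "(\<integral>t. g t * f t + G t * f' t \<partial>half_line)
        = (\<integral>t. (g t * f t + G t * f' t) * indicator {0<..<T} t \<partial>half_line)"
      using cut by (metis (no_types, opaque_lifting) distrib_right mult.assoc)
    also have "\<dots> = G T * f T - G 0 * f 0"
    proof (rule integral_half_line_FTC[OF T])
      fix t assume t: "0 \<le> t" "t \<le> T"
      show "((\<lambda>t. G t * f t) has_real_derivative g t * f t + G t * f' t) (at t within {0..T})"
        using DERIV_mult[OF G(1)[OF t] has_field_derivative_at_within[OF F(3)]]
        by (simp add: add.commute mult.commute)
    next
      show "continuous_on {0..T} (\<lambda>t. g t * f t + G t * f' t)"
        by (intro continuous_intros continuous_on_subset[OF g] continuous_on_subset[OF G(3)]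
            continuous_on_subset[OF F(4)] continuous_on_subset[OF F(5)]) auto
    qed simp
    also have "\<dots> = 0" using G(4) ab(3)[of T] by (simp add: T_def)
    finally have "(\<integral>t. g t * f t \<partial>half_line) + (\<integral>t. G t * f' t \<partial>half_line) = 0"
      using gI GI by simp
    then show ?thesis using eigenfunction_weak[OF x eig f] unfolding g_def by simp
  qed
  \<comment> \<open>Increments of \<open>X\<close> are limits of inner products of
    \<open>snd x + G\<close> with bumps on \<open>(a, b)\<close>. A bump minus its translate is the
    derivative of a test function, which is annihilated, so increments are translation
    invariant.\<close>
  have X_diff: "X b - X a = X (b + s) - X (a + s)" if abs: "0 < a" "a < b" "0 \<le> s" for a b s
  proof -
    \<comment> \<open>\<open>G\<close> need not be square integrable; cutting it off beyond the
      supports of all bumps in play changes none of the inner products.\<close>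
    define T where "T = b + s + 1"
    define P where "P = snd x + (\<lambda>t. G t * indicator {0<..<T} t)"
    have GT: "(\<lambda>t. G t * indicator {0<..<T} t) \<in> L2 half_line"
      by (rule continuous_cutoff_L2[OF G(3,5)])
    have P: "P \<in> L2 half_line" unfolding P_def by (intro L2.closed snd_L2 x0 GT)
    have P_ind: "hl_inner P (indicator {0<..<t}) = X t" if t: "0 \<le> t" "t \<le> T" for t
    proof -
      have "hl_inner (\<lambda>t. G t * indicator {0<..<T} t) (indicator {0<..<t})
          = (\<integral>s. G s * indicator {0<..<t} s \<partial>half_line)"
        unfolding L2_inner_def
        by (rule Bochner_Integration.integral_cong) (use t in \<open>auto simp: indicator_def\<close>)
      also have "\<dots> = J t - J 0"
        using t by (intro integral_half_line_FTC J(1) continuous_on_subset[OF G(3)] Gm) auto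
      finally show ?thesis
        unfolding P_def X_def rep_def using J(4)
        by (simp add: L2.add_left snd_L2 x0 GT indicator_Ioo_L2)
    qed
    have P_Ioo: "hl_inner P (indicator {u<..<v}) = X v - X u"
      if uv: "0 \<le> u" "u \<le> v" "v \<le> T" for u v
    proof -
      have "hl_inner P (indicator {u<..<v})
          = hl_inner P (indicator {0<..<v} - indicator {0<..<u})"
      proof (rule L2_inner_cong_AE)
        show "AE t in half_line. indicator {u<..<v} t = (indicator {0<..<v} - indicator {0<..<u} :: real \<Rightarrow> real) t"
          unfolding AE_half_line using AE_lborel_singleton[of u]
          by eventually_elim (use uv in \<open>auto simp: indicator_def\<close>)
      qed (auto intro!: L2_measurable P indicator_Ioo_L2 L2.closed)
      also have "\<dots> = X v - X u"
        using uv by (simp add: L2.diff_right P indicator_Ioo_L2 P_ind)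
      finally show ?thesis .
    qed
    obtain \<beta> \<beta>' :: "nat \<Rightarrow> real \<Rightarrow> real" where \<beta>: "\<And>k. test_pair (\<beta> k) (\<beta>' k)"
      "\<And>k t. 0 \<le> \<beta> k t" "\<And>k t. \<beta> k t \<le> 1" "\<And>k t. t \<notin> {a<..<b} \<Longrightarrow> \<beta> k t = 0"
      "\<And>t. t \<in> {a<..<b} \<Longrightarrow> (\<lambda>k. \<beta> k t) \<longlonglongrightarrow> 1"
      using test_pair_bump[OF abs(1,2)] by metis
    have lim: "(\<lambda>k. hl_inner P (\<lambda>t. \<beta> k (t - s))) \<longlonglongrightarrow> X (b + s) - X (a + s)"
      if s: "0 \<le> s" "b + s \<le> T" for s
    proof -
      have \<beta>s: "test_pair (\<lambda>t. \<beta> k (t - s)) (\<lambda>t. \<beta>' k (t - s))" for k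
        by (rule test_pair_shift[OF \<beta>(1) s(1)])
      have "(\<lambda>k. hl_sq (indicator {a+s<..<b+s} - (\<lambda>t. \<beta> k (t - s)))) \<longlonglongrightarrow> 0"
      proof (rule L2_dominated_convergence(2)[OF _ indicator_Ioo_L2[of "a+s" "b+s"]])
        show "(\<lambda>t. \<beta> k (t - s)) \<in> borel_measurable half_line" for k
          using test_pairD(6)[OF \<beta>s] by simp
        show "AE t in half_line. \<bar>\<beta> k (t - s)\<bar> \<le> indicator {a+s<..<b+s} t" for k
          using \<beta>(2,3)[of k] \<beta>(4)[of _ k] by (auto simp: indicator_def)
        show "AE t in half_line. (\<lambda>k. \<beta> k (t - s)) \<longlonglongrightarrow> indicator {a+s<..<b+s} t"
        proof (rule AE_I2)
          fix t show "(\<lambda>k. \<beta> k (t - s)) \<longlonglongrightarrow> indicator {a+s<..<b+s} t"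
            using \<beta>(4,5)[of "t - s"] by (cases "t - s \<in> {a<..<b}") auto
        qed
      qed auto
      then have "(\<lambda>k. hl_sq ((\<lambda>t. \<beta> k (t - s)) - indicator {a+s<..<b+s})) \<longlonglongrightarrow> 0"
        using L2.quad_diff_commute[OF indicator_Ioo_L2 test_pair_L2[OF \<beta>s]] by simp
      from L2.tendsto_inner[of "\<lambda>k t. \<beta> k (t - s)", OF test_pair_L2[OF \<beta>s] indicator_Ioo_L2 P this]
      have "(\<lambda>k. hl_inner P (\<lambda>t. \<beta> k (t - s)))
          \<longlonglongrightarrow> hl_inner P (indicator {a+s<..<b+s})"
        using L2.sym[OF P test_pair_L2[OF \<beta>s]] L2.sym[OF P indicator_Ioo_L2] by simp
      then show ?thesis using abs s by (simp add: P_Ioo)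
    qed
    have "hl_inner P (\<beta> k) = hl_inner P (\<lambda>t. \<beta> k (t - s))" for k
    proof -
      note \<beta>s = test_pair_shift[OF \<beta>(1)[of k] abs(3)]
      have diff: "test_pair (\<lambda>t. \<beta> k t - \<beta> k (t - s)) (\<lambda>t. \<beta>' k t - \<beta>' k (t - s))"
        using test_pair_add[OF \<beta>(1)[of k] test_pair_scale[OF \<beta>s, of "-1"]] by simp
      obtain \<phi> where \<phi>: "test_pair \<phi> (\<lambda>t. \<beta> k t - \<beta> k (t - s))"
        using test_pair_primitive[OF diff integral_shift_UNIV[OF \<beta>(1) abs(3)]] .
      have dL: "(\<lambda>t. \<beta> k t - \<beta> k (t - s)) \<in> L2 half_line" by (rule test_pair_L2[OF diff])
      have "hl_inner (\<lambda>t. G t * indicator {0<..<T} t) (\<lambda>t. \<beta> k t - \<beta> k (t - s))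
          = (\<integral>t. G t * (\<beta> k t - \<beta> k (t - s)) \<partial>half_line)"
        unfolding L2_inner_def
      proof (rule Bochner_Integration.integral_cong[OF refl])
        fix t
        have "\<beta> k t - \<beta> k (t - s) = 0" if "t \<notin> {0<..<T}"
          using \<beta>(4)[of t k] \<beta>(4)[of "t - s" k] that abs by (auto simp: T_def)
        then show "G t * indicator {0<..<T} t * (\<beta> k t - \<beta> k (t - s)) = G t * (\<beta> k t - \<beta> k (t - s))"
          by (cases "t \<in> {0<..<T}") auto
      qed
      then have "hl_inner P (\<lambda>t. \<beta> k t - \<beta> k (t - s)) = 0"
        unfolding P_def using weak[OF \<phi>] by (simp add: L2.add_left snd_L2 x0 GT dL)
      moreover have "(\<lambda>t. \<beta> k t - \<beta> k (t - s)) = \<beta> k - (\<lambda>t. \<beta> k (t - s))" by (simp add: fun_eq_iff)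
      ultimately show ?thesis
        using P test_pair_L2[OF \<beta>(1)] test_pair_L2[OF \<beta>s] by (simp add: L2.diff_right)
    qed
    then show ?thesis
      using LIMSEQ_unique lim[of 0] lim[of s] abs(3) unfolding T_def by fastforce
  qed
  have X_add: "X (b + s) = X b + X s" if b: "0 < b" and s: "0 \<le> s" for b s
  proof -
    \<comment> \<open>Bumps require a left endpoint \<open>a > 0\<close>. These points lie strictly
      between 0 and \<open>b\<close> and tend to 0, so continuity and \<open>X 0 = 0\<close> give
      additivity.\<close>
    define a where "a k = b / (real (Suc k) + 1)" for k
    have a: "0 < a k" "a k < b" for k
      unfolding a_def using b mult_strict_left_mono[of 1 "real (Suc k) + 1" b]
      by (simp_all add: pos_divide_less_eq del: of_nat_Suc)
    have a_nn: "0 \<le> a k" for k using a(1)[of k] by simp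
    have "(\<lambda>k. b * (1 / real (Suc (Suc k)))) \<longlonglongrightarrow> b * 0"
      by (intro tendsto_intros LIMSEQ_Suc[OF LIMSEQ_Suc[OF lim_1_over_n]])
    then have a0: "a \<longlonglongrightarrow> 0" unfolding a_def by (simp add: add.commute)
    have "(\<lambda>k. X (a k)) \<longlonglongrightarrow> X 0"
      by (rule continuous_on_tendsto_compose[OF X_cont a0]) (use a_nn in auto)
    moreover have "(\<lambda>k. X (a k + s)) \<longlonglongrightarrow> X (0 + s)"
      by (rule continuous_on_tendsto_compose[OF X_cont tendsto_add[OF a0 tendsto_const]])
        (use a_nn s in auto)
    ultimately have "(\<lambda>k. X b - X (a k) - X (b + s) + X (a k + s)) \<longlonglongrightarrow> X b - X 0 - X (b + s) + X (0 + s)"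
      by (intro tendsto_intros)
    moreover have "X b - X (a k) - X (b + s) + X (a k + s) = 0" for k
      using X_diff[OF a s, of k] by simp
    ultimately show ?thesis using X0 by (simp add: LIMSEQ_const_iff)
  qed
  have "(rep x has_real_derivative X 1 - G t) (at t)" if t: "0 < t" for t
  proof -
    have "((\<lambda>t. X t - J t) has_real_derivative X 1 - G t) (at t)"
      by (intro DERIV_diff additive_has_derivative X_cont X_add t J(2))
    then show ?thesis by (simp add: X_def)
  qed
  then show ?thesis using G(2,3,4) unfolding g_def by (intro exI[of _ "X 1"] exI[of _ G]) simp
qed

lemma K_zero_if_rep_zero:
  assumes x: "x \<in> H" and rep: "\<And>t. 0 < t \<Longrightarrow> rep x t = 0"
  shows "K x x = 0"
proof -
  have "AE t in half_line. (wt_fun p x t)\<^sup>2 = 0"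
    using rep_AE[OF x] unfolding AE_half_line
    by eventually_elim (use rep in \<open>simp add: wt_fun_def\<close>)
  then show ?thesis
    unfolding K_def L2_inner_same by (rule integral_eq_zero_AE)
qed

lemma rep_linear:
  assumes "x \<in> H0" "y \<in> H0"
  shows "rep (a *\<^sub>R x - b *\<^sub>R y) t = a * rep x t - b * rep y t"
  unfolding rep_def using assms
  by (simp add: snd_L2 indicator_Ioo_L2 L2.closed L2.diff_left L2.scale_left)

text \<open>Two solutions of the Volterra system with proportional initial data are proportional, so
  eigenspaces are one-dimensional.\<close>

lemma eigenvalue_simple:
  assumes u: "u \<in> H" "\<forall>y\<in>H. B u y = l * K u y"
    and v: "v \<in> H" "\<forall>y\<in>H. B v y = l * K v y"
    and orth: "K u v = 0"
  shows "K u u = 0 \<or> K v v = 0"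
proof (rule ccontr)
  assume "\<not> ?thesis"
  then have Kuv: "0 < K u u" "0 < K v v"
    using KB.K.nonneg[OF u(1)] KB.K.nonneg[OF v(1)] by auto
  have u0: "u \<in> H0" and v0: "v \<in> H0" using u v H_subset by auto
  obtain \<xi> G where "continuous_on {0..} G \<and> G 0 = 0 \<and>
    (\<forall>t>0. (rep u has_real_derivative \<xi> - G t) (at t) \<and>
      (G has_real_derivative potential l t * rep u t) (at t))"
    using eigenfunction_ode[OF u] by (elim exE)
  then have G: "continuous_on {0..} G" "G 0 = 0"
    "\<And>t. 0 < t \<Longrightarrow> (rep u has_real_derivative \<xi> - G t) (at t)"
    "\<And>t. 0 < t \<Longrightarrow> (G has_real_derivative potential l t * rep u t) (at t)"
    by simp_all
  obtain \<eta> F where "continuous_on {0..} F \<and> F 0 = 0 \<and>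
    (\<forall>t>0. (rep v has_real_derivative \<eta> - F t) (at t) \<and>
      (F has_real_derivative potential l t * rep v t) (at t))"
    using eigenfunction_ode[OF v] by (elim exE)
  then have F: "continuous_on {0..} F" "F 0 = 0"
    "\<And>t. 0 < t \<Longrightarrow> (rep v has_real_derivative \<eta> - F t) (at t)"
    "\<And>t. 0 < t \<Longrightarrow> (F has_real_derivative potential l t * rep v t) (at t)"
    by simp_all
  have zero: "K (a *\<^sub>R u - b *\<^sub>R v) (a *\<^sub>R u - b *\<^sub>R v) = 0" if ab: "a * \<xi> = b * \<eta>" for a b
  proof (rule K_zero_if_rep_zero)
    show "a *\<^sub>R u - b *\<^sub>R v \<in> H" using u v by (intro BH.closed)
    fix t :: real assume "0 < t"
    have "a * rep u t - b * rep v t = 0"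
    proof (rule linear_ode_unique[of "\<lambda>t. a * rep u t - b * rep v t" "\<lambda>t. a * G t - b * F t"])
      fix t :: real assume t: "0 < t"
      have "((\<lambda>t. a * rep u t - b * rep v t) has_real_derivative a * (\<xi> - G t) - b * (\<eta> - F t)) (at t)"
        by (intro DERIV_diff DERIV_cmult G F t)
      then show "((\<lambda>t. a * rep u t - b * rep v t) has_real_derivative - (a * G t - b * F t)) (at t)"
        using ab by (simp add: algebra_simps)
      have "((\<lambda>t. a * G t - b * F t) has_real_derivative
          a * (potential l t * rep u t) - b * (potential l t * rep v t)) (at t)"
        by (intro DERIV_diff DERIV_cmult G F t)
      then show "((\<lambda>t. a * G t - b * F t) has_real_derivative
          potential l t * (a * rep u t - b * rep v t)) (at t)"
        by (simp add: algebra_simps)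
    qed (use G F \<open>0 < t\<close> in \<open>auto intro!: continuous_intros rep_continuous u0 v0 potential_continuous\<close>)
    then show "rep (a *\<^sub>R u - b *\<^sub>R v) t = 0" by (simp add: rep_linear u0 v0)
  qed
  have expand: "K (a *\<^sub>R u - b *\<^sub>R v) (a *\<^sub>R u - b *\<^sub>R v) = a\<^sup>2 * K u u + b\<^sup>2 * K v v" for a b
    using KB.K.quad_diff[of "a *\<^sub>R u" "b *\<^sub>R v"] u v orth
    by (simp add: KB.K.bilin KB.K.quad_scale power2_eq_square)
  \<comment> \<open>The combination of \<open>u\<close> and \<open>v\<close> with coefficients
    \<eta> and \<xi> has initial slope 0, hence zero \<open>K\<close>; orthogonality separates the
    terms and gives \<open>\<xi> = 0\<close>. Then \<open>u\<close> alone has slope 0, which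
    contradicts \<open>K u u > 0\<close>.\<close>
  have "\<eta>\<^sup>2 * K u u + \<xi>\<^sup>2 * K v v = 0" using zero[of \<eta> \<xi>] expand[of \<eta> \<xi>] by (simp add: mult.commute)
  then have "\<xi> = 0"
    using Kuv by (simp add: add_nonneg_eq_0_iff)
  then show False using zero[of 1 0] expand[of 1 0] Kuv by simp
qed

text \<open>Equal consecutive eigenvalues would put two \<open>K\<close>-orthonormal vectors in one
  eigenspace; together with monotonicity this yields strict growth.\<close>

theorem simple_eigenbasis:
  obtains w :: "nat \<Rightarrow> fun_pair" and lam :: "nat \<Rightarrow> real"
  where "\<And>i. w i \<in> H" "\<And>i v. v \<in> H \<Longrightarrow> B (w i) v = lam i * K (w i) v"
    "\<And>i j. K (w i) (w j) = (if i = j then 1 else 0)"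
    "0 < lam 0" "strict_mono lam" "filterlim lam at_top sequentially"
    "\<And>v e. \<lbrakk>v \<in> H; e > 0\<rbrakk> \<Longrightarrow>
      \<exists>N c. B0.quad (v - (\<Sum>i<N. c i *\<^sub>R w i)) < e"
proof -
  show ?thesis
  proof (rule KB.eigenbasis)
    fix w :: "nat \<Rightarrow> fun_pair" and lam :: "nat \<Rightarrow> real"
    assume w: "\<And>i. w i \<in> H" "\<And>i v. v \<in> H \<Longrightarrow> B (w i) v = lam i * K (w i) v"
      "\<And>i j. K (w i) (w j) = (if i = j then 1 else 0)"
      "\<And>i. 0 < lam i" "mono lam" "filterlim lam at_top sequentially"
      "\<And>v e. \<lbrakk>v \<in> H; e > 0\<rbrakk> \<Longrightarrow>
        \<exists>N c. B0.quad (v - (\<Sum>i<N. c i *\<^sub>R w i)) < e"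
  have "lam i < lam (Suc i)" for i
  proof -
    have "lam i \<noteq> lam (Suc i)"
    proof
      assume "lam i = lam (Suc i)"
      then show False
        using eigenvalue_simple[of "w i" "lam i" "w (Suc i)"] w(1,2) w(3)[of i i]
          w(3)[of "Suc i" "Suc i"] w(3)[of i "Suc i"] by auto
    qed
    then show ?thesis using monoD[OF w(5), of i "Suc i"] by simp
  qed
  then have "strict_mono lam" by (rule strict_mono_Suc_iff[THEN iffD2, rule_format])
  from that[OF w(1,2,3) w(4) this w(6,7)] show thesis .
  qed
qed

end

section \<open>Complex-valued functions\<close>

lemma sum_fun_apply: "(\<Sum>i\<in>A. f i) x = (\<Sum>i\<in>A. f i x)"
  by (induction A rule: infinite_finite_induct) auto

lemma integral_complex_split:
  assumes "integrable M a" "integrable M b"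
  shows "(\<integral>t. of_real (a t) + \<i> * of_real (b t) \<partial>M) = Complex (\<integral>t. a t \<partial>M) (\<integral>t. b t \<partial>M)"
  using assms by (simp add: Complex_eq)

locale half_line_problem =
  fixes n :: nat and \<Lambda> :: real
  assumes n: "3 \<le> n" and \<Lambda>: "\<Lambda> < 0"

text \<open>The dimension bound gives \<open>4/n \<le> 4/3\<close>, hence a positive
  exponent.\<close>

sublocale half_line_problem \<subseteq> weighted_oscillator "cB n" "real n * \<bar>\<Lambda>\<bar>" "2 - 4 / real n"
proof
  have "4 / real n \<le> 4 / 3" using n by (intro divide_left_mono) auto
  then show "0 < 2 - 4 / real n" by simp
qed (use n \<Lambda> in \<open>auto simp: cB_def mult_pos_pos mult_pos_neg\<close>)

context half_line_problem
begin

definition re_pair :: "(real \<Rightarrow> complex) \<Rightarrow> (real \<Rightarrow> complex) \<Rightarrow> fun_pair" where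
  "re_pair v v' = (\<lambda>t. Re (v t), \<lambda>t. Re (v' t))"

definition im_pair :: "(real \<Rightarrow> complex) \<Rightarrow> (real \<Rightarrow> complex) \<Rightarrow> fun_pair" where
  "im_pair v v' = (\<lambda>t. Im (v t), \<lambda>t. Im (v' t))"

text \<open>Extended-real valued, so that it makes sense before membership in \<open>H0\<close> is
  known.\<close>

definition Bnorm2_real :: "fun_pair \<Rightarrow> ennreal" where
  "Bnorm2_real x = (\<integral>\<^sup>+t. ennreal ((B_fun x t)\<^sup>2 + (B_deriv x t)\<^sup>2) \<partial>half_line)"

lemma parts_measurable:
  assumes "fst x \<in> borel_measurable borel" "snd x \<in> borel_measurable borel"
  shows "B_fun x \<in> borel_measurable borel" "B_deriv x \<in> borel_measurable borel"
  using assms unfolding B_fun_def[abs_def] B_deriv_def[abs_def] by simp_all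

lemma Bnorm2_split:
  assumes [measurable]: "v \<in> borel_measurable borel" "v' \<in> borel_measurable borel"
  shows "Bnorm2 n \<Lambda> v v' = Bnorm2_real (re_pair v v') + Bnorm2_real (im_pair v v')"
proof -
  let ?r = "re_pair v v'" and ?i = "im_pair v v'"
  let ?f = "\<lambda>t. cB n * (norm (v' t))\<^sup>2 + real n * \<bar>\<Lambda>\<bar> * t^2 * (norm (v t))\<^sup>2"
  let ?g = "\<lambda>x t. (B_fun x t)\<^sup>2 + (B_deriv x t)\<^sup>2"
  have m [measurable]: "B_fun ?r \<in> borel_measurable borel" "B_deriv ?r \<in> borel_measurable borel"
    "B_fun ?i \<in> borel_measurable borel" "B_deriv ?i \<in> borel_measurable borel"
    by (auto intro!: parts_measurable simp: re_pair_def im_pair_def)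
  have "Bnorm2 n \<Lambda> v v' = (\<integral>\<^sup>+t. ennreal (?f t) \<partial>half_line)"
    unfolding Bnorm2_def by (rule nn_integral_half_line[symmetric]) simp
  also have "\<dots> = (\<integral>\<^sup>+t. ennreal (?g ?r t)
      + ennreal (?g ?i t) \<partial>half_line)"
  proof (rule nn_integral_cong)
    fix t
    have "(sqrt (cB n))\<^sup>2 = cB n" "(sqrt (real n * \<bar>\<Lambda>\<bar>))\<^sup>2 = real n * \<bar>\<Lambda>\<bar>"
      using c_pos \<kappa>_pos by simp_all
    then have "?f t
       = (?g ?r t)
          + (?g ?i t)"
      unfolding B_fun_def B_deriv_def re_pair_def im_pair_def fst_conv snd_conv
        power_mult_distrib cmod_power2 by (simp add: algebra_simps)
    then show "ennreal (?f t)
       = ennreal (?g ?r t)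
          + ennreal (?g ?i t)"
      by (simp only: ennreal_plus add_nonneg_nonneg zero_le_power2)
  qed
  also have "\<dots> = Bnorm2_real ?r + Bnorm2_real ?i"
    unfolding Bnorm2_real_def by (rule nn_integral_add) simp_all
  finally show ?thesis .
qed

lemma Bnorm2_real_eq:
  assumes "x \<in> H0"
  shows "Bnorm2_real x = ennreal (B x x)"
proof -
  have L: "B_fun x \<in> L2 half_line" "B_deriv x \<in> L2 half_line" using assms by (auto simp: H0_def)
  have "Bnorm2_real x = ennreal (\<integral>t. (B_fun x t)\<^sup>2 + (B_deriv x t)\<^sup>2 \<partial>half_line)"
    unfolding Bnorm2_real_def
    using L2_square_integrable[OF L(1)] L2_square_integrable[OF L(2)]
    by (intro nn_integral_eq_integral) auto
  also have "(\<integral>t. (B_fun x t)\<^sup>2 + (B_deriv x t)\<^sup>2 \<partial>half_line) = B x x"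
    unfolding B_def L2_inner_same
    using L2_square_integrable[OF L(1)] L2_square_integrable[OF L(2)]
    by (rule Bochner_Integration.integral_add)
  finally show ?thesis .
qed

lemma H0_if_Bnorm2_real_finite:
  assumes m: "fst x \<in> borel_measurable borel" "snd x \<in> borel_measurable borel"
    and fin: "Bnorm2_real x < \<infinity>"
  shows "x \<in> H0"
proof -
  have "(\<integral>\<^sup>+t. ennreal ((B_fun x t)\<^sup>2) \<partial>half_line) \<le> Bnorm2_real x"
    "(\<integral>\<^sup>+t. ennreal ((B_deriv x t)\<^sup>2) \<partial>half_line) \<le> Bnorm2_real x"
    unfolding Bnorm2_real_def by (auto intro!: nn_integral_mono ennreal_leI)
  then have "(\<integral>\<^sup>+t. ennreal ((B_fun x t)\<^sup>2) \<partial>half_line) < \<infinity>"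
    "(\<integral>\<^sup>+t. ennreal ((B_deriv x t)\<^sup>2) \<partial>half_line) < \<infinity>"
    using fin le_less_trans by blast+
  then show ?thesis
    using m parts_measurable[OF m] unfolding H0_def L2_iff_nn_integral by simp
qed

text \<open>Finite distance to a single test pair already places \<open>x\<close> in
  \<open>H0\<close>, as a difference of two of its elements; only then does \<open>B\<close> itself
  measure the distances.\<close>

lemma pair_in_H:
  assumes m: "fst x \<in> borel_measurable borel" "snd x \<in> borel_measurable borel"
    and approx: "\<And>e. e > 0 \<Longrightarrow> \<exists>f f'. test_pair f f' \<and> Bnorm2_real ((f, f') - x) < ennreal e"
  shows "x \<in> H"
proof -
  have d0: "(f, f') - x \<in> H0" if "test_pair f f'" "Bnorm2_real ((f, f') - x) < ennreal e" for f f' e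
  proof (rule H0_if_Bnorm2_real_finite)
    show "fst ((f, f') - x) \<in> borel_measurable borel" "snd ((f, f') - x) \<in> borel_measurable borel"
      using m test_pairD(6,7)[OF that(1)] by (simp_all add: fun_diff_def)
    show "Bnorm2_real ((f, f') - x) < \<infinity>" 
      by (rule less_trans[OF that(2)]) simp
  qed
  obtain f f' where f: "test_pair f f'" "Bnorm2_real ((f, f') - x) < ennreal 1" using approx[of 1] by auto
  have "(f, f') - ((f, f') - x) \<in> H0" using test_pair_H0[OF f(1)] d0[OF f] by (rule B0.closed)
  then have x0: "x \<in> H0" by simp
  show ?thesis
    unfolding H_iff
  proof (intro conjI x0 allI impI)
    fix e :: real assume e: "e > 0"
    obtain f f' where f: "test_pair f f'" "Bnorm2_real ((f, f') - x) < ennreal e" using approx[OF e] by auto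
    have "B0.quad ((f, f') - x) < e"
      using f(2) Bnorm2_real_eq[OF d0[OF f]] B0.nonneg[OF d0[OF f]] by (simp add: ennreal_less_iff)
    then show "\<exists>f f'. test_pair f f' \<and> B0.quad (x - (f, f')) < e"
      using f(1) B0.quad_diff_commute[OF test_pair_H0[OF f(1)] x0] by auto
  qed
qed

text \<open>Real and imaginary parts of the approximating test functions are real test pairs, and
  \<open>Bnorm2_split\<close> bounds each real distance by the complex one.\<close>

lemma in_H_parts:
  assumes "in_H n \<Lambda> v v'"
  shows "v \<in> borel_measurable borel" "v' \<in> borel_measurable borel"
    "re_pair v v' \<in> H" "im_pair v v' \<in> H"
proof -
  obtain \<phi> :: "nat \<Rightarrow> real \<Rightarrow> complex" where \<phi>: "\<And>k. test_fun (\<phi> k)"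
    and lim: "(\<lambda>k. Bnorm2 n \<Lambda> (\<lambda>t. \<phi> k t - v t) (\<lambda>t. vd (\<phi> k) t - v' t)) \<longlonglongrightarrow> 0"
    and m: "v \<in> borel_measurable lborel" "v' \<in> borel_measurable lborel"
    using assms unfolding in_H_def by blast
  show [measurable]: "v \<in> borel_measurable borel" "v' \<in> borel_measurable borel" using m by simp_all
  have [measurable]: "\<phi> k \<in> borel_measurable borel" "vd (\<phi> k) \<in> borel_measurable borel" for k
  proof -
    note R = test_fun_Re_Im[OF \<phi>[of k]]
    show "\<phi> k \<in> borel_measurable borel" "vd (\<phi> k) \<in> borel_measurable borel"
      using test_pairD(6,7)[OF R(1)] test_pairD(6,7)[OF R(2)]
      by (simp_all add: borel_measurable_complex_iff)
  qed
  let ?e = "\<lambda>k. Bnorm2 n \<Lambda> (\<lambda>t. \<phi> k t - v t) (\<lambda>t. vd (\<phi> k) t - v' t)"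
  have split: "?e k
      = Bnorm2_real ((\<lambda>t. Re (\<phi> k t), \<lambda>t. Re (vd (\<phi> k) t)) - re_pair v v')
        + Bnorm2_real ((\<lambda>t. Im (\<phi> k t), \<lambda>t. Im (vd (\<phi> k) t)) - im_pair v v')" for k
    by (subst Bnorm2_split) (simp_all add: re_pair_def im_pair_def fun_diff_def)
  have ex: "\<exists>k. ?e k < ennreal e" if "e > 0" for e
    using order_tendstoD(2)[OF lim, of "ennreal e"] that unfolding eventually_sequentially by auto
  have part: "x \<in> H" if m: "fst x \<in> borel_measurable borel" "snd x \<in> borel_measurable borel"
    and le: "\<And>k. \<exists>f f'. test_pair f f' \<and>
      Bnorm2_real ((f, f') - x) \<le> ?e k" for x
    using ex le by (intro pair_in_H m) (meson le_less_trans)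
  show "re_pair v v' \<in> H"
  proof (rule part)
    show "\<exists>f f'. test_pair f f' \<and> Bnorm2_real ((f, f') - re_pair v v') \<le> ?e k" for k
      unfolding split using test_fun_Re_Im(1)[OF \<phi>[of k]] by (intro exI conjI) (assumption, simp)
  qed (simp_all add: re_pair_def)
  show "im_pair v v' \<in> H"
  proof (rule part)
    show "\<exists>f f'. test_pair f f' \<and> Bnorm2_real ((f, f') - im_pair v v') \<le> ?e k" for k
      unfolding split using test_fun_Re_Im(2)[OF \<phi>[of k]] by (intro exI conjI) (assumption, simp)
  qed (simp_all add: im_pair_def)
qed

lemma Bnorm2_real_zero: "Bnorm2_real (\<lambda>_. 0, \<lambda>_. 0) = 0"
  unfolding Bnorm2_real_def B_fun_def B_deriv_def by simp

lemma in_H_of_real: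
  assumes x: "x \<in> H"
  shows "in_H n \<Lambda> (\<lambda>t. of_real (fst x t)) (\<lambda>t. of_real (snd x t))"
proof -
  have x0: "x \<in> H0" using x H_subset by blast
  note [measurable] = H_measurable[OF x0]
  obtain f f' :: "nat \<Rightarrow> real \<Rightarrow> real" where f: "\<And>k. test_pair (f k) (f' k)"
    and lim: "(\<lambda>k. B0.quad (x - (f k, f' k))) \<longlonglongrightarrow> 0"
    using H_approx[OF x] by blast
  have "Bnorm2 n \<Lambda> (\<lambda>t. of_real (f k t) - of_real (fst x t))
      (\<lambda>t. vd (\<lambda>t. of_real (f k t)) t - of_real (snd x t))
      = ennreal (B0.quad (x - (f k, f' k)))" for k
  proof -
    note [measurable] = test_pairD(6,7)[OF f[of k]]
    have d0: "(f k, f' k) - x \<in> H0" by (intro B0.closed x0 test_pair_H0 f)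
    have "Bnorm2 n \<Lambda> (\<lambda>t. of_real (f k t) - of_real (fst x t))
      (\<lambda>t. vd (\<lambda>t. of_real (f k t)) t - of_real (snd x t))
      = Bnorm2_real ((f k, f' k) - x)"
      unfolding test_pair_vd[OF f[of k]]
      by (subst Bnorm2_split)
        (simp_all add: re_pair_def im_pair_def Bnorm2_real_zero, simp add: minus_prod_def fun_diff_def)
    also have "\<dots> = ennreal (B0.quad (x - (f k, f' k)))"
      using Bnorm2_real_eq[OF d0] B0.quad_diff_commute[OF x0 test_pair_H0[OF f]] by simp
    finally show ?thesis .
  qed
  moreover have "(\<lambda>k. ennreal (B0.quad (x - (f k, f' k)))) \<longlonglongrightarrow> 0"
    using tendsto_ennrealI[OF lim] by simp
  ultimately show ?thesis
    unfolding in_H_def using f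
    by (intro conjI exI[of _ "\<lambda>k t. complex_of_real (f k t)"]) (auto simp: test_pair_def)
qed

text \<open>For a real first argument conjugation is trivial, so the complex form splits into two
  real ones. Testing the eigenvalue equation against complex elements thus reduces to the real
  case.\<close>

lemma formB_of_real:
  assumes x: "x \<in> H" and v: "in_H n \<Lambda> v v'"
  shows "formB n \<Lambda> (\<lambda>t. of_real (fst x t)) (\<lambda>t. of_real (snd x t)) v v'
    = Complex (B x (re_pair v v')) (B x (im_pair v v'))"
proof -
  note V = in_H_parts[OF v]
  have x0: "x \<in> H0" and r0: "re_pair v v' \<in> H0" and i0: "im_pair v v' \<in> H0"
    using x V H_subset by auto
  note [measurable] = H_measurable[OF x0] V(1,2)
  have int: "integrable half_line (\<lambda>t. B_fun x t * B_fun y t)"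
    "integrable half_line (\<lambda>t. B_deriv x t * B_deriv y t)" if "y \<in> H0" for y
    using x0 that by (auto simp: H0_def intro!: L2_mult_integrable)
  have B_eq: "B x y = (\<integral>t. B_fun x t * B_fun y t + B_deriv x t * B_deriv y t \<partial>half_line)" if "y \<in> H0" for y
    unfolding B_def L2_inner_def using int[OF that] by simp
  have sq: "sqrt (cB n) * sqrt (cB n) = cB n" "sqrt (real n * \<bar>\<Lambda>\<bar>) * sqrt (real n * \<bar>\<Lambda>\<bar>) = real n * \<bar>\<Lambda>\<bar>"
    using c_pos \<kappa>_pos by simp_all
  have rearrange: "r * d * (r * e) = k * (d * e)" if "r * r = k" for r k d e :: real
    unfolding that[symmetric] by (simp only: mult_ac)
  have B_parts: "B_fun x t * B_fun y t = real n * \<bar>\<Lambda>\<bar> * t\<^sup>2 * (fst x t * fst y t)"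
    "B_deriv x t * B_deriv y t = cB n * (snd x t * snd y t)" for y t
    using rearrange[OF sq(2), of "t * fst x t" "t * fst y t"] rearrange[OF sq(1), of "snd x t" "snd y t"]
    unfolding B_fun_def B_deriv_def power2_eq_square by (simp_all only: mult_ac)
  have "formB n \<Lambda> (\<lambda>t. of_real (fst x t)) (\<lambda>t. of_real (snd x t)) v v'
    = (\<integral>t. of_real (cB n) * cnj (of_real (snd x t)) * v' t
         + of_real (real n * \<bar>\<Lambda>\<bar> * t^2) * cnj (of_real (fst x t)) * v t \<partial>half_line)"
    unfolding formB_def by (rule integral_half_line[symmetric]) simp
  also have "\<dots> = (\<integral>t. of_real (B_fun x t * B_fun (re_pair v v') t + B_deriv x t * B_deriv (re_pair v v') t)
       + \<i> * of_real (B_fun x t * B_fun (im_pair v v') t + B_deriv x t * B_deriv (im_pair v v') t) \<partial>half_line)"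
    by (rule Bochner_Integration.integral_cong[OF refl], unfold B_parts)
      (simp add: complex_eq_iff re_pair_def im_pair_def algebra_simps)
  also have "\<dots> = Complex (B x (re_pair v v')) (B x (im_pair v v'))"
    unfolding B_eq[OF r0] B_eq[OF i0]
    by (intro integral_complex_split Bochner_Integration.integrable_add int r0 i0)
  finally show ?thesis .
qed

lemma formK_of_real:
  assumes x: "x \<in> H" and v: "in_H n \<Lambda> v v'"
  shows "formK n (\<lambda>t. of_real (fst x t)) v = Complex (K x (re_pair v v')) (K x (im_pair v v'))"
proof -
  let ?p = "2 - 4 / real n"
  note V = in_H_parts[OF v]
  note [measurable] = H_measurable(1)[OF subsetD[OF H_subset x]] V(1)
  have int: "integrable half_line (\<lambda>t. wt_fun ?p x t * wt_fun ?p y t)" if "y \<in> H" for y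
    using p_pos p_less by (intro L2_mult_integrable wt_fun_L2 x that) auto
  have "formK n (\<lambda>t. of_real (fst x t)) v
    = (\<integral>t. of_real (t powr ?p) * cnj (of_real (fst x t)) * v t \<partial>half_line)"
    unfolding formK_def by (rule integral_half_line[symmetric]) simp
  also have "\<dots> = (\<integral>t. of_real (wt_fun ?p x t * wt_fun ?p (re_pair v v') t)
       + \<i> * of_real (wt_fun ?p x t * wt_fun ?p (im_pair v v') t) \<partial>half_line)"
  proof (rule integral_cong_AE)
    show "AE t in half_line. of_real (t powr ?p) * cnj (of_real (fst x t)) * v t
       = of_real (wt_fun ?p x t * wt_fun ?p (re_pair v v') t)
       + \<i> * of_real (wt_fun ?p x t * wt_fun ?p (im_pair v v') t)"
      unfolding AE_half_line
    proof (intro AE_I2 impI)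
      fix t :: real assume t: "0 < t"
      have "t powr ?p = t powr (?p / 2) * t powr (?p / 2)" by (simp add: powr_add[symmetric])
      then have "wt_fun ?p x t * wt_fun ?p y t = t powr ?p * (fst x t * fst y t)" for y
        unfolding wt_fun_def by (simp only: mult_ac)
      then show "of_real (t powr ?p) * cnj (of_real (fst x t)) * v t
       = of_real (wt_fun ?p x t * wt_fun ?p (re_pair v v') t)
       + \<i> * of_real (wt_fun ?p x t * wt_fun ?p (im_pair v v') t)"
        by (simp add: complex_eq_iff re_pair_def im_pair_def)
    qed
  qed (simp_all add: wt_fun_def re_pair_def im_pair_def)
  also have "\<dots> = Complex (K x (re_pair v v')) (K x (im_pair v v'))"
    unfolding K_def L2_inner_def by (intro integral_complex_split int V(3,4))
  finally show ?thesis .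
qed

section \<open>Approximation by complex combinations of the eigenfunctions\<close>

text \<open>Padding with zero coefficients brings the expansions of real and imaginary parts to a
  common length.\<close>

lemma sum_extend:
  fixes f :: "nat \<Rightarrow> 'a::real_vector"
  assumes "M \<le> N"
  shows "(\<Sum>i<N. (if i < M then c i else 0) *\<^sub>R f i) = (\<Sum>i<M. c i *\<^sub>R f i)"
  using assms by (intro sum.mono_neutral_cong_right) auto

text \<open>A function in \<open>L2\<close> need not lie in the form domain, so it is first replaced
  by a test function. That one is approximated in the \<open>B\<close>-norm, which dominates the
  \<open>L2\<close>-norm with the constant \<open>?C\<close> of \<open>fst_L2\<close>.\<close>

lemma L2_approx_by_basis:
  fixes w :: "nat \<Rightarrow> fun_pair"
  assumes wH: "\<And>i. w i \<in> H"
    and w: "\<And>v e. \<lbrakk>v \<in> H; e > 0\<rbrakk> \<Longrightarrow>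
      \<exists>N c. B0.quad (v - (\<Sum>i<N. c i *\<^sub>R w i)) < e"
    and v: "v \<in> L2 half_line" and e: "e > 0"
  shows "\<exists>N c. hl_sq (v - (\<Sum>i<N. c i *\<^sub>R fst (w i))) < e"
proof -
  obtain f f' where f: "test_pair f f'" "hl_sq (v - f) < e / 4"
    using test_functions_dense_L2[OF v] e
    unfolding test_closure_def L2.form_closure_def test_functions_def by (auto dest: spec[of _ "e / 4"])
  let ?C = "1 / (real n * \<bar>\<Lambda>\<bar>) + 1 / cB n"
  have C: "0 < ?C" using c_pos \<kappa>_pos by (simp add: add_pos_pos)
  then have "0 < e / 4 / ?C" using e by simp
  from w[OF test_pair_H[OF f(1)] this] obtain N c where
    Nc: "B0.quad ((f, f') - (\<Sum>i<N. c i *\<^sub>R w i)) < e / 4 / ?C" by blast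
  let ?d = "(f, f') - (\<Sum>i<N. c i *\<^sub>R w i)"
  have dH: "?d \<in> H" by (intro BH.closed wH test_pair_H[OF f(1)])
  have fst_d: "fst ?d = f - (\<Sum>i<N. c i *\<^sub>R fst (w i))" by (simp add: fst_sum)
  have "hl_sq (fst ?d) \<le> ?C * B ?d ?d" by (rule fst_L2(2)[OF dH])
  also have "\<dots> < e / 4" using Nc C by (simp only: pos_less_divide_eq mult.commute)
  finally have small: "hl_sq (fst ?d) < e / 4" .
  have "hl_sq ((v - f) + fst ?d)
      \<le> 2 * hl_sq (v - f) + 2 * hl_sq (fst ?d)"
    by (intro L2.quad_add_le L2.closed v test_pair_L2[OF f(1)] fst_L2 dH)
  also have "\<dots> < e" using f(2) small e by linarith
  finally show ?thesis unfolding fst_d by (intro exI[of _ N] exI[of _ c]) simp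
qed

lemma Bnorm2_approx_by_basis:
  fixes w :: "nat \<Rightarrow> fun_pair"
  assumes wH: "\<And>i. w i \<in> H"
    and w: "\<And>v e. \<lbrakk>v \<in> H; e > 0\<rbrakk> \<Longrightarrow>
      \<exists>N c. B0.quad (v - (\<Sum>i<N. c i *\<^sub>R w i)) < e"
    and v: "in_H n \<Lambda> v v'" and e: "e > 0"
  shows "\<exists>N c. Bnorm2 n \<Lambda> (\<lambda>t. v t - (\<Sum>i<N. c i * of_real (fst (w i) t)))
      (\<lambda>t. v' t - (\<Sum>i<N. c i * of_real (snd (w i) t))) < ennreal e"
proof -
  note V = in_H_parts[OF v]
  have w0: "w i \<in> H0" for i using wH H_subset by blast
  note [measurable] = V(1,2) H_measurable[OF w0]
  have e2: "e / 2 > 0" using e by simp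
  obtain N1 a where a: "B0.quad (re_pair v v' - (\<Sum>i<N1. a i *\<^sub>R w i)) < e / 2"
    using w[OF V(3) e2] by blast
  obtain N2 b where b: "B0.quad (im_pair v v' - (\<Sum>i<N2. b i *\<^sub>R w i)) < e / 2"
    using w[OF V(4) e2] by blast
  define N where "N = max N1 N2"
  \<comment> \<open>The two real expansions become the real and imaginary parts of one complex
    coefficient sequence, the shorter one padded by zeros.\<close>
  define c where "c i = Complex (if i < N1 then a i else 0) (if i < N2 then b i else 0)" for i
  let ?R = "re_pair v v' - (\<Sum>i<N1. a i *\<^sub>R w i)" and ?I = "im_pair v v' - (\<Sum>i<N2. b i *\<^sub>R w i)"
  let ?v = "\<lambda>t. v t - (\<Sum>i<N. c i * of_real (fst (w i) t))"
    and ?v' = "\<lambda>t. v' t - (\<Sum>i<N. c i * of_real (snd (w i) t))"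
  have re: "re_pair ?v
      ?v'
      = ?R"
    unfolding sum_extend[of N1 N, unfolded N_def, simplified, symmetric]
    by (simp add: prod_eq_iff re_pair_def fun_eq_iff fst_sum snd_sum sum_fun_apply c_def N_def)
  have im: "im_pair ?v
      ?v'
      = ?I"
    unfolding sum_extend[of N2 N, unfolded N_def, simplified, symmetric]
    by (simp add: prod_eq_iff im_pair_def fun_eq_iff fst_sum snd_sum sum_fun_apply c_def N_def)
  have R0: "?R \<in> H0" "?I \<in> H0"
    using V(3,4) H_subset by (auto intro!: B0.closed w0)
  have "Bnorm2 n \<Lambda> ?v
      ?v'
    = ennreal (B0.quad ?R)
      + ennreal (B0.quad ?I)"
    by (subst Bnorm2_split) (simp_all add: re im Bnorm2_real_eq R0)
  also have "\<dots> = ennreal (B0.quad ?R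
      + B0.quad ?I)"
    using B0.nonneg R0 by simp
  also have "\<dots> < ennreal e"
    using a b e by (intro ennreal_lessI) auto
  finally show ?thesis by blast
qed

lemma complex_L2_approx_by_basis:
  fixes w :: "nat \<Rightarrow> fun_pair" and v :: "real \<Rightarrow> complex"
  assumes wH: "\<And>i. w i \<in> H"
    and w: "\<And>v e. \<lbrakk>v \<in> H; e > 0\<rbrakk> \<Longrightarrow>
      \<exists>N c. B0.quad (v - (\<Sum>i<N. c i *\<^sub>R w i)) < e"
    and vm: "v \<in> borel_measurable lborel"
    and fin: "(\<integral>\<^sup>+ t\<in>{0<..}. ennreal ((norm (v t))\<^sup>2) \<partial>lborel) < \<infinity>" and e: "e > 0"
  shows "\<exists>N c. (\<integral>\<^sup>+ t\<in>{0<..}. ennreal ((norm (v t - (\<Sum>i<N. c i * of_real (fst (w i) t))))\<^sup>2) \<partial>lborel)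
    < ennreal e"
proof -
  have [measurable]: "v \<in> borel_measurable borel" using vm by simp
  have w0: "w i \<in> H0" for i using wH H_subset by blast
  note [measurable] = H_measurable(1)[OF w0]
  have norm2: "(\<integral>\<^sup>+ t\<in>{0<..}. ennreal ((norm (u t))\<^sup>2) \<partial>lborel)
      = (\<integral>\<^sup>+ t. ennreal ((Re (u t))\<^sup>2) \<partial>half_line) + (\<integral>\<^sup>+ t. ennreal ((Im (u t))\<^sup>2) \<partial>half_line)"
    if [measurable]: "u \<in> borel_measurable borel" for u :: "real \<Rightarrow> complex"
  proof -
    have "(\<integral>\<^sup>+ t\<in>{0<..}. ennreal ((norm (u t))\<^sup>2) \<partial>lborel) = (\<integral>\<^sup>+ t. ennreal ((norm (u t))\<^sup>2) \<partial>half_line)"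
      by (rule nn_integral_half_line[symmetric]) simp
    also have "\<dots> = (\<integral>\<^sup>+ t. ennreal ((Re (u t))\<^sup>2) + ennreal ((Im (u t))\<^sup>2) \<partial>half_line)"
      by (simp add: cmod_power2)
    finally show ?thesis by (subst (asm) nn_integral_add) auto
  qed
  have L: "(\<lambda>t. Re (v t)) \<in> L2 half_line" "(\<lambda>t. Im (v t)) \<in> L2 half_line"
    using fin unfolding norm2[of v, simplified] L2_iff_nn_integral by auto
  have e2: "e / 2 > 0" using e by simp
  let ?v1 = "\<lambda>t. Re (v t)" and ?v2 = "\<lambda>t. Im (v t)"
  obtain N1 a where a: "hl_sq (?v1 - (\<Sum>i<N1. a i *\<^sub>R fst (w i))) < e / 2"
    using L2_approx_by_basis[OF wH w L(1) e2] by blast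
  obtain N2 b where b: "hl_sq (?v2 - (\<Sum>i<N2. b i *\<^sub>R fst (w i))) < e / 2"
    using L2_approx_by_basis[OF wH w L(2) e2] by blast
  let ?R = "?v1 - (\<Sum>i<N1. a i *\<^sub>R fst (w i))" and ?I = "?v2 - (\<Sum>i<N2. b i *\<^sub>R fst (w i))"
  define N where "N = max N1 N2"
  define c where "c i = Complex (if i < N1 then a i else 0) (if i < N2 then b i else 0)" for i
  define u where "u t = v t - (\<Sum>i<N. c i * of_real (fst (w i) t))" for t
  have [measurable]: "u \<in> borel_measurable borel" unfolding u_def by simp
  have re: "Re (u t) = ?R t" for t
    unfolding sum_extend[of N1 N, unfolded N_def, simplified, symmetric]
    by (simp add: u_def sum_fun_apply c_def N_def)
  have im: "Im (u t) = ?I t" for t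
    unfolding sum_extend[of N2 N, unfolded N_def, simplified, symmetric]
    by (simp add: u_def sum_fun_apply c_def N_def)
  have R: "?R \<in> L2 half_line" "?I \<in> L2 half_line"
    by (intro L2.closed L fst_L2 wH)+
  have "(\<integral>\<^sup>+ t\<in>{0<..}. ennreal ((norm (u t))\<^sup>2) \<partial>lborel)
    = ennreal (hl_sq ?R)
      + ennreal (hl_sq ?I)"
    unfolding norm2[of u, simplified] re im L2_nn_integral[OF R(1)] L2_nn_integral[OF R(2)] L2_inner_same ..
  also have "\<dots> = ennreal (hl_sq ?R
      + hl_sq ?I)"
    using L2.nonneg[OF R(1)] L2.nonneg[OF R(2)] by (rule ennreal_plus[symmetric])
  also have "\<dots> < ennreal e"
    using a b e by (intro ennreal_lessI) auto
  finally show ?thesis unfolding u_def by blast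
qed

end

theorem theorem3p2:
  fixes n :: nat and \<Lambda> :: real
  assumes "n \<ge> 3" and "\<Lambda> < 0"
  shows "\<exists>(w :: nat \<Rightarrow> real \<Rightarrow> complex) (w' :: nat \<Rightarrow> real \<Rightarrow> complex) (lam :: nat \<Rightarrow> real).
     (\<forall>i. in_H n \<Lambda> (w i) (w' i)) \<and>
     (\<forall>i \<phi> \<phi>'. in_H n \<Lambda> \<phi> \<phi>' \<longrightarrow>
        formB n \<Lambda> (w i) (w' i) \<phi> \<phi>' = of_real (lam i) * formK n (w i) \<phi>) \<and>
     0 < lam 0 \<and> strict_mono lam \<and> filterlim lam at_top sequentially \<and>
     (\<forall>i j. formK n (w i) (w j) = (if i = j then 1 else 0)) \<and>
     (\<forall>v v'. in_H n \<Lambda> v v' \<longrightarrow> (\<forall>\<epsilon>>0. \<exists>N (c :: nat \<Rightarrow> complex).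
        Bnorm2 n \<Lambda> (\<lambda>t. v t - (\<Sum>i<N. c i * w i t)) (\<lambda>t. v' t - (\<Sum>i<N. c i * w' i t))
          < ennreal \<epsilon>)) \<and>
     (\<forall>v :: real \<Rightarrow> complex. v \<in> borel_measurable lborel \<longrightarrow>
        (\<integral>\<^sup>+ t\<in>{0<..}. ennreal ((norm (v t))^2) \<partial>lborel) < \<infinity> \<longrightarrow>
        (\<forall>\<epsilon>>0. \<exists>N (c :: nat \<Rightarrow> complex).
           (\<integral>\<^sup>+ t\<in>{0<..}. ennreal ((norm (v t - (\<Sum>i<N. c i * w i t)))^2) \<partial>lborel) < ennreal \<epsilon>))"
proof -
  interpret half_line_problem n \<Lambda> by standard (use assms in auto)
  show ?thesis
  proof (rule simple_eigenbasis)
    fix w :: "nat \<Rightarrow> fun_pair" and lam :: "nat \<Rightarrow> real"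
    assume wH: "\<And>i. w i \<in> H" and eig: "\<And>i v. v \<in> H \<Longrightarrow> B (w i) v = lam i * K (w i) v"
      and orth: "\<And>i j. K (w i) (w j) = (if i = j then 1 else 0)"
      and lam: "0 < lam 0" "strict_mono lam" "filterlim lam at_top sequentially"
      and approx: "\<And>v e. \<lbrakk>v \<in> H; e > 0\<rbrakk> \<Longrightarrow>
        \<exists>N c. B0.quad (v - (\<Sum>i<N. c i *\<^sub>R w i)) < e"
    let ?w = "\<lambda>i t. complex_of_real (fst (w i) t)" and ?w' = "\<lambda>i t. complex_of_real (snd (w i) t)"
    have in_H: "in_H n \<Lambda> (?w i) (?w' i)" for i by (rule in_H_of_real[OF wH])
    have eigen: "formB n \<Lambda> (?w i) (?w' i) \<phi> \<phi>' = of_real (lam i) * formK n (?w i) \<phi>"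
      if "in_H n \<Lambda> \<phi> \<phi>'" for i \<phi> \<phi>'
      using in_H_parts(3,4)[OF that]
      by (simp add: formB_of_real[OF wH that] formK_of_real[OF wH that] eig complex_eq_iff)
    have ortho: "formK n (?w i) (?w j) = (if i = j then 1 else 0)" for i j
    proof -
      have "re_pair (?w j) (?w' j) = w j" "im_pair (?w j) (?w' j) = 0"
        by (simp_all add: re_pair_def im_pair_def zero_prod_def zero_fun_def)
      then show ?thesis
        using KB.K.zero_right[OF wH] by (simp add: formK_of_real[OF wH in_H] orth complex_eq_iff)
    qed
    show ?thesis
      by (intro exI[of _ ?w] exI[of _ ?w'] exI[of _ lam] conjI allI impI in_H eigen lam ortho
          Bnorm2_approx_by_basis[of w, OF wH approx] complex_L2_approx_by_basis[of w, OF wH approx])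
  qed
qed

end
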